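(* The Kadec-Klee property and the uniform Kadec-Klee property are equivalent for real JB$^*$-triples; that is, a real JB$^*$-triple $A$ has the Kadec-Klee property if and only if it has the uniform Kadec-Klee property.
   Context: JB$^*$-triple: a complex Banach space $E$ with a continuous triple product $\{\cdot,\cdot,\cdot\}:E\times E\times E\to E$ which is bilinear and symmetric in the outer variables and conjugate linear in the middle one, such that, writing $L(a,b)x=\{a,b,x\}$: (1) $L(a,b)\{x,y,z\}=\{L(a,b)x,y,z\}-\{x,L(b,a)y,z\}+\{x,y,L(a,b)z\}$ for all $a,b,x,y,z\in E$; (2) $L(a,a)$ is a hermitian operator with non-negative spectrum for every $a\in E$; (3) $\|\{a,a,a\}\|=\|a\|^3$ for every $a\in E$. Real JB$^*$-triple: a closed real linear subspace $A$ of a JB$^*$-triple $E$ which is closed under the triple product of $E$. Equivalently, the set $E^\tau=\{x\in E:\tau(x)=x\}$ of fixed points of a conjugation $\tau$ (conjugate linear isometry of order 2) on a JB$^*$-triple $E$. It is viewed as a real Banach space with the inherited norm. Kadec-Klee property (KKP) of a Banach space $X$: every sequence in the unit sphere of $X$ which converges weakly to a point of the unit sphere converges to it in norm. Uniform Kadec-Klee (UKK) property of $X$: for a sequence $(x_n)$ put $\mathrm{sep}(x_n)=\inf\{\|x_n-x_m\|:n\neq m\}$; for each $\varepsilon>0$ there exists $\delta>0$ such that every sequence $(x_n)$ in the closed unit ball of $X$ with $\mathrm{sep}(x_n)\geq\varepsilon$ and $x_n\to x$ weakly satisfies $\|x\|<1-\delta$. *)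

theory Defs
  imports "HOL-Analysis.Analysis"
begin

section \<open>Complex Banach spaces\<close>

text \<open>
  The library has no type class of complex normed spaces. A complex Banach space is therefore a
  type of class \<^class>\<open>banach\<close> together with a complex scalar multiplication that extends the real
  one and for which the norm is absolutely homogeneous.
\<close>

locale complex_banach = vector_space scaleC
  for scaleC :: "complex \<Rightarrow> 'e::banach \<Rightarrow> 'e" (infixr \<open>*\<^sub>C\<close> 75) +
  assumes scaleC_of_real: "complex_of_real r *\<^sub>C x = r *\<^sub>R x"
    and norm_scaleC: "norm (c *\<^sub>C x) = cmod c * norm x"

definition bounded_clinear :: "(complex \<Rightarrow> 'e::banach \<Rightarrow> 'e) \<Rightarrow> ('e \<Rightarrow> 'e) \<Rightarrow> bool" where
  "bounded_clinear scaleC T \<longleftrightarrow> Vector_Spaces.linear scaleC scaleC T \<and> bounded_linear T"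

definition op_spectrum :: "(complex \<Rightarrow> 'e::banach \<Rightarrow> 'e) \<Rightarrow> ('e \<Rightarrow> 'e) \<Rightarrow> complex set" where
  "op_spectrum scaleC T = {\<mu>. \<not> (\<exists>S. bounded_clinear scaleC S \<and>
     S \<circ> (\<lambda>x. scaleC \<mu> x - T x) = id \<and> (\<lambda>x. scaleC \<mu> x - T x) \<circ> S = id)}"

definition op_exp :: "('e::banach \<Rightarrow> 'e) \<Rightarrow> 'e \<Rightarrow> 'e" where
  "op_exp T x = (\<Sum>n. (T ^^ n) x /\<^sub>R fact n)"

text \<open>
  A bounded operator \<open>T\<close> is hermitian if every \<open>exp (i t T)\<close>, \<open>t\<close> real, is an isometry. As
  \<open>exp (- i t T)\<close> is the inverse of \<open>exp (i t T)\<close>, on a nonzero space this says that these operators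
  have norm one.
\<close>

definition hermitian_op :: "(complex \<Rightarrow> 'e::banach \<Rightarrow> 'e) \<Rightarrow> ('e \<Rightarrow> 'e) \<Rightarrow> bool" where
  "hermitian_op scaleC T \<longleftrightarrow> bounded_clinear scaleC T \<and>
     (\<forall>t::real. \<forall>x. norm (op_exp (\<lambda>y. scaleC (\<i> * complex_of_real t) (T y)) x) = norm x)"


section \<open>Complex and real JB*-triples\<close>

text \<open>\<open>triple a b x\<close> is the triple product \<open>{a, b, x}\<close>; thus \<open>triple a b\<close> is the operator \<open>L(a, b)\<close>.\<close>

locale jb_star_triple = complex_banach scaleC
  for scaleC :: "complex \<Rightarrow> 'e::banach \<Rightarrow> 'e" (infixr \<open>*\<^sub>C\<close> 75) +
  fixes triple :: "'e \<Rightarrow> 'e \<Rightarrow> 'e \<Rightarrow> 'e"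
  assumes triple_continuous: "continuous_on UNIV (\<lambda>(x, y, z). triple x y z)"
    and triple_commute: "triple x y z = triple z y x"
    and triple_add_left: "triple (x + x') y z = triple x y z + triple x' y z"
    and triple_scaleC_left: "triple (c *\<^sub>C x) y z = c *\<^sub>C triple x y z"
    and triple_add_middle: "triple x (y + y') z = triple x y z + triple x y' z"
    and triple_scaleC_middle: "triple x (c *\<^sub>C y) z = cnj c *\<^sub>C triple x y z"
    and triple_add_right: "triple x y (z + z') = triple x y z + triple x y z'"
    and triple_scaleC_right: "triple x y (c *\<^sub>C z) = c *\<^sub>C triple x y z"
    and jordan_identity:
      "triple a b (triple x y z) =
         triple (triple a b x) y z - triple x (triple b a y) z + triple x y (triple a b z)"
    and hermitian: "hermitian_op scaleC (triple a a)"
    and spectrum_nonneg: "op_spectrum scaleC (triple a a) \<subseteq> complex_of_real ` {0..}"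
    and norm_cube: "norm (triple a a a) = norm a ^ 3"

locale real_jb_star_triple = jb_star_triple scaleC triple
  for scaleC :: "complex \<Rightarrow> 'e::banach \<Rightarrow> 'e" (infixr \<open>*\<^sub>C\<close> 75)
    and triple :: "'e \<Rightarrow> 'e \<Rightarrow> 'e \<Rightarrow> 'e" +
  fixes A :: "'e set"
  assumes subspace_A: "Real_Vector_Spaces.subspace A"
    and closed_A: "closed A"
    and triple_closed: "\<lbrakk>x \<in> A; y \<in> A; z \<in> A\<rbrakk> \<Longrightarrow> triple x y z \<in> A"


section \<open>Kadec-Klee properties\<close>

text \<open>
  The following notions are those of the real normed space \<open>A\<close>, a real linear subspace of the
  ambient type with the inherited norm. Functionals are functions on the ambient type of which only
  the values on \<open>A\<close> matter, so weak convergence is intrinsic to \<open>A\<close>.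
\<close>

definition dual_on :: "'e::real_normed_vector set \<Rightarrow> ('e \<Rightarrow> real) set" where
  "dual_on A = {f. (\<forall>x\<in>A. \<forall>y\<in>A. f (x + y) = f x + f y) \<and>
                   (\<forall>r. \<forall>x\<in>A. f (r *\<^sub>R x) = r * f x) \<and>
                   (\<exists>K. \<forall>x\<in>A. \<bar>f x\<bar> \<le> K * norm x)}"

definition weakly_tendsto_on ::
  "'e::real_normed_vector set \<Rightarrow> (nat \<Rightarrow> 'e) \<Rightarrow> 'e \<Rightarrow> bool" where
  "weakly_tendsto_on A x l \<longleftrightarrow> (\<forall>f\<in>dual_on A. (\<lambda>n. f (x n)) \<longlonglongrightarrow> f l)"

definition kadec_klee :: "'e::real_normed_vector set \<Rightarrow> bool" where
  "kadec_klee A \<longleftrightarrow>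
     (\<forall>x l. (\<forall>n. x n \<in> A \<and> norm (x n) = 1) \<and> l \<in> A \<and> norm l = 1 \<and> weakly_tendsto_on A x l
        \<longrightarrow> x \<longlonglongrightarrow> l)"

definition sep :: "(nat \<Rightarrow> 'e::real_normed_vector) \<Rightarrow> real" where
  "sep x = (INF (n, m)\<in>{(n, m). n \<noteq> m}. norm (x n - x m))"

definition uniform_kadec_klee :: "'e::real_normed_vector set \<Rightarrow> bool" where
  "uniform_kadec_klee A \<longleftrightarrow>
     (\<forall>\<epsilon>>0. \<exists>\<delta>>0. \<forall>x l. (\<forall>n. x n \<in> A \<and> norm (x n) \<le> 1) \<and> sep x \<ge> \<epsilon> \<and>
        l \<in> A \<and> weakly_tendsto_on A x l \<longrightarrow> norm l < 1 - \<delta>)"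

end

theory Submission
  imports Defs
    "HOL-Library.Diagonal_Subsequence"
    "HOL-Computational_Algebra.Fundamental_Theorem_Algebra"
begin

text \<open>
  That the uniform property implies the Kadec-Klee property holds in every Banach space: a weakly
  convergent sequence without norm convergent subsequences has a separated subsequence.

  Conversely let \<open>A\<close> have the Kadec-Klee property and let \<open>a \<in> A\<close> have norm one. The spectrum
  axiom and \<open>\<parallel>{x, x, x}\<parallel> = \<parallel>x\<parallel>\<^sup>3\<close> give a contractive odd functional calculus at \<open>a\<close>, and the
  Kadec-Klee property forces the odd powers of \<open>a\<close> to converge, to a tripotent \<open>e\<close> with
  \<open>a - e\<close> orthogonal to \<open>e\<close>. As there is no infinite orthogonal sequence of tripotents,
  every element of \<open>A\<close> is a finite combination of orthogonal tripotents, and every tripotent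
  dominates a minimal one.

  Let \<open>x n\<close> converge weakly to \<open>l\<close>, and write \<open>l = \<parallel>l\<parallel> e + l'\<close> with \<open>e\<close> minimal and \<open>l'\<close>
  orthogonal to \<open>e\<close>. The Peirce 0-components of \<open>x n - l\<close> tend to \<open>0\<close> in norm, since \<open>\<parallel>e + w\<parallel> = 1\<close>
  for \<open>w\<close> in the unit ball of the Peirce 0-space. The other components are controlled by
  \<open>\<alpha>\<^sup>2 + \<parallel>s\<parallel>\<^sup>2 + \<parallel>v\<parallel>\<^sup>2 / 2 \<le> \<parallel>z\<parallel>\<^sup>2\<close> for \<open>z = \<alpha> e + s + v + w\<close>, where \<open>s\<close> is the skew part in the Peirce
  1-space and \<open>v\<close> the Peirce 1/2-component. So \<open>x n\<close> cannot be separated if \<open>\<parallel>l\<parallel>\<close> is close to one.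
\<close>

text \<open>The norm axiom speaks only of cubes of single elements, so estimates are obtained by
  iteration: k-fold cubing turns \<open>norm x\<close> into \<open>norm x ^ 3 ^ k\<close>, and by
  \<open>power3_cube_le\<close> an estimate that holds for all iterates with a fixed constant holds
  with constant 1. The spectrum axiom confines the spectrum of L(a, a) to the half-line t >= 0 but
  gives no upper bound, so functions are compared on the whole half-line; hence bounds of the form
  \<open>max 1 (t ^ D)\<close>, whose second term is harmless because the odd powers of a stay in
  the unit ball when a does. The real setting shapes the second half: minimality of e forces only
  the part of the Peirce 1-space fixed by x -> {e, x, e} to be one-dimensional. The skew part can be
  infinite-dimensional, as in a real Hilbert space inside a spin factor, and weakly null sequences
  need not be norm null there. This is why a quantitative inequality replaces norm convergence for
  the skew and Peirce 1/2 parts, and why \<open>norm l\<close> close to one is what makes them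
  small.\<close>

lemma power3_cube_le:
  fixes a b C :: real
  assumes "a \<ge> 0" "b \<ge> 0" and le: "\<And>k::nat. k \<ge> N \<Longrightarrow> a ^ (3 ^ k) \<le> C * b ^ (3 ^ k)"
  shows "a \<le> b"
proof (rule ccontr)
  assume "\<not> a \<le> b"
  then have "b < a" by simp
  show False
  proof (cases "b = 0")
    case True
    then have "a ^ 3 ^ N \<le> 0" using le[of N] by (simp add: power_0_left)
    moreover have "a ^ 3 ^ N > 0" using True \<open>b < a\<close> by simp
    ultimately show False by linarith
  next
    case False
    with assms have "b > 0" by simp
    then have "a / b > 1" using \<open>b < a\<close> by simp
    then obtain n where n: "C < (a / b) ^ n" using real_arch_pow by blast
    have "m < 3 ^ m" for m :: nat by (induction m) auto
    from this[of "max n N"] have "n \<le> 3 ^ max n N" by linarith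
    then have "(a / b) ^ n \<le> (a / b) ^ (3 ^ max n N)"
      using \<open>a / b > 1\<close> by (intro power_increasing) auto
    also have "\<dots> \<le> C"
      using le[of "max n N"] \<open>b > 0\<close> by (simp add: power_divide divide_simps mult.commute)
    finally show False using n by simp
  qed
qed

lemma scaleR_3: "3 *\<^sub>R x = x + x + (x :: 'a::real_vector)"
  and scaleR_4: "4 *\<^sub>R x = x + x + x + x"
  using scaleR_left_distrib[of 2 1 x] scaleR_left_distrib[of 2 2 x]
  by (simp_all add: scaleR_2 algebra_simps)

section \<open>Scalars, trilinearity and boundedness of the triple product\<close>

context complex_banach
begin

lemma scaleR_eq_scaleC: "r *\<^sub>R x = complex_of_real r *\<^sub>C x"
  by (simp add: scaleC_of_real)

lemma bounded_linear_scaleC_left: "bounded_linear (\<lambda>c. c *\<^sub>C x)"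
  by (rule bounded_linear_intro[where K = "norm x"])
    (simp_all add: scale_left_distrib norm_scaleC scaleR_conv_of_real scaleR_eq_scaleC)

lemma bounded_linear_scaleC_right: "bounded_linear (\<lambda>x. c *\<^sub>C x)"
  by (rule bounded_linear_intro[where K = "cmod c"])
    (simp_all add: scale_right_distrib norm_scaleC scaleR_eq_scaleC mult.commute)

end

context jb_star_triple
begin

lemma triple_scaleR_left: "triple (r *\<^sub>R x) y z = r *\<^sub>R triple x y z"
  and triple_scaleR_middle: "triple x (r *\<^sub>R y) z = r *\<^sub>R triple x y z"
  and triple_scaleR_right: "triple x y (r *\<^sub>R z) = r *\<^sub>R triple x y z"
  by (simp_all add: scaleR_eq_scaleC triple_scaleC_left triple_scaleC_middle triple_scaleC_right)

lemma triple_zero_left [simp]: "triple 0 y z = 0"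
  and triple_zero_middle [simp]: "triple x 0 z = 0"
  and triple_zero_right [simp]: "triple x y 0 = 0"
  using triple_scaleR_left[of 0] triple_scaleR_middle[of _ 0] triple_scaleR_right[of _ _ 0]
  by simp_all

lemma triple_minus_left: "triple (- x) y z = - triple x y z"
  and triple_minus_middle: "triple x (- y) z = - triple x y z"
  and triple_minus_right: "triple x y (- z) = - triple x y z"
  using triple_scaleR_left[of "-1"] triple_scaleR_middle[of _ "-1"] triple_scaleR_right[of _ _ "-1"]
  by simp_all

lemma triple_diff_left: "triple (x - x') y z = triple x y z - triple x' y z"
  and triple_diff_middle: "triple x (y - y') z = triple x y z - triple x y' z"
  and triple_diff_right: "triple x y (z - z') = triple x y z - triple x y z'"
  using triple_add_left[of x "- x'"] triple_add_middle[of x y "- y'"]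
    triple_add_right[of x y z "- z'"]
  by (simp_all add: triple_minus_left triple_minus_middle triple_minus_right)

lemmas triple_simps =
  triple_add_left triple_add_middle triple_add_right
  triple_diff_left triple_diff_middle triple_diff_right
  triple_minus_left triple_minus_middle triple_minus_right
  triple_scaleR_left triple_scaleR_middle triple_scaleR_right

lemma triple_sum_left: "triple (sum f I) y z = (\<Sum>i\<in>I. triple (f i) y z)"
  by (induction I rule: infinite_finite_induct) (auto simp: triple_add_left)

lemma triple_sum_middle: "triple x (sum f I) z = (\<Sum>i\<in>I. triple x (f i) z)"
  by (induction I rule: infinite_finite_induct) (auto simp: triple_add_middle)

lemma tendsto_triple:
  assumes "(f \<longlongrightarrow> x) F" "(g \<longlongrightarrow> y) F" "(h \<longlongrightarrow> z) F"
  shows "((\<lambda>n. triple (f n) (g n) (h n)) \<longlongrightarrow> triple x y z) F"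
proof -
  have "isCont (\<lambda>(x, y, z). triple x y z) (x, y, z)"
    using triple_continuous by (simp add: continuous_on_eq_continuous_at)
  from isCont_tendsto_compose[OF this tendsto_Pair[OF assms(1) tendsto_Pair[OF assms(2,3)]]]
  show ?thesis by simp
qed

lemma triple_bounded: "\<exists>K>0. \<forall>x y z. norm (triple x y z) \<le> K * norm x * norm y * norm z"
proof -
  have "isCont (\<lambda>(x, y, z). triple x y z) (0, 0, 0)"
    using triple_continuous by (simp add: continuous_on_eq_continuous_at)
  then obtain d where d: "d > 0"
    "\<And>w. dist w (0, 0, 0) < d \<Longrightarrow> dist ((\<lambda>(x, y, z). triple x y z) w) (triple 0 0 0) < 1"
    unfolding continuous_at_eps_delta by (metis case_prod_conv zero_less_one)
  \<comment> \<open>The norm of (x, y, z) is at most the sum of the three norms, and 3 * d / 4 <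
    d.\<close>
  define s where "s = d / 4"
  have "s > 0" using d by (simp add: s_def)
  have small: "norm (triple x y z) \<le> 1" if "norm x \<le> s" "norm y \<le> s" "norm z \<le> s" for x y z
  proof -
    have "norm (x, y, z) \<le> norm x + (norm y + norm z)"
      by (meson norm_Pair_le add_left_mono order_trans)
    also have "\<dots> < d" using that \<open>s > 0\<close> by (simp add: s_def)
    finally show ?thesis using d(2)[of "(x, y, z)"] by (simp add: dist_norm flip: zero_prod_def)
  qed
  have "norm (triple x y z) \<le> (1 / s ^ 3) * norm x * norm y * norm z" for x y z
  proof (cases "x = 0 \<or> y = 0 \<or> z = 0")
    case True
    then show ?thesis by auto
  next
    case False
    have "triple ((s / norm x) *\<^sub>R x) ((s / norm y) *\<^sub>R y) ((s / norm z) *\<^sub>R z)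
        = (s ^ 3 / (norm x * norm y * norm z)) *\<^sub>R triple x y z"
      by (simp add: triple_simps power3_eq_cube mult_ac)
    moreover have "norm (triple ((s / norm x) *\<^sub>R x) ((s / norm y) *\<^sub>R y) ((s / norm z) *\<^sub>R z)) \<le> 1"
      using False \<open>s > 0\<close> by (intro small) auto
    ultimately have "(s ^ 3 / (norm x * norm y * norm z)) * norm (triple x y z) \<le> 1"
      using \<open>s > 0\<close> by simp
    then show ?thesis using False \<open>s > 0\<close> by (simp add: field_simps)
  qed
  then show ?thesis using \<open>s > 0\<close> by (intro exI[of _ "1 / s ^ 3"]) auto
qed

lemma bounded_linear_triple_right: "bounded_linear (\<lambda>z. triple x y z)"
  and bounded_linear_triple_middle: "bounded_linear (\<lambda>y. triple x y z)"
proof -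
  obtain K where K: "\<And>x y z. norm (triple x y z) \<le> K * norm x * norm y * norm z"
    using triple_bounded by blast
  show "bounded_linear (\<lambda>z. triple x y z)"
    by (rule bounded_linear_intro[where K = "K * norm x * norm y"])
      (use K[of x y] in \<open>auto simp: triple_simps algebra_simps\<close>)
  show "bounded_linear (\<lambda>y. triple x y z)"
    by (rule bounded_linear_intro[where K = "K * norm x * norm z"])
      (use K[of x _ z] in \<open>auto simp: triple_simps algebra_simps\<close>)
qed

text \<open>The Jordan identity computes \<open>[L(a, b), L(x, y)]\<close>, which is antisymmetric under exchanging
  the pairs \<open>(a, b)\<close> and \<open>(x, y)\<close>.\<close>

lemma jordan_antisym:
  "triple (triple a b x) y u - triple x (triple b a y) u =
   triple a (triple y x b) u - triple (triple x y a) b u"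
  using jordan_identity[of a b x y u] jordan_identity[of x y a b u] by (simp add: algebra_simps)


subsection \<open>Peirce decomposition\<close>

definition tripotent :: "'e \<Rightarrow> bool" where
  "tripotent e \<longleftrightarrow> triple e e e = e"

text \<open>The index is the eigenvalue of L(e, e), so 1, 1/2 and 0 stand for the spaces often
  written E_2, E_1, E_0. Admitting every real c lets the Peirce rule be a formula in the indices;
  \<open>peirce_trivial\<close> disposes of the other values.\<close>

definition peirce :: "'e \<Rightarrow> real \<Rightarrow> 'e set" where
  "peirce e c = {x. triple e e x = c *\<^sub>R x}"

definition orth :: "'e \<Rightarrow> 'e \<Rightarrow> bool" where
  "orth x y \<longleftrightarrow> (\<forall>u. triple x y u = 0 \<and> triple y x u = 0)"

lemma orth_sym: "orth x y \<Longrightarrow> orth y x"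
  by (auto simp: orth_def)

lemma orthD:
  assumes "orth x y"
  shows "triple x y u = 0" "triple y x u = 0" "triple u x y = 0" "triple u y x = 0"
  using assms triple_commute[of u x y] triple_commute[of u y x] by (auto simp: orth_def)

lemma orth_add: "orth x y \<Longrightarrow> orth x z \<Longrightarrow> orth x (y + z)"
  by (simp add: orth_def triple_simps)

lemma orth_scaleR: "orth x y \<Longrightarrow> orth x (r *\<^sub>R y)"
  by (simp add: orth_def triple_simps)

lemma orth_sum: "(\<And>i. i \<in> I \<Longrightarrow> orth x (f i)) \<Longrightarrow> orth x (sum f I)"
  by (induction I rule: infinite_finite_induct) (auto simp: orth_add, auto simp: orth_def)

lemma triple_add_orth:
  assumes "orth x y"
  shows "triple (x + y) (x + y) u = triple x x u + triple y y u"
    "triple (x + y) (x + y) (x + y) = triple x x x + triple y y y"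
  using assms by (simp_all add: triple_simps orthD)

lemma tripotent_add_orth: "orth x y \<Longrightarrow> tripotent x \<Longrightarrow> tripotent y \<Longrightarrow> tripotent (x + y)"
  by (simp only: tripotent_def triple_add_orth(2))

lemma tripotent_minus: "tripotent (- e) \<longleftrightarrow> tripotent e"
  by (simp add: tripotent_def triple_simps)

lemma norm_tripotent:
  assumes "tripotent e" "e \<noteq> 0"
  shows "norm e = 1"
proof -
  have "norm e ^ 3 = norm e" using norm_cube[of e] assms(1) by (simp add: tripotent_def)
  then have "norm e * (norm e ^ 2 - 1) = 0" by (simp add: algebra_simps power3_eq_cube power2_eq_square)
  then show ?thesis using assms(2) by (simp add: power2_eq_1_iff) (metis norm_ge_zero not_one_le_zero neg_0_le_iff_le)
qed

lemma norm_tripotent_le: "tripotent e \<Longrightarrow> norm e \<le> 1"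
  using norm_tripotent[of e] by (cases "e = 0") auto

text \<open>By the Jordan identity L(e, e) acts on products as a derivation, with a minus sign in
  the conjugate linear middle slot.\<close>

lemma peirce_triple:
  assumes "x \<in> peirce e i" "y \<in> peirce e j" "z \<in> peirce e k"
  shows "triple x y z \<in> peirce e (i - j + k)"
  using assms by (simp add: peirce_def jordan_identity[of e e x y z] triple_simps algebra_simps)

lemma peirce_add: "x \<in> peirce e c \<Longrightarrow> y \<in> peirce e c \<Longrightarrow> x + y \<in> peirce e c"
  and peirce_diff: "x \<in> peirce e c \<Longrightarrow> y \<in> peirce e c \<Longrightarrow> x - y \<in> peirce e c"
  and peirce_scaleR: "x \<in> peirce e c \<Longrightarrow> r *\<^sub>R x \<in> peirce e c"
  and peirce_zero: "0 \<in> peirce e c"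
  by (auto simp: peirce_def triple_simps algebra_simps)

lemma closed_peirce: "closed (peirce e c)"
  unfolding peirce_def
  by (intro closed_Collect_eq continuous_intros linear_continuous_on bounded_linear_triple_right)

context
  fixes e assumes e: "tripotent e"
begin

text \<open>Write D for L(e, e) and Q for x -> {e, x, e}. Applying L(x, e) to e = {e, e, e} gives
  Q^2 = 2 D^2 - D.\<close>

lemma Q_Q: "triple e (triple e x e) e = 2 *\<^sub>R triple e e (triple e e x) - triple e e x"
proof -
  have c: "triple e e e = e" using e by (simp add: tripotent_def)
  have "triple x e e = triple (triple x e e) e e - triple e (triple e x e) e + triple e e (triple x e e)"
    using jordan_identity[of x e e e e] c by simp
  then show ?thesis
    by (simp add: triple_commute[of x e e] triple_commute[of "triple e e x" e e] scaleR_2 algebra_simps)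
qed

text \<open>The Jordan identity yields DQ = 2Q - QD, and \<open>jordan_antisym\<close> yields DQ + Q
  = 2QD. Eliminating DQ leaves 3Q = 3QD.\<close>

lemma D_Q: "triple e e (triple e x e) = triple e x e"
  and Q_D: "triple e (triple e e x) e = triple e x e"
proof -
  have c: "triple e e e = e" using e by (simp add: tripotent_def)
  have 1: "triple e e (triple e x e) = 2 *\<^sub>R triple e x e - triple e (triple e e x) e"
    using jordan_identity[of e e e x e] c by (simp add: scaleR_2)
  have "triple (triple e x e) e e - triple e (triple x e e) e = triple e (triple e e x) e - triple (triple e e e) x e"
    using jordan_antisym[of e x e e e] by simp
  then have "triple e e (triple e x e) + triple e x e = 2 *\<^sub>R triple e (triple e e x) e"
    by (simp add: c triple_commute[of x e e] triple_commute[of "triple e x e" e e] scaleR_2 algebra_simps)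
  moreover have "triple e e (triple e x e) + triple e x e =
      3 *\<^sub>R triple e x e - triple e (triple e e x) e"
    unfolding 1 by (simp add: scaleR_2 scaleR_3)
  ultimately have "3 *\<^sub>R triple e x e = 3 *\<^sub>R triple e (triple e e x) e"
    by (simp add: scaleR_2 scaleR_3 algebra_simps)
  then show qd: "triple e (triple e e x) e = triple e x e" by simp
  show "triple e e (triple e x e) = triple e x e" using 1 qd by (simp add: scaleR_2)
qed

text \<open>D fixes the range of Q, in particular that of Q^2 = 2 D^2 - D. Hence t (2t - 1) (t - 1)
  annihilates D, which is where the eigenvalues 0, 1/2, 1 come from.\<close>

lemma D_cubic: "2 *\<^sub>R triple e e (triple e e (triple e e x)) = 3 *\<^sub>R triple e e (triple e e x) - triple e e x"
proof -
  have "triple e e (triple e (triple e x e) e) = triple e (triple e x e) e" by (rule D_Q)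
  then have "2 *\<^sub>R triple e e (triple e e (triple e e x)) - triple e e (triple e e x)
      = 2 *\<^sub>R triple e e (triple e e x) - triple e e x"
    unfolding Q_Q by (simp add: triple_simps)
  then have "2 *\<^sub>R triple e e (triple e e (triple e e x))
     = 2 *\<^sub>R triple e e (triple e e x) + triple e e (triple e e x) - triple e e x"
    by (simp add: algebra_simps)
  also have "\<dots> = (2 + 1) *\<^sub>R triple e e (triple e e x) - triple e e x"
    unfolding scaleR_left_distrib by simp
  finally show ?thesis by simp
qed

lemma peirce_eigenvalue:
  assumes "x \<in> peirce e c" "x \<noteq> 0"
  shows "c = 0 \<or> c = 1/2 \<or> c = 1"
proof -
  have "triple e e x = c *\<^sub>R x" using assms by (simp add: peirce_def)
  then have "(2 * c ^ 3) *\<^sub>R x = (3 * c ^ 2 - c) *\<^sub>R x"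
    using D_cubic[of x] by (simp add: triple_simps power3_eq_cube power2_eq_square algebra_simps)
  then have "2 * c ^ 3 = 3 * c ^ 2 - c"
    using assms(2) scaleR_right_imp_eq by blast
  then have "c * (2 * c - 1) * (c - 1) = 0"
    by (simp add: power3_eq_cube power2_eq_square algebra_simps)
  then show ?thesis by auto
qed

lemma peirce_trivial: "x \<in> peirce e c \<Longrightarrow> c \<noteq> 0 \<Longrightarrow> c \<noteq> 1/2 \<Longrightarrow> c \<noteq> 1 \<Longrightarrow> x = 0"
  using peirce_eigenvalue by blast

lemma Q_peirce:
  assumes "x \<in> peirce e c" "c \<noteq> 1"
  shows "triple e x e = 0"
proof -
  have "triple e x e = c *\<^sub>R triple e x e"
    using Q_D[of x] assms by (simp add: peirce_def triple_simps)
  then have "(1 - c) *\<^sub>R triple e x e = 0" by (simp add: algebra_simps)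
  then show ?thesis using assms by simp
qed

lemma tripotent_in_peirce: "e \<in> peirce e 1"
  using e by (simp add: peirce_def tripotent_def)

text \<open>The commutator of L(e, e) and L(e, b) is L(e, b) by one side of
  \<open>jordan_antisym\<close> and 0 by the other, because {e, b, e} and {b, e, e} vanish;
  similarly for L(b, e).\<close>

lemma orth_peirce0:
  assumes "b \<in> peirce e 0"
  shows "orth e b"
proof -
  have c: "triple e e e = e" using e by (simp add: tripotent_def)
  have b: "triple e e b = 0" "triple b e e = 0" "triple e b e = 0"
    using assms Q_peirce[OF assms] triple_commute[of b e e] by (auto simp: peirce_def)
  have "triple e b u = 0" for u using jordan_antisym[of e e e b u] b c by simp
  moreover have "triple b e u = 0" for u using jordan_antisym[of b e e e u] b c by simp
  ultimately show ?thesis by (simp add: orth_def)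
qed

lemma orth_iff_peirce0: "orth e b \<longleftrightarrow> b \<in> peirce e 0"
  using orth_peirce0 orthD(3)[of e b] by (auto simp: peirce_def)

lemma Q_Q_peirce1: "x \<in> peirce e 1 \<Longrightarrow> triple e (triple e x e) e = x"
  by (simp add: Q_Q peirce_def scaleR_2)

lemma Q_in_peirce1: "triple e x e \<in> peirce e 1"
  by (simp add: peirce_def D_Q)

text \<open>Writing x = {e, x', e} reduces the claim to the orthogonality of e and b: in
  \<open>jordan_antisym\<close> every other term then contains a product with e and b as
  neighbours.\<close>

lemma orth_peirce1_peirce0:
  assumes "x \<in> peirce e 1" "b \<in> peirce e 0"
  shows "orth x b"
proof -
  define x' where "x' = triple e x e"
  have x: "triple e x' e = x" using assms by (simp add: x'_def Q_Q_peirce1)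
  have o: "orth e b" using assms orth_peirce0 by simp
  have "triple x b u = 0" for u
    using jordan_antisym[of e x' e b u] o x
    by (simp add: orthD triple_commute[of x' e b])
  moreover have "triple b x u = 0" for u
    using jordan_antisym[of b e x' e u] o x jordan_antisym[of e x' e b u]
      jordan_antisym[of b e e x' u]
    by (simp add: orthD triple_commute[of x' e b])
  ultimately show ?thesis by (simp add: orth_def)
qed

text \<open>The Lagrange polynomials for the nodes 0, 1/2, 1, evaluated at L(e, e): (1 - t)(1 - 2t),
  4t(1 - t) and t(2t - 1). The digit in the name is twice the eigenvalue.\<close>

definition "pr0 x = x - 3 *\<^sub>R triple e e x + 2 *\<^sub>R triple e e (triple e e x)"
definition "pr1 x = 4 *\<^sub>R triple e e x - 4 *\<^sub>R triple e e (triple e e x)"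
definition "pr2 x = 2 *\<^sub>R triple e e (triple e e x) - triple e e x"

lemma pr_in_peirce: "pr0 x \<in> peirce e 0" "pr1 x \<in> peirce e (1/2)" "pr2 x \<in> peirce e 1"
  unfolding peirce_def pr0_def pr1_def pr2_def
proof safe
  define d1 where "d1 = triple e e x"
  define d2 where "d2 = triple e e d1"
  define d3 where "d3 = triple e e d2"
  have d3: "d3 = (3/2) *\<^sub>R d2 - (1/2) *\<^sub>R d1"
  proof -
    have "2 *\<^sub>R d3 = 3 *\<^sub>R d2 - d1" using D_cubic[of x] by (simp add: d1_def d2_def d3_def)
    then have "(1/2) *\<^sub>R (2 *\<^sub>R d3) = (1/2) *\<^sub>R (3 *\<^sub>R d2 - d1)" by simp
    then show ?thesis by (simp add: algebra_simps)
  qed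
  show "triple e e (x - 3 *\<^sub>R triple e e x + 2 *\<^sub>R triple e e (triple e e x)) =
     0 *\<^sub>R (x - 3 *\<^sub>R triple e e x + 2 *\<^sub>R triple e e (triple e e x))"
    by (simp add: triple_simps d1_def[symmetric] d2_def[symmetric] d3_def[symmetric] d3 algebra_simps scaleR_3)
  show "triple e e (4 *\<^sub>R triple e e x - 4 *\<^sub>R triple e e (triple e e x)) =
     (1/2) *\<^sub>R (4 *\<^sub>R triple e e x - 4 *\<^sub>R triple e e (triple e e x))"
    by (simp add: triple_simps d1_def[symmetric] d2_def[symmetric] d3_def[symmetric] d3 algebra_simps)
      (simp flip: scaleR_left_distrib)
  show "triple e e (2 *\<^sub>R triple e e (triple e e x) - triple e e x) =
     1 *\<^sub>R (2 *\<^sub>R triple e e (triple e e x) - triple e e x)"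
    by (simp add: triple_simps d1_def[symmetric] d2_def[symmetric] d3_def[symmetric] d3 algebra_simps)
      (simp add: scaleR_2 scaleR_3)
qed

end

end

subsection \<open>Separation of points by bounded functionals\<close>

definition sublinear :: "('a::real_normed_vector \<Rightarrow> real) \<Rightarrow> bool" where
  "sublinear q \<longleftrightarrow> (\<forall>x y. q (x + y) \<le> q x + q y) \<and> (\<forall>r\<ge>0. \<forall>x. q (r *\<^sub>R x) = r * q x)
     \<and> (\<forall>x. q x \<le> norm x)"

lemma sublinearD:
  assumes "sublinear q"
  shows "q (x + y) \<le> q x + q y" "r \<ge> 0 \<Longrightarrow> q (r *\<^sub>R x) = r * q x" "q x \<le> norm x" "q 0 = 0"
proof -
  show "q (x + y) \<le> q x + q y" "r \<ge> 0 \<Longrightarrow> q (r *\<^sub>R x) = r * q x" "q x \<le> norm x"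
    using assms by (simp_all add: sublinear_def)
  have "q (0 *\<^sub>R 0) = 0 * q 0" using assms unfolding sublinear_def by (meson order_refl)
  then show "q 0 = 0" by simp
qed

lemma sublinear_lower_bound:
  assumes "sublinear q"
  shows "- norm x \<le> q x"
proof -
  have "0 \<le> q x + q (- x)" using sublinearD(1)[OF assms, of x "- x"] sublinearD(4)[OF assms] by simp
  then show ?thesis using sublinearD(3)[OF assms, of "- x"] by simp
qed

text \<open>Sliding x along y and paying \<open>q y\<close> per unit can only lower q. At - y the
  value t = 1 gives at most \<open>- q y\<close>, so a q that cannot be lowered is odd.\<close>

lemma sublinear_shift:
  fixes y :: "'a::real_normed_vector"
  assumes q: "sublinear q"
  defines "p \<equiv> \<lambda>x. INF t\<in>{0..}. q (x + t *\<^sub>R y) - t * q y"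
  shows "sublinear p" "\<And>x. p x \<le> q x" "p (- y) \<le> - q y"
proof -
  have sub: "q (u + v) \<le> q u + q v" for u v using sublinearD(1)[OF q] .
  have hom: "q (r *\<^sub>R u) = r * q u" if "r \<ge> 0" for r u using sublinearD(2)[OF q that] .
  have q0: "q 0 = 0" using sublinearD(4)[OF q] .
  have lower: "- q (- x) \<le> q (x + t *\<^sub>R y) - t * q y" if "t \<ge> 0" for x t
    using sub[of "x + t *\<^sub>R y" "- x"] hom[OF that, of y] by simp
  have bdd: "bdd_below ((\<lambda>t. q (x + t *\<^sub>R y) - t * q y) ` {0..})" for x
    by (rule bdd_belowI[of _ "- q (- x)"]) (use lower in auto)
  have p_le: "p x \<le> q (x + t *\<^sub>R y) - t * q y" if "t \<ge> 0" for x t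
    unfolding p_def by (rule cINF_lower[OF bdd]) (use that in auto)
  have p_ge: "c \<le> p x" if "\<And>t. t \<ge> 0 \<Longrightarrow> c \<le> q (x + t *\<^sub>R y) - t * q y" for c x
    unfolding p_def by (rule cINF_greatest) (use that in auto)
  show pq: "p x \<le> q x" for x using p_le[of 0 x] by simp
  show "p (- y) \<le> - q y"
    using p_le[of 1 "- y"] q0 by simp
  have "p (u + v) \<le> p u + p v" for u v
  proof -
    have "p (u + v) - (q (v + s *\<^sub>R y) - s * q y) \<le> p u" if "s \<ge> 0" for s
    proof (rule p_ge)
      fix t :: real assume "t \<ge> 0"
      have "p (u + v) \<le> q ((u + v) + (t + s) *\<^sub>R y) - (t + s) * q y"
        using that \<open>t \<ge> 0\<close> by (intro p_le) simp
      also have "(u + v) + (t + s) *\<^sub>R y = (u + t *\<^sub>R y) + (v + s *\<^sub>R y)"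
        by (simp add: algebra_simps)
      finally show "p (u + v) - (q (v + s *\<^sub>R y) - s * q y) \<le> q (u + t *\<^sub>R y) - t * q y"
        using sub[of "u + t *\<^sub>R y" "v + s *\<^sub>R y"] by (simp add: algebra_simps)
    qed
    then have "p (u + v) - p u \<le> p v" by (intro p_ge) (simp add: algebra_simps)
    then show ?thesis by simp
  qed
  moreover have hom_le: "r * p x \<le> p (r *\<^sub>R x)" if "r > 0" for r x
  proof (rule p_ge)
    fix t :: real assume "t \<ge> 0"
    have "p x \<le> q (x + (t / r) *\<^sub>R y) - (t / r) * q y" using \<open>t \<ge> 0\<close> that by (intro p_le) simp
    then have "r * p x \<le> r * (q (x + (t / r) *\<^sub>R y) - (t / r) * q y)" using that by simp
    also have "\<dots> = q (r *\<^sub>R (x + (t / r) *\<^sub>R y)) - t * q y"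
      using that by (subst hom) (auto simp: algebra_simps)
    also have "r *\<^sub>R (x + (t / r) *\<^sub>R y) = r *\<^sub>R x + t *\<^sub>R y" using that by (simp add: algebra_simps)
    finally show "r * p x \<le> q (r *\<^sub>R x + t *\<^sub>R y) - t * q y" .
  qed
  moreover have "p (r *\<^sub>R x) = r * p x" if "r \<ge> 0" for r x
  proof (cases "r = 0")
    case True
    have "p 0 \<le> 0" using pq[of 0] q0 by simp
    moreover have "0 \<le> p 0" by (rule p_ge) (simp add: hom)
    ultimately show ?thesis using True by simp
  next
    case False
    with that have "r > 0" by simp
    have "(1 / r) * p (r *\<^sub>R x) \<le> p ((1 / r) *\<^sub>R (r *\<^sub>R x))"
      by (rule hom_le) (use \<open>r > 0\<close> in simp)
    then show ?thesis using \<open>r > 0\<close> hom_le[of r x] by (simp add: field_simps)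
  qed
  moreover have "p x \<le> norm x" for x
    using pq[of x] sublinearD(3)[OF q, of x] by simp
  ultimately show "sublinear p" by (simp add: sublinear_def)
qed

text \<open>Subadditivity survives the infimum because in a chain one member lies below any two, so
  the same r can serve both summands. The lower bound \<open>- norm x\<close> keeps the infimum
  finite.\<close>

lemma sublinear_chain_Inf:
  assumes C: "C \<noteq> {}" "\<And>q. q \<in> C \<Longrightarrow> sublinear q"
    and chain: "\<And>q q'. q \<in> C \<Longrightarrow> q' \<in> C \<Longrightarrow> q \<le> q' \<or> q' \<le> q"
  defines "p \<equiv> \<lambda>x. INF q\<in>C. q x"
  shows "sublinear p" "\<And>q. q \<in> C \<Longrightarrow> p \<le> q"
proof -
  have bdd: "bdd_below ((\<lambda>q. q x) ` C)" for x
    by (rule bdd_belowI[of _ "- norm x"]) (use C sublinear_lower_bound in auto)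
  have p_le: "p x \<le> q x" if "q \<in> C" for q x
    unfolding p_def by (rule cINF_lower[OF bdd that])
  have p_ge: "c \<le> p x" if "\<And>q. q \<in> C \<Longrightarrow> c \<le> q x" for c x
    unfolding p_def by (rule cINF_greatest) (use that C in auto)
  show "p \<le> q" if "q \<in> C" for q using p_le that by (simp add: le_fun_def)
  have "p (u + v) \<le> p u + p v" for u v
  proof -
    have "p (u + v) - q v \<le> p u" if "q \<in> C" for q
    proof (rule p_ge)
      fix q' assume "q' \<in> C"
      then obtain r where r: "r \<in> C" "r \<le> q" "r \<le> q'" using chain[OF \<open>q \<in> C\<close> \<open>q' \<in> C\<close>] \<open>q \<in> C\<close> \<open>q' \<in> C\<close>
        by (metis order_refl)
      have "p (u + v) \<le> r (u + v)" using p_le r by simp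
      also have "\<dots> \<le> r u + r v" by (rule sublinearD(1)[OF C(2)[OF r(1)]])
      also have "\<dots> \<le> q' u + q v" using r by (intro add_mono) (auto simp: le_fun_def)
      finally show "p (u + v) - q v \<le> q' u" by simp
    qed
    then have "p (u + v) - p u \<le> p v" by (intro p_ge) (simp add: algebra_simps)
    then show ?thesis by simp
  qed
  moreover have hom_le: "r * p x \<le> p (r *\<^sub>R x)" if "r \<ge> 0" for r x
  proof (rule p_ge)
    fix q assume "q \<in> C"
    then have "r * p x \<le> r * q x" using p_le that by (intro mult_left_mono) auto
    then show "r * p x \<le> q (r *\<^sub>R x)" using sublinearD(2)[OF C(2) that, of q x] \<open>q \<in> C\<close> by simp
  qed
  moreover have "p (r *\<^sub>R x) = r * p x" if "r \<ge> 0" for r x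
  proof (cases "r = 0")
    case True
    obtain q where "q \<in> C" using C by blast
    have "p 0 \<le> 0" using p_le[OF \<open>q \<in> C\<close>, of 0] sublinearD(4)[OF C(2)] \<open>q \<in> C\<close> by metis
    then show ?thesis using hom_le[of 0 0] True by simp
  next
    case False
    with that have "r > 0" by simp
    then show ?thesis using hom_le[of r x] hom_le[of "1 / r" "r *\<^sub>R x"] by (simp add: field_simps)
  qed
  moreover have "p x \<le> norm x" for x
  proof -
    obtain q where "q \<in> C" using C by blast
    then show ?thesis using p_le[of q x] sublinearD(3)[OF C(2)[of q], of x] by simp
  qed
  ultimately show "sublinear p" by (simp add: sublinear_def)
qed

text \<open>A minimal sublinear functional is linear, since \<open>sublinear_shift\<close> cannot decrease it.\<close>

lemma norming_functional:
  fixes d :: "'a::real_normed_vector"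
  shows "\<exists>f. (\<forall>x y. f (x + y) = f x + f y) \<and> (\<forall>r x. f (r *\<^sub>R x) = r * f x)
     \<and> (\<forall>x. \<bar>f x\<bar> \<le> norm x) \<and> f d = norm d"
proof -
  have norm_sub: "sublinear (norm :: 'a \<Rightarrow> real)" by (auto simp: sublinear_def norm_triangle_ineq)
  \<comment> \<open>Zorn is started below a functional that is already at most
    \<open>- norm d\<close> at - d; a linear minorant then has value \<open>norm d\<close> at
    d.\<close>
  obtain p0 :: "'a \<Rightarrow> real" where p0: "sublinear p0" "p0 (- d) \<le> - norm d"
    using sublinear_shift(1,3)[OF norm_sub, of d] by blast
  define S where "S = {q. sublinear q \<and> q \<le> p0}"
  have "\<exists>m\<in>S. \<forall>q\<in>S. q \<le> m \<longrightarrow> q = m"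
  proof -
    define r where "r = {(q, q'). q \<in> S \<and> q' \<in> S \<and> q' \<le> (q :: 'a \<Rightarrow> real)}"
    have Field: "Field r = S" by (auto simp: r_def Field_def)
    have "Partial_order r"
      by (auto simp: partial_order_on_def preorder_on_def refl_on_def Field trans_def antisym_def)
        (auto simp: r_def)
    moreover have "\<exists>u\<in>S. \<forall>q\<in>C. (q, u) \<in> r" if C: "C \<in> Chains r" for C
    proof (cases "C = {}")
      case True
      have "p0 \<in> S" using p0 by (simp add: S_def)
      then show ?thesis using True by blast
    next
      case False
      have CS: "C \<subseteq> S" and ch: "\<And>q q'. q \<in> C \<Longrightarrow> q' \<in> C \<Longrightarrow> q \<le> q' \<or> q' \<le> q"
        using C by (auto simp: Chains_def r_def)
      have sl: "\<And>q. q \<in> C \<Longrightarrow> sublinear q" using CS by (auto simp: S_def)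
      note I = sublinear_chain_Inf[OF False sl ch]
      define p where "p = (\<lambda>x. INF q\<in>C. q x)"
      have p: "sublinear p" "\<And>q. q \<in> C \<Longrightarrow> p \<le> q" unfolding p_def using I by auto
      obtain q where "q \<in> C" using False by blast
      then have "p \<le> p0" using p(2)[of q] CS by (auto simp: S_def intro: order_trans)
      then have "p \<in> S" using p by (simp add: S_def)
      then show ?thesis using p CS by (auto simp: r_def)
    qed
    ultimately obtain m where "m \<in> S" "\<forall>q\<in>S. (m, q) \<in> r \<longrightarrow> q = m"
      using Zorns_po_lemma[of r] Field by auto
    then show ?thesis by (auto simp: r_def)
  qed
  then obtain m where m: "sublinear m" "m \<le> p0" "\<And>q. sublinear q \<Longrightarrow> q \<le> m \<Longrightarrow> q = m"
    unfolding S_def by (auto intro: order_trans)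
  have neg: "m (- y) \<le> - m y" for y
  proof -
    have "(\<lambda>x. INF t\<in>{0..}. m (x + t *\<^sub>R y) - t * m y) = m"
      by (rule m(3)) (use sublinear_shift[OF m(1)] in \<open>auto simp: le_fun_def\<close>)
    from fun_cong[OF this, of "- y"] show ?thesis using sublinear_shift(3)[OF m(1), of y] by simp
  qed
  have sub: "m (u + v) \<le> m u + m v" for u v by (rule sublinearD(1)[OF m(1)])
  have hom: "m (r *\<^sub>R u) = r * m u" if "r \<ge> 0" for r u by (rule sublinearD(2)[OF m(1) that])
  have m0: "m 0 = 0" by (rule sublinearD(4)[OF m(1)])
  have minus: "m (- y) = - m y" for y using neg[of y] sub[of y "- y"] m0 by simp
  have add: "m (x + y) = m x + m y" for x y
    using sub[of x y] sub[of "x + y" "- y"] minus[of y] by simp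
  have scale: "m (r *\<^sub>R x) = r * m x" for r x
  proof (cases "r \<ge> 0")
    case False
    then show ?thesis using hom[of "- r" x] minus[of "(- r) *\<^sub>R x"] by simp
  qed (rule hom)
  have le: "m x \<le> norm x" for x by (rule sublinearD(3)[OF m(1)])
  have bound: "\<bar>m x\<bar> \<le> norm x" for x using le[of x] le[of "- x"] minus[of x] by simp
  have "m (- d) \<le> - norm d" using m(2) p0(2) by (auto simp: le_fun_def intro: order_trans)
  then have "m d = norm d" using minus[of d] le[of d] by simp
  then show ?thesis using add scale bound by blast
qed

lemma dual_on_separates:
  assumes "\<And>f. f \<in> dual_on A \<Longrightarrow> f x = f y"
  shows "x = y"
proof -
  obtain f where f: "\<forall>x y. f (x + y) = f x + f y" "\<forall>r x. f (r *\<^sub>R x) = r * f x"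
    "\<forall>x. \<bar>f x\<bar> \<le> norm x" "f (x - y) = norm (x - y)"
    using norming_functional[of "x - y"] by blast
  have "f \<in> dual_on A" using f by (auto simp: dual_on_def intro!: exI[of _ 1])
  then have "f x = f y" by (rule assms)
  moreover have "f x = f (x - y) + f y" using f(1) by (metis diff_add_cancel)
  ultimately show ?thesis using f(4) by simp
qed

lemma dual_on_continuous:
  assumes f: "f \<in> dual_on A" and A: "subspace A" "range x \<subseteq> A" "l \<in> A" and lim: "x \<longlonglongrightarrow> l"
  shows "(\<lambda>n. f (x n)) \<longlonglongrightarrow> f l"
proof -
  obtain K where K: "\<And>x. x \<in> A \<Longrightarrow> \<bar>f x\<bar> \<le> K * norm x" using f unfolding dual_on_def by blast
  have "norm (f (x n) - f l) \<le> norm (x n - l) * K" for n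
  proof -
    have "x n - l \<in> A" using A subspace_diff by blast
    then have "f (x n - l + l) = f (x n - l) + f l"
      using f A unfolding dual_on_def by blast
    then have "f (x n) - f l = f (x n - l)" by simp
    moreover have "\<bar>f (x n - l)\<bar> \<le> K * norm (x n - l)" using K \<open>x n - l \<in> A\<close> by blast
    ultimately show ?thesis by (simp add: mult.commute)
  qed
  then have "(\<lambda>n. f (x n) - f l) \<longlonglongrightarrow> 0"
    by (intro tendsto_0_le[OF LIM_zero[OF lim], of _ K] always_eventually) auto
  then show ?thesis by (simp add: LIM_zero_iff)
qed

lemma weakly_tendsto_on_subseq:
  "weakly_tendsto_on A x l \<Longrightarrow> strict_mono r \<Longrightarrow> weakly_tendsto_on A (x \<circ> r) l"
  by (auto simp: weakly_tendsto_on_def o_def intro: LIMSEQ_subseq_LIMSEQ[unfolded o_def])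


subsection \<open>The uniform Kadec-Klee property implies the Kadec-Klee property\<close>

lemma sep_ge:
  assumes "\<And>n m. n \<noteq> m \<Longrightarrow> norm (x n - x m) \<ge> c"
  shows "sep x \<ge> c"
proof -
  have "(0::nat, 1::nat) \<in> {(n, m). n \<noteq> m}" by simp
  then show ?thesis unfolding sep_def by (intro cINF_greatest) (use assms in auto)
qed

lemma sep_le:
  assumes "n \<noteq> m"
  shows "sep x \<le> norm (x n - x m)"
proof -
  have "bdd_below ((\<lambda>(n, m). norm (x n - x m)) ` {(n, m). n \<noteq> m})"
    by (rule bdd_belowI[of _ 0]) auto
  from cINF_lower[OF this, of "(n, m)"] show ?thesis using assms by (simp add: sep_def)
qed

text \<open>If no subsequence were separated, every subsequence would contain one of diameter below
  any given bound, and a diagonal sequence would be Cauchy.\<close>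

lemma separated_subseq:
  fixes x :: "nat \<Rightarrow> 'a::banach"
  assumes no: "\<And>r. strict_mono r \<Longrightarrow> \<not> convergent (x \<circ> r)"
  shows "\<exists>\<epsilon>>0. \<exists>r. strict_mono r \<and> sep (x \<circ> r) \<ge> \<epsilon>"
proof (rule ccontr)
  assume neg: "\<not> ?thesis"
  have sub: "\<exists>r::nat \<Rightarrow> nat. strict_mono r \<and> (\<forall>n m. norm (x (s (r n)) - x (s (r m))) < \<epsilon>)"
    if "\<epsilon> > 0" "strict_mono s" for \<epsilon> and s :: "nat \<Rightarrow> nat"
  proof -
    \<comment> \<open>Otherwise every ball of radius \<epsilon> / 2 around a term holds finitely
      many terms, and choosing each new term outside all earlier balls produces a separated
      subsequence.\<close>
    have "\<exists>N. infinite {n. norm (x (s n) - x (s N)) < \<epsilon> / 2}"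
    proof (rule ccontr)
      assume "\<not> ?thesis"
      then have fin: "finite {n. norm (x (s n) - x (s N)) < \<epsilon> / 2}" for N by simp
      have "\<exists>t. \<forall>n. (t n < t (Suc n)) \<and> (\<forall>k\<le>t n. norm (x (s (t (Suc n))) - x (s k)) \<ge> \<epsilon> / 2)"
      proof -
        have "\<exists>m>n. \<forall>k\<le>n. norm (x (s m) - x (s k)) \<ge> \<epsilon> / 2" for n
        proof -
          have "finite ({..n} \<union> (\<Union>k\<le>n. {m. norm (x (s m) - x (s k)) < \<epsilon> / 2}))" using fin by auto
          then obtain m where "m \<notin> {..n} \<union> (\<Union>k\<le>n. {m. norm (x (s m) - x (s k)) < \<epsilon> / 2})"
            using ex_new_if_finite[OF infinite_UNIV_nat] by blast
          then show ?thesis by (auto simp: not_less not_le)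
        qed
        then obtain g where g: "\<And>n. g n > n" "\<And>n k. k \<le> n \<Longrightarrow> norm (x (s (g n)) - x (s k)) \<ge> \<epsilon> / 2"
          by metis
        define t where "t = rec_nat 0 (\<lambda>_. g)"
        have "t (Suc n) = g (t n)" for n by (simp add: t_def)
        then show ?thesis using g by (intro exI[of _ t]) auto
      qed
      then obtain t where t: "\<And>n. t n < t (Suc n)"
        "\<And>n k. k \<le> t n \<Longrightarrow> norm (x (s (t (Suc n))) - x (s k)) \<ge> \<epsilon> / 2" by blast
      have tm: "strict_mono t" using t(1) by (simp add: strict_mono_Suc_iff)
      have lt: "norm (x (s (t m)) - x (s (t n))) \<ge> \<epsilon> / 2" if "n < m" for n m
      proof -
        obtain k where k: "m = Suc k" using \<open>n < m\<close> by (cases m) auto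
        then have "t n \<le> t k" using that tm by (simp add: strict_mono_less_eq)
        then show ?thesis using t(2) k by blast
      qed
      have "sep (x \<circ> (s \<circ> t)) \<ge> \<epsilon> / 2"
      proof (rule sep_ge)
        fix n m :: nat assume "n \<noteq> m"
        then show "\<epsilon> / 2 \<le> norm ((x \<circ> (s \<circ> t)) n - (x \<circ> (s \<circ> t)) m)"
          using lt[of n m] lt[of m n] by (cases "n < m") (auto simp: norm_minus_commute)
      qed
      moreover have "strict_mono (s \<circ> t)" using tm that(2) by (simp add: strict_mono_o)
      ultimately show False using neg that(1) half_gt_zero by blast
    qed
    then obtain N where N: "infinite {n. norm (x (s n) - x (s N)) < \<epsilon> / 2}" by blast
    define r where "r = enumerate {n. norm (x (s n) - x (s N)) < \<epsilon> / 2}"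
    have r: "norm (x (s (r n)) - x (s N)) < \<epsilon> / 2" for n using enumerate_in_set[OF N] by (auto simp: r_def)
    have "norm (x (s (r n)) - x (s (r m))) < \<epsilon>" for n m
      using norm_triangle_ineq4[of "x (s (r n)) - x (s N)" "x (s (r m)) - x (s N)"] r[of n] r[of m] by simp
    moreover have "strict_mono r" unfolding r_def using N by (simp add: strict_mono_enumerate)
    ultimately show ?thesis by (intro exI[of _ r]) simp
  qed
  interpret subseqs "\<lambda>n s. \<forall>i j. norm (x (s i) - x (s j)) < 1 / Suc n"
    by standard (use sub in auto)
  have red: "norm (x (seqseq (Suc n) i) - x (seqseq (Suc n) j)) < 1 / Suc n" for n i j
    using seqseq_holds[of n] by blast
  have "Cauchy (x \<circ> diagseq)"
  proof (rule CauchyI)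
    fix e :: real assume "e > 0"
    then obtain M where M: "1 / Suc M < e" using nat_approx_posE by blast
    have "norm ((x \<circ> diagseq) m - (x \<circ> diagseq) n) < e" if "m \<ge> Suc M" "n \<ge> Suc M" for m n
    proof -
      have "diagseq k \<in> range (seqseq (Suc M))" if "k \<ge> Suc M" for k
      proof -
        have "diagseq (Suc M + (k - Suc M)) = (seqseq (Suc M) \<circ> fold_reduce (Suc M) (k - Suc M)) (Suc M + (k - Suc M))"
          by (metis diagseq_add)
        then show ?thesis using that by auto
      qed
      then obtain i j where "diagseq m = seqseq (Suc M) i" "diagseq n = seqseq (Suc M) j"
        using \<open>m \<ge> Suc M\<close> \<open>n \<ge> Suc M\<close> by blast
      then show ?thesis using less_trans[OF red M] by simp
    qed
    then show "\<exists>M. \<forall>m\<ge>M. \<forall>n\<ge>M. norm ((x \<circ> diagseq) m - (x \<circ> diagseq) n) < e" by blast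
  qed
  then have "convergent (x \<circ> diagseq)" by (rule Cauchy_convergent)
  then show False using no[OF subseq_diagseq] by simp
qed

lemma uniform_kadec_klee_imp_kadec_klee:
  fixes A :: "'a::banach set"
  assumes A: "subspace A" "closed A" and ukk: "uniform_kadec_klee A"
  shows "kadec_klee A"
  unfolding kadec_klee_def
proof (intro allI impI, elim conjE)
  fix x :: "nat \<Rightarrow> 'a" and l
  assume x: "\<forall>n. x n \<in> A \<and> norm (x n) = 1" and l: "l \<in> A" "norm l = 1"
    and w: "weakly_tendsto_on A x l"
  show "x \<longlonglongrightarrow> l"
  proof (rule ccontr)
    assume "\<not> x \<longlonglongrightarrow> l"
    then obtain e where e: "e > 0" "infinite {n. norm (x n - l) \<ge> e}"
      unfolding LIMSEQ_iff infinite_nat_iff_unbounded_le by (auto simp: not_less)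
    define s where "s = enumerate {n. norm (x n - l) \<ge> e}"
    have s: "strict_mono s" unfolding s_def using e by (simp add: strict_mono_enumerate)
    have far: "norm (x (s n) - l) \<ge> e" for n using enumerate_in_set[OF e(2)] by (auto simp: s_def)
    \<comment> \<open>A norm limit of such a subsequence must be the weak limit l, but all its terms
      keep distance e from l.\<close>
    have "\<not> convergent ((x \<circ> s) \<circ> r)" if r: "strict_mono r" for r
    proof
      assume "convergent ((x \<circ> s) \<circ> r)"
      then obtain l' where l': "(x \<circ> (s \<circ> r)) \<longlonglongrightarrow> l'" by (auto simp: convergent_def o_assoc)
      have "l' \<in> A" using A(2) _ l' by (rule closed_sequentially) (use x in simp)
      have "l = l'"
      proof (rule dual_on_separates)
        fix f assume f: "f \<in> dual_on A"
        have "(\<lambda>n. f ((x \<circ> (s \<circ> r)) n)) \<longlonglongrightarrow> f l'"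
          by (rule dual_on_continuous[OF f A(1) _ \<open>l' \<in> A\<close> l']) (use x in auto)
        moreover have "(\<lambda>n. f ((x \<circ> (s \<circ> r)) n)) \<longlonglongrightarrow> f l"
          using weakly_tendsto_on_subseq[OF w, of "s \<circ> r"] f s r
          by (auto simp: weakly_tendsto_on_def strict_mono_o)
        ultimately show "f l = f l'" by (rule LIMSEQ_unique[rotated])
      qed
      then have "(\<lambda>n. norm (x (s (r n)) - l)) \<longlonglongrightarrow> 0" using l' by (simp add: o_def tendsto_norm_zero LIM_zero)
      moreover have "\<forall>n. e \<le> norm (x (s (r n)) - l)" using far by blast
      ultimately have "e \<le> 0" by (intro LIMSEQ_le_const[of _ 0 e]) auto
      then show False using e by simp
    qed
    then obtain \<epsilon> r where r: "\<epsilon> > 0" "strict_mono r" "sep ((x \<circ> s) \<circ> r) \<ge> \<epsilon>"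
      using separated_subseq by blast
    obtain \<delta> where d: "\<delta> > 0" "\<And>x l. (\<forall>n. x n \<in> A \<and> norm (x n) \<le> 1) \<and> sep x \<ge> \<epsilon> \<and>
        l \<in> A \<and> weakly_tendsto_on A x l \<Longrightarrow> norm l < 1 - \<delta>"
      using ukk r(1) unfolding uniform_kadec_klee_def by meson
    have "norm l < 1 - \<delta>"
      by (rule d(2)[of "(x \<circ> s) \<circ> r"])
        (use x l r w s in \<open>auto simp: weakly_tendsto_on_subseq\<close>)
    then show False using d l by simp
  qed
qed

lemma scaleR_three_halves: "(3/2) *\<^sub>R x = x + (1/2) *\<^sub>R (x :: 'a::real_vector)"
  using scaleR_left_distrib[of 1 "1/2" x] by simp

context jb_star_triple
begin

lemma pr_sum:
  assumes "tripotent e"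
  shows "pr0 e x + pr1 e x + pr2 e x = x"
  by (simp add: pr0_def[OF assms] pr1_def[OF assms] pr2_def[OF assms] scaleR_2 scaleR_3 scaleR_4)

subsection \<open>Contractivity of the Peirce projections\<close>

lemma triple_scaleC_eigen:
  assumes "x \<in> peirce e c"
  shows "((\<lambda>y. z *\<^sub>C triple e e y) ^^ n) x = (z * complex_of_real c) ^ n *\<^sub>C x"
proof (induction n)
  case (Suc n)
  then show ?case
    using assms by (simp add: triple_scaleC_right peirce_def scaleR_eq_scaleC mult_ac)
qed simp

lemma op_exp_eigen_sums:
  assumes "x \<in> peirce e c"
  shows "(\<lambda>n. ((\<lambda>y. z *\<^sub>C triple e e y) ^^ n) x /\<^sub>R fact n) sums (exp (z * complex_of_real c) *\<^sub>C x)"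
proof -
  have "(\<lambda>n. ((z * complex_of_real c) ^ n /\<^sub>R fact n) *\<^sub>C x) sums (exp (z * complex_of_real c) *\<^sub>C x)"
    using bounded_linear.sums[OF bounded_linear_scaleC_left exp_converges] .
  moreover have "((z * complex_of_real c) ^ n /\<^sub>R fact n) *\<^sub>C x
      = ((\<lambda>y. z *\<^sub>C triple e e y) ^^ n) x /\<^sub>R fact n" for n
    using assms by (simp add: triple_scaleC_eigen scaleR_conv_of_real scaleR_eq_scaleC)
  ultimately show ?thesis by simp
qed

text \<open>The isometry exp(2it L(e, e)) multiplies the component of eigenvalue c by exp(2itc); the
  factor 2 makes up for the eigenvalue 1/2.\<close>

lemma norm_peirce_rotation:
  assumes "x0 \<in> peirce e 0" "x1 \<in> peirce e (1/2)" "x2 \<in> peirce e 1"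
  shows "norm (x0 + cis t *\<^sub>C x1 + cis (2 * t) *\<^sub>C x2) = norm (x0 + x1 + x2)"
proof -
  define z where "z = \<i> * complex_of_real (2 * t)"
  define M where "M = (\<lambda>y. z *\<^sub>C triple e e y)"
  have add: "M (x + y) = M x + M y" for x y
    by (simp add: M_def triple_add_right scale_right_distrib)
  have pow: "(M ^^ n) (x + y) = (M ^^ n) x + (M ^^ n) y" for x y n
    by (induction n) (simp_all add: add)
  have "(\<lambda>n. (M ^^ n) x0 /\<^sub>R fact n + (M ^^ n) x1 /\<^sub>R fact n + (M ^^ n) x2 /\<^sub>R fact n) sums
      (exp (z * complex_of_real 0) *\<^sub>C x0 + exp (z * complex_of_real (1/2)) *\<^sub>C x1
        + exp (z * complex_of_real 1) *\<^sub>C x2)"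
    unfolding M_def by (intro sums_add op_exp_eigen_sums assms)
  then have "op_exp M (x0 + x1 + x2) = x0 + cis t *\<^sub>C x1 + cis (2 * t) *\<^sub>C x2"
    unfolding op_exp_def
    by (simp add: pow z_def cis_conv_exp mult_ac scaleR_right_distrib sums_iff)
  moreover have "norm (op_exp M (x0 + x1 + x2)) = norm (x0 + x1 + x2)"
    using hermitian[of e] unfolding hermitian_op_def M_def z_def by blast
  ultimately show ?thesis by simp
qed

text \<open>Averaging the rotations by 0 and pi removes x1 and leaves x0 + x2; averaging those by
  pi/2 and - pi/2 leaves x0 - x2. Half the sum and half the difference of the two give x0 and
  x2.\<close>

lemma norm_peirce_bounds:
  assumes "x0 \<in> peirce e 0" "x1 \<in> peirce e (1/2)" "x2 \<in> peirce e 1"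
  defines "x \<equiv> x0 + x1 + x2"
  shows "norm x0 \<le> norm x" "norm x2 \<le> norm x" "norm (x2 - x0) \<le> norm x"
proof -
  note rot = norm_peirce_rotation[OF assms(1-3), folded x_def]
  have 1: "norm (x0 - x1 + x2) = norm x" using rot[of pi] by (simp add: scale_minus_left)
  have 2: "norm (x0 + \<i> *\<^sub>C x1 - x2) = norm x"
    using rot[of "pi / 2"] by (simp add: scale_minus_left)
  have 3: "norm (x0 - \<i> *\<^sub>C x1 - x2) = norm x"
  proof -
    have "cis (- pi) = -1" by (simp add: complex_eq_iff)
    then show ?thesis using rot[of "- pi / 2"] by (simp add: scale_minus_left)
  qed
  have "norm ((x0 + x1 + x2) + (x0 - x1 + x2)) \<le> norm x + norm x"
    using norm_triangle_ineq[of "x0 + x1 + x2" "x0 - x1 + x2"] 1 by (simp add: x_def)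
  moreover have "(x0 + x1 + x2) + (x0 - x1 + x2) = 2 *\<^sub>R (x0 + x2)" by (simp add: scaleR_2)
  ultimately have 4: "norm (x0 + x2) \<le> norm x" by simp
  have "norm ((x0 + \<i> *\<^sub>C x1 - x2) + (x0 - \<i> *\<^sub>C x1 - x2)) \<le> norm x + norm x"
    using norm_triangle_ineq[of "x0 + \<i> *\<^sub>C x1 - x2" "x0 - \<i> *\<^sub>C x1 - x2"] 2 3 by simp
  moreover have "(x0 + \<i> *\<^sub>C x1 - x2) + (x0 - \<i> *\<^sub>C x1 - x2) = 2 *\<^sub>R (x0 - x2)" by (simp add: scaleR_2)
  ultimately have 5: "norm (x0 - x2) \<le> norm x" by simp
  then show "norm (x2 - x0) \<le> norm x" by (simp add: norm_minus_commute)
  have "norm (2 *\<^sub>R x0) \<le> 2 * norm x"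
    using norm_triangle_ineq[of "x0 + x2" "x0 - x2"] 4 5 by (simp add: scaleR_2)
  then show "norm x0 \<le> norm x" by simp
  have "norm (2 *\<^sub>R x2) \<le> 2 * norm x"
    using norm_triangle_ineq4[of "x0 + x2" "x0 - x2"] 4 5 by (simp add: scaleR_2)
  then show "norm x2 \<le> norm x" by simp
qed

lemma norm_pr_le:
  assumes e: "tripotent e"
  shows "norm (pr0 e x) \<le> norm x" "norm (pr2 e x) \<le> norm x" "norm (triple e e x) \<le> norm x"
proof -
  note b = norm_peirce_bounds[OF pr_in_peirce[OF e], of x x x, unfolded pr_sum[OF e]]
  show "norm (pr0 e x) \<le> norm x" "norm (pr2 e x) \<le> norm x" using b by auto
  \<comment> \<open>On the eigenvalue c this reads 2c = 1 + (2c - 1), with 2c - 1 in {-1, 0,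
    1}.\<close>
  have "2 *\<^sub>R triple e e x = x + (pr2 e x - pr0 e x)"
    by (simp add: pr0_def[OF e] pr2_def[OF e] scaleR_2 scaleR_3)
  then have "norm (2 *\<^sub>R triple e e x) \<le> norm x + norm x"
    using norm_triangle_ineq[of x "pr2 e x - pr0 e x"] b(3) by simp
  then show "norm (triple e e x) \<le> norm x" by simp
qed

lemma pr_peirce:
  assumes e: "tripotent e"
  shows "x \<in> peirce e 0 \<Longrightarrow> pr0 e x = x" "x \<in> peirce e (1/2) \<Longrightarrow> pr0 e x = 0" "x \<in> peirce e 1 \<Longrightarrow> pr0 e x = 0"
    "x \<in> peirce e 0 \<Longrightarrow> pr1 e x = 0" "x \<in> peirce e (1/2) \<Longrightarrow> pr1 e x = x" "x \<in> peirce e 1 \<Longrightarrow> pr1 e x = 0"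
    "x \<in> peirce e 0 \<Longrightarrow> pr2 e x = 0" "x \<in> peirce e (1/2) \<Longrightarrow> pr2 e x = 0" "x \<in> peirce e 1 \<Longrightarrow> pr2 e x = x"
  by (simp_all add: pr0_def[OF e] pr1_def[OF e] pr2_def[OF e] peirce_def triple_simps
      scaleR_2 scaleR_3 scaleR_4 scaleR_three_halves flip: scaleR_left_distrib)

lemma pr_linear:
  assumes e: "tripotent e"
  shows "pr0 e (x + y) = pr0 e x + pr0 e y" "pr1 e (x + y) = pr1 e x + pr1 e y"
    "pr2 e (x + y) = pr2 e x + pr2 e y" "pr0 e (r *\<^sub>R x) = r *\<^sub>R pr0 e x"
    "pr1 e (r *\<^sub>R x) = r *\<^sub>R pr1 e x" "pr2 e (r *\<^sub>R x) = r *\<^sub>R pr2 e x"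
  by (simp_all add: pr0_def[OF e] pr1_def[OF e] pr2_def[OF e] triple_simps algebra_simps)


subsection \<open>Powers\<close>

abbreviation cube :: "'e \<Rightarrow> 'e" where
  "cube x \<equiv> triple x x x"

lemma norm_cube_iter: "norm ((cube ^^ k) x) = norm x ^ (3 ^ k)"
proof (induction k)
  case (Suc k)
  then show ?case by (simp add: norm_cube flip: power_mult) (simp add: mult.commute)
qed simp

text \<open>Cubing acts separately on orthogonal summands, so every iterated cube of e + w is e plus
  an element of the unit ball and has norm at most 2.\<close>

lemma norm_add_orth_le:
  assumes e: "tripotent e" and w: "w \<in> peirce e 0" "norm w \<le> 1"
  shows "norm (e + w) \<le> 1"
proof (rule power3_cube_le[where C = 2 and N = 0])
  fix k :: nat
  have c: "(cube ^^ k) w \<in> peirce e 0" for k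
  proof (induction k)
    case (Suc k)
    then show ?case using peirce_triple[OF Suc Suc Suc] by simp
  qed (simp add: w)
  have "(cube ^^ k) (e + w) = e + (cube ^^ k) w"
  proof (induction k)
    case (Suc k)
    then show ?case
      using triple_add_orth(2)[OF orth_peirce0[OF e c]] e by (simp add: tripotent_def)
  qed simp
  then have "norm (e + w) ^ 3 ^ k = norm (e + (cube ^^ k) w)" by (metis norm_cube_iter)
  also have "\<dots> \<le> norm e + norm ((cube ^^ k) w)" by (rule norm_triangle_ineq)
  also have "\<dots> \<le> 1 + 1"
    using norm_tripotent_le[OF e] w(2) by (intro add_mono) (auto simp: norm_cube_iter power_le_one)
  finally show "norm (e + w) ^ 3 ^ k \<le> 2 * 1 ^ 3 ^ k" by simp
qed auto

lemma norm_add_orth: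
  assumes e: "tripotent e" "e \<noteq> 0" and w: "w \<in> peirce e 0" "norm w \<le> 1"
  shows "norm (e + w) = 1"
proof -
  have "norm e \<le> norm (w + 0 + e)"
    using w(1) tripotent_in_peirce[OF e(1)] by (intro norm_peirce_bounds) (auto simp: peirce_zero)
  then show ?thesis
    using norm_add_orth_le[OF e(1) w] norm_tripotent[OF e] by (simp add: add.commute)
qed

definition odd_power :: "'e \<Rightarrow> nat \<Rightarrow> 'e" where
  "odd_power a n = (triple a a ^^ n) a"

lemma odd_power_0 [simp]: "odd_power a 0 = a"
  and odd_power_Suc: "odd_power a (Suc n) = triple a a (odd_power a n)"
  by (simp_all add: odd_power_def)

text \<open>Induction on \<open>N = i + j + k\<close>. The defects \<open>d\<close> of the claim at level \<open>N\<close> satisfy two linear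
  relations, obtained from the Jordan identity with known products of lower level, and these
  force \<open>d = 0\<close>.\<close>

lemma triple_odd_power:
  "triple (odd_power a i) (odd_power a j) (odd_power a k) = odd_power a (i + j + k + 1)"
proof -
  have "\<forall>i j k. i + j + k = N \<longrightarrow>
     triple (odd_power a i) (odd_power a j) (odd_power a k) = odd_power a (N + 1)" for N
  proof (induction N rule: less_induct)
    case (less N)
    define d where "d i j k = triple (odd_power a i) (odd_power a j) (odd_power a k) - odd_power a (N + 1)"
      for i j k
    have IH: "triple (odd_power a i) (odd_power a j) (odd_power a k) = odd_power a (i + j + k + 1)"
      if "i + j + k < N" for i j k using less[OF that] by blast
    have sym: "d i j k = d k j i" for i j k by (simp add: d_def triple_commute)
    have d0: "d 0 0 N = 0" by (simp add: d_def odd_power_Suc)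
    have rel1: "d (Suc i) j k + d i j (Suc k) = d i (Suc j) k" if "Suc (i + j + k) = N" for i j k
    proof -
      have "triple a a (odd_power a (i + j + k + 1)) =
          triple (odd_power a (Suc i)) (odd_power a j) (odd_power a k)
          - triple (odd_power a i) (odd_power a (Suc j)) (odd_power a k)
          + triple (odd_power a i) (odd_power a j) (odd_power a (Suc k))"
        using jordan_identity[of a a "odd_power a i" "odd_power a j" "odd_power a k"]
          IH[of i j k] that by (simp add: odd_power_Suc)
      moreover have "triple a a (odd_power a (i + j + k + 1)) = odd_power a (N + 1)"
        using that by (simp add: odd_power_Suc flip: that)
      ultimately show ?thesis by (simp add: d_def algebra_simps)
    qed
    \<comment> \<open>L(a_i, a_j) is applied to {a_K, a, a}, where a_i denotes the i-th odd power;
      \<open>rel1\<close> applies L(a, a) to a product of the level below.\<close>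
    have rel2: "d i j (Suc K) = d K 0 (i + j + 1) - d K (i + j + 1) 0" if "i + j + Suc K = N" for i j K
    proof -
      have "triple (odd_power a i) (odd_power a j) (odd_power a (K + 0 + 0 + 1)) =
          triple (odd_power a (i + j + K + 1)) a a
          - triple (odd_power a K) (odd_power a (i + j + 0 + 1)) a
          + triple (odd_power a K) a (odd_power a (i + j + 0 + 1))"
        using jordan_identity[of "odd_power a i" "odd_power a j" "odd_power a K" "odd_power a 0" "odd_power a 0"]
          IH[of K 0 0] IH[of i j K] IH[of j i 0] IH[of i j 0] that
        by (simp add: add.commute[of j i])
      moreover have "triple (odd_power a (i + j + K + 1)) a a = odd_power a (N + 1)"
        using that by (simp add: triple_commute[of _ a a] odd_power_Suc flip: that)
      ultimately show ?thesis by (simp add: d_def algebra_simps)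
    qed
    have d: "d i j k = 0" if "i + j + k = N" for i j k
    proof -
      \<comment> \<open>The right side of \<open>rel2\<close> depends on i and j only through i + j,
        so using it a second time makes the two remaining defects cancel.\<close>
      have ge2: "d i j (Suc (Suc K)) = 0" if "i + j + Suc (Suc K) = N" for i j K
      proof -
        define m where "m = i + j + 1"
        have m: "m + Suc K = N" using that by (simp add: m_def)
        have "d i j (Suc (Suc K)) = d m 0 (Suc K) - d 0 m (Suc K)"
          using rel2[of i j "Suc K"] that sym[of "Suc K"] by (simp add: m_def)
        also have "d m 0 (Suc K) = d 0 m (Suc K)" using rel2[of m 0 K] rel2[of 0 m K] m by simp
        finally show ?thesis by simp
      qed
      \<comment> \<open>All defects with last index 1 equal \<open>- d 0 N 0\<close>, while
        \<open>rel1\<close> with the outer symmetry makes \<open>d 0 N 0\<close> twice such a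
        defect; hence 3 times it is 0.\<close>
      have "d i j (Suc 0) = 0 \<and> d 0 N 0 = 0" if "i + j + 1 = N" for i j
      proof -
        have 1: "d i' j' (Suc 0) = - d 0 N 0" if "i' + j' + 1 = N" for i' j'
          using rel2[of i' j' 0] that d0 by simp
        obtain n where n: "N = Suc n" using \<open>i + j + 1 = N\<close> by (cases N) auto
        have "d 0 N 0 = d 0 n (Suc 0) + d 0 n (Suc 0)"
          using rel1[of 0 n 0] sym[of "Suc 0" n 0] n by simp
        then have "d 0 N 0 = - (d 0 N 0 + d 0 N 0)" using 1[of 0 n] n by simp
        then have "3 *\<^sub>R d 0 N 0 = 0" by (simp only: scaleR_3 eq_neg_iff_add_eq_0 add.assoc)
        then show ?thesis using 1[OF that] by simp
      qed
      note eq1 = this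
      have pos: "d i j k = 0" if "i + j + k = N" "k > 0" for i j k
      proof (cases "k = 1")
        case False
        then obtain k' where "k = Suc (Suc k')" using \<open>k > 0\<close> by (metis One_nat_def not0_implies_Suc gr_implies_not0)
        then show ?thesis using ge2 that by simp
      qed (use that eq1 in simp)
      show ?thesis
      proof (cases "k = 0 \<and> i = 0")
        case True
        then show ?thesis using that d0 eq1[of 0 "N - 1"] by (cases "N = 0") auto
      next
        case False
        then show ?thesis using pos[of i j k] pos[of k j i] sym[of i j k] that by (cases "k = 0") auto
      qed
    qed
    then show ?case by (auto simp: d_def)
  qed
  then show ?thesis by blast
qed

end

subsection \<open>The spectral radius\<close>

lemma sum_roots_of_unity:
  fixes k n :: nat
  assumes "k < n" "k > 0"
  shows "(\<Sum>j<n. cis (2 * pi * real j / real n) ^ k) = 0"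
proof -
  define w where "w = cis (2 * pi * k / n)"
  have "cis (2 * pi * j / n) ^ k = w ^ j" for j :: nat
    by (simp add: w_def Complex.DeMoivre mult_ac)
  moreover have "w \<noteq> 1"
  proof
    assume "w = 1"
    then have "cos (2 * pi * k / n) = 1" by (metis cis.simps(1) one_complex.simps(1) w_def)
    then obtain m :: int where m: "2 * pi * k / n = real_of_int m * 2 * pi" using cos_one_2pi_int by blast
    then have "(real k / n) * (2 * pi) = m * (2 * pi)" by (simp add: mult_ac)
    then have "real k / n = m" by (rule mult_right_cancel[THEN iffD1, rotated]) simp
    moreover have "0 < real k / n" "real k / n < 1" using assms by auto
    ultimately show False by simp
  qed
  moreover have "w ^ n = 1"
    using assms by (simp add: w_def Complex.DeMoivre)
  ultimately show ?thesis by (simp add: geometric_sum)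
qed

lemma cis_root_of_unity: "n > 0 \<Longrightarrow> cis (2 * pi * real j / real n) ^ n = 1"
  by (simp add: Complex.DeMoivre)

context complex_banach
begin

lemma bounded_clinearD:
  assumes "bounded_clinear scaleC T"
  shows "T (x + y) = T x + T y" "T (x - y) = T x - T y" "T (c *\<^sub>C x) = c *\<^sub>C T x" "T 0 = 0"
    "T (r *\<^sub>R x) = r *\<^sub>R T x"
    "bounded_linear T" "Vector_Spaces.linear scaleC scaleC T" "T (sum f I) = (\<Sum>i\<in>I. T (f i))"
proof -
  have l: "Vector_Spaces.linear scaleC scaleC T" and b: "bounded_linear T"
    using assms by (auto simp: bounded_clinear_def)
  interpret Vector_Spaces.linear scaleC scaleC T by (rule l)
  show "T (x + y) = T x + T y" "T (c *\<^sub>C x) = c *\<^sub>C T x" by (simp_all add: add scale)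
  show "T (x - y) = T x - T y" "T 0 = 0" "T (r *\<^sub>R x) = r *\<^sub>R T x" "T (sum f I) = (\<Sum>i\<in>I. T (f i))"
    using b by (auto simp: linear_simps linear_sum bounded_linear.linear)
  show "bounded_linear T" "Vector_Spaces.linear scaleC scaleC T" by fact+
qed

lemma bounded_clinearI:
  assumes "bounded_linear T" "\<And>c x. T (c *\<^sub>C x) = c *\<^sub>C T x"
  shows "bounded_clinear scaleC T"
  unfolding bounded_clinear_def
proof
  show "Vector_Spaces.linear scaleC scaleC T"
    by unfold_locales (use assms linear_add[OF bounded_linear.linear] in auto)
qed (rule assms)

lemma bounded_clinear_compose:
  "bounded_clinear scaleC S \<Longrightarrow> bounded_clinear scaleC T \<Longrightarrow> bounded_clinear scaleC (\<lambda>x. S (T x))"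
  by (rule bounded_clinearI) (auto simp: bounded_clinearD intro: bounded_linear_compose)

lemma bounded_clinear_add:
  "bounded_clinear scaleC S \<Longrightarrow> bounded_clinear scaleC T \<Longrightarrow> bounded_clinear scaleC (\<lambda>x. S x + T x)"
  by (rule bounded_clinearI) (auto simp: bounded_clinearD scale_right_distrib intro: bounded_linear_add)

lemma bounded_clinear_scale: "bounded_clinear scaleC (\<lambda>x. c *\<^sub>C x)"
  by (rule bounded_clinearI) (auto simp: bounded_linear_scaleC_right mult.commute)

lemma bounded_clinear_zero: "bounded_clinear scaleC (\<lambda>x. 0)"
  by (rule bounded_clinearI) auto

lemma bounded_clinear_pow: "bounded_clinear scaleC T \<Longrightarrow> bounded_clinear scaleC (T ^^ n)"
proof (induction n)
  case 0
  then show ?case using bounded_clinear_scale[of 1] by (simp add: id_def)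
next
  case (Suc n)
  then show ?case using bounded_clinear_compose[of T "T ^^ n"] by (simp add: o_def)
qed

text \<open>The argument averages the resolvents \<open>F u = (1 - u T)\<^sup>-\<^sup>1\<close> over \<open>n\<close>-th roots of unity \<open>w\<close>: the mean of
  \<open>F (w q)\<close> is \<open>(1 - q\<^sup>n T\<^sup>n)\<^sup>-\<^sup>1\<close>, so that \<open>q\<^sup>n T\<^sup>n \<rightarrow> 0\<close> can be propagated in \<open>q\<close> by uniform continuity.\<close>

lemma spectral_radius_le_1:
  assumes T: "bounded_clinear scaleC T"
    and inv: "\<And>z. cmod z < 1 \<Longrightarrow> \<exists>S. bounded_clinear scaleC S \<and>
      (\<forall>x. S (x - z *\<^sub>C T x) = x) \<and> (\<forall>x. S x - z *\<^sub>C T (S x) = x)"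
    and "\<rho> > 1"
  shows "\<exists>N. \<forall>n\<ge>N. \<forall>x. norm ((T ^^ n) x) \<le> \<rho> ^ n * norm x"
proof -
  define q1 where "q1 = 1 / \<rho>"
  define r where "r = (1 + q1) / 2"
  have r: "0 < q1" "q1 < r" "r < 1" using \<open>\<rho> > 1\<close> by (simp_all add: q1_def r_def field_simps)
  obtain F where F: "\<And>z. cmod z < 1 \<Longrightarrow> bounded_clinear scaleC (F z)"
    "\<And>z x. cmod z < 1 \<Longrightarrow> F z (x - z *\<^sub>C T x) = x" "\<And>z x. cmod z < 1 \<Longrightarrow> F z x - z *\<^sub>C T (F z x) = x"
    using inv by metis
  note Tl = bounded_clinearD[OF T]
  obtain B where B: "B > 0" "\<And>x. norm (T x) \<le> B * norm x"
    using bounded_linear.pos_bounded[OF Tl(6)] by (auto simp: mult.commute)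
  have FT: "F z (T x) = T (F z x)" if z: "cmod z < 1" for z x
  proof -
    have "T x = T (F z x) - z *\<^sub>C T (T (F z x))" using F(3)[OF z, of x] Tl(2,3) by metis
    then show ?thesis using F(2)[OF z, of "T (F z x)"] by simp
  qed
  have resolvent: "F z x - F z' x = (z - z') *\<^sub>C F z (T (F z' x))" if z: "cmod z < 1" "cmod z' < 1" for z z' x
  proof -
    have "F z x = F z (F z' x - z' *\<^sub>C T (F z' x))" using F(3)[OF z(2)] by simp
    moreover have "F z' x = F z (F z' x - z *\<^sub>C T (F z' x))" using F(2)[OF z(1)] by simp
    ultimately have "F z x - F z' x
        = F z (F z' x - z' *\<^sub>C T (F z' x)) - F z (F z' x - z *\<^sub>C T (F z' x))" by simp
    then show ?thesis by (simp add: bounded_clinearD[OF F(1)[OF z(1)]] scale_left_diff_distrib)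
  qed
  \<comment> \<open>Near z0 the resolvent identity bounds \<open>norm (F z x)\<close> by
    \<open>norm (F z0 x)\<close> plus half of itself. Compactness of the disc of radius r < 1 then
    makes the bound uniform.\<close>
  have local: "\<exists>M>0. \<exists>d>0. \<forall>z. cmod z < 1 \<longrightarrow> cmod (z - z0) < d \<longrightarrow> (\<forall>x. norm (F z x) \<le> M * norm x)"
    if z0: "cmod z0 < 1" for z0
  proof -
    obtain N where N: "N > 0" "\<And>x. norm (F z0 x) \<le> N * norm x"
      using bounded_linear.pos_bounded[OF bounded_clinearD(6)[OF F(1)[OF z0]]] by (auto simp: mult.commute)
    have "norm (F z x) \<le> (2 * N) * norm x" if z: "cmod z < 1" "cmod (z - z0) < 1 / (2 * N * B)" for z x
    proof -
      have "norm (F z x - F z0 x) = cmod (z - z0) * norm (F z0 (T (F z x)))"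
        using resolvent[OF z0 z(1), of x] by (simp add: norm_minus_commute norm_scaleC)
      also have "\<dots> \<le> (1 / (2 * N * B)) * (N * (B * norm (F z x)))"
        using z N B by (intro mult_mono order_trans[OF N(2)]) auto
      also have "\<dots> = norm (F z x) / 2" using N B by simp
      finally have "norm (F z x) \<le> norm (F z0 x) + norm (F z x) / 2"
        using norm_triangle_sub[of "F z x" "F z0 x"] by simp
      then show ?thesis using N(2)[of x] by simp
    qed
    then show ?thesis using N B
      by (intro exI[of _ "2 * N"] conjI exI[of _ "1 / (2 * N * B)"]) auto
  qed
  obtain M where M: "M > 0" "\<And>z x. cmod z \<le> r \<Longrightarrow> norm (F z x) \<le> M * norm x"
  proof -
    obtain m d where md: "\<And>z0. cmod z0 < 1 \<Longrightarrow> m z0 > 0 \<and> d z0 > 0 \<and>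
        (\<forall>z. cmod z < 1 \<longrightarrow> cmod (z - z0) < d z0 \<longrightarrow> (\<forall>x. norm (F z x) \<le> m z0 * norm x))"
      using local by metis
    have "compact (cball 0 r :: complex set)" by simp
    moreover have "cball 0 r \<subseteq> (\<Union>z\<in>cball 0 r. ball z (d z))"
      using md r by (force simp: dist_norm)
    moreover have "\<And>z. z \<in> cball 0 r \<Longrightarrow> open (ball z (d z))" by simp
    ultimately obtain C where C: "C \<subseteq> cball 0 r" "finite C" "cball 0 r \<subseteq> (\<Union>z\<in>C. ball z (d z))"
      using compactE_image[of "cball 0 r" "cball 0 r" "\<lambda>z. ball z (d z)"] by metis
    have "C \<noteq> {}" using C(3) r by auto
    define M where "M = Max (m ` C)"
    have mM: "m z0 \<le> M" if "z0 \<in> C" for z0 using that C by (simp add: M_def)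
    have m0: "m z0 > 0" if "z0 \<in> C" for z0 using that C r md by (force simp: dist_norm)
    have "M > 0" using \<open>C \<noteq> {}\<close> mM m0 by (metis ex_in_conv less_le_trans)
    moreover have "norm (F z x) \<le> M * norm x" if "cmod z \<le> r" for z x
    proof -
      obtain z0 where z0: "z0 \<in> C" "cmod (z - z0) < d z0"
        using C(3) \<open>cmod z \<le> r\<close> by (fastforce simp: dist_norm norm_minus_commute)
      then have "cmod z0 < 1" using C(1) r by (force simp: dist_norm)
      then have "norm (F z x) \<le> m z0 * norm x" using md z0 that r by simp
      also have "\<dots> \<le> M * norm x" using mM[OF z0(1)] by (intro mult_right_mono) auto
      finally show ?thesis .
    qed
    ultimately show thesis using that by blast
  qed
  define G where "G n q x = (1 / real n) *\<^sub>R (\<Sum>j<n. F (cis (2 * pi * real j / real n) * complex_of_real q) x)" for n q x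
  have u: "cmod (cis t * complex_of_real q) \<le> r" "cmod (cis t * complex_of_real q) < 1"
    if "0 \<le> q" "q \<le> r" for t q using that r by (simp_all add: norm_mult)
  have G_bound: "norm (G n q x) \<le> M * norm x" if "n > 0" "0 \<le> q" "q \<le> r" for n q x
  proof -
    have "norm (\<Sum>j<n. F (cis (2 * pi * real j / real n) * complex_of_real q) x) \<le> (\<Sum>j<n. M * norm x)"
      by (intro sum_norm_le M(2) u that)
    then show ?thesis using that by (simp add: G_def field_simps)
  qed
  have G_lip: "norm (G n q x - G n q' x) \<le> \<bar>q - q'\<bar> * (M * (B * M)) * norm x"
    if "n > 0" "0 \<le> q" "q \<le> r" "0 \<le> q'" "q' \<le> r" for n q q' x
  proof -
    have F_lip: "norm (F z x - F z' x) \<le> cmod (z - z') * (M * (B * M)) * norm x"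
      if "cmod z \<le> r" "cmod z' \<le> r" for z z'
    proof -
      have "norm (F z (T (F z' x))) \<le> M * (B * (M * norm x))"
        by (rule order_trans[OF M(2)]) (use that M B in \<open>auto intro!: mult_left_mono order_trans[OF B(2)]\<close>)
      then have "cmod (z - z') * norm (F z (T (F z' x))) \<le> cmod (z - z') * (M * (B * (M * norm x)))"
        by (intro mult_left_mono) auto
      then show ?thesis using resolvent[of z z' x] that r by (simp add: norm_scaleC mult_ac)
    qed
    have "norm (\<Sum>j<n. F (cis (2 * pi * real j / real n) * complex_of_real q) x -
        F (cis (2 * pi * real j / real n) * complex_of_real q') x) \<le> (\<Sum>j<n. \<bar>q - q'\<bar> * (M * (B * M)) * norm x)"
    proof (intro sum_norm_le)
      fix j
      have "cmod (cis (2 * pi * real j / real n) * complex_of_real q - cis (2 * pi * real j / real n) * complex_of_real q') = \<bar>q - q'\<bar>"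
        by (simp add: norm_mult flip: right_diff_distrib of_real_diff)
      then show "norm (F (cis (2 * pi * real j / real n) * complex_of_real q) x -
        F (cis (2 * pi * real j / real n) * complex_of_real q') x) \<le> \<bar>q - q'\<bar> * (M * (B * M)) * norm x"
        using F_lip[OF u(1) u(1)] that by metis
    qed
    moreover have "G n q x - G n q' x = (1 / real n) *\<^sub>R (\<Sum>j<n. F (cis (2 * pi * real j / real n) * complex_of_real q) x -
        F (cis (2 * pi * real j / real n) * complex_of_real q') x)"
      by (simp add: G_def sum_subtractf scaleR_diff_right)
    ultimately show ?thesis using \<open>n > 0\<close> by (simp add: field_simps)
  qed
  have geo: "F v (x - v ^ n *\<^sub>C (T ^^ n) x) = (\<Sum>k<n. v ^ k *\<^sub>C (T ^^ k) x)" if v: "cmod v < 1" for v n x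
  proof -
    define y where "y = (\<Sum>k<n. v ^ k *\<^sub>C (T ^^ k) x)"
    have "y - v *\<^sub>C T y = (\<Sum>k<n. v ^ k *\<^sub>C (T ^^ k) x - v ^ Suc k *\<^sub>C (T ^^ Suc k) x)"
      by (simp add: y_def Tl(8) Tl(3) scale_sum_right sum_subtractf mult.commute)
    also have "\<dots> = x - v ^ n *\<^sub>C (T ^^ n) x"
      using sum_lessThan_telescope'[of "\<lambda>k. v ^ k *\<^sub>C (T ^^ k) x" n] by simp
    finally show ?thesis using F(2)[OF v, of y] by (simp add: y_def)
  qed
  \<comment> \<open>For v = w q with w^n = 1 all the geometric sums belong to the same vector x -
    q^n T^n x, and averaging over w removes every term except k = 0.\<close>
  have G_left: "G n q (x - q ^ n *\<^sub>R (T ^^ n) x) = x" if n: "n > 0" "0 \<le> q" "q \<le> r" for n q x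
  proof -
    have "F (cis (2 * pi * real j / real n) * complex_of_real q) (x - q ^ n *\<^sub>R (T ^^ n) x)
      = (\<Sum>k<n. cis (2 * pi * real j / real n) ^ k *\<^sub>C (q ^ k *\<^sub>R (T ^^ k) x))" for j :: nat
    proof -
      define w where "w = cis (2 * pi * real j / real n)"
      have "w ^ n = 1" using n(1) unfolding w_def by (rule cis_root_of_unity)
      moreover have "cmod (w * complex_of_real q) < 1" unfolding w_def by (rule u(2)[OF n(2,3)])
      ultimately have "F (w * complex_of_real q) (x - q ^ n *\<^sub>R (T ^^ n) x)
          = (\<Sum>k<n. w ^ k *\<^sub>C (q ^ k *\<^sub>R (T ^^ k) x))"
        using geo[of "w * complex_of_real q" x n]
        by (simp add: power_mult_distrib scaleR_eq_scaleC mult_ac)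
      then show ?thesis by (simp only: w_def)
    qed
    then have "G n q (x - q ^ n *\<^sub>R (T ^^ n) x)
      = (1 / real n) *\<^sub>R (\<Sum>j<n. \<Sum>k<n. cis (2 * pi * real j / real n) ^ k *\<^sub>C (q ^ k *\<^sub>R (T ^^ k) x))"
      by (simp add: G_def)
    also have "(\<Sum>j<n. \<Sum>k<n. cis (2 * pi * real j / real n) ^ k *\<^sub>C (q ^ k *\<^sub>R (T ^^ k) x))
      = (\<Sum>k<n. (\<Sum>j<n. cis (2 * pi * real j / real n) ^ k) *\<^sub>C (q ^ k *\<^sub>R (T ^^ k) x))"
      by (subst sum.swap) (simp add: scale_sum_left)
    also have "\<dots> = (\<Sum>k<n. if k = 0 then real n *\<^sub>R x else 0)"
      using sum_roots_of_unity[of _ n]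
      by (intro sum.cong refl) (auto simp: scaleR_eq_scaleC)
    also have "\<dots> = real n *\<^sub>R x" using n by (simp add: sum.delta)
    finally show ?thesis using n by simp
  qed
  have G_right: "G n q x - q ^ n *\<^sub>R (T ^^ n) (G n q x) = x" if n: "n > 0" "0 \<le> q" "q \<le> r" for n q x
  proof -
    have "(T ^^ n) (F v x) = F v ((T ^^ n) x)" if "cmod v < 1" for v
      by (induction n) (simp_all add: FT that)
    then have "q ^ n *\<^sub>R (T ^^ n) (G n q x) = G n q (q ^ n *\<^sub>R (T ^^ n) x)"
      using u(2)[OF n(2,3)] bounded_clinearD(5)[OF bounded_clinear_pow[OF T]] bounded_clinearD(5)[OF F(1)]
      by (simp add: G_def bounded_clinearD(8)[OF bounded_clinear_pow[OF T]]) (simp add: scaleR_sum_right)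
    moreover have "G n q x - G n q (q ^ n *\<^sub>R (T ^^ n) x) = G n q (x - q ^ n *\<^sub>R (T ^^ n) x)"
      using u(2)[OF n(2,3)] bounded_clinearD(2)[OF F(1)]
      by (simp add: G_def scaleR_diff_right sum_subtractf)
    ultimately show ?thesis using G_left[OF n] by simp
  qed
  \<comment> \<open>With this constant, moving q by at most \<delta> changes \<open>G n q y\<close>
    by at most a quarter of \<open>norm y\<close>.\<close>
  define \<delta> where "\<delta> = 1 / (4 * (M * (B * M)))"
  have "\<delta> > 0" using M B by (simp add: \<delta>_def)
  define P where "P q \<longleftrightarrow> (\<forall>\<eta>>0. \<exists>N. \<forall>n\<ge>N. \<forall>x. norm (q ^ n *\<^sub>R (T ^^ n) x) \<le> \<eta> * norm x)" for q :: real
  \<comment> \<open>For y = x - q'^n T^n x the average at q' returns x exactly, and the average at q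
    returns y up to q^n T^n, which is small by \<open>P q\<close>. The two errors of a quarter give
    norm (x - y) <= norm y / 2.\<close>
  have step: "\<exists>N. \<forall>n\<ge>N. \<forall>x. norm (q' ^ n *\<^sub>R (T ^^ n) x) \<le> norm x"
    if qs: "P q" "0 \<le> q" "q \<le> q'" "q' \<le> r" "q' - q \<le> \<delta>" for q q'
  proof -
    obtain N where N: "\<And>n x. n \<ge> N \<Longrightarrow> norm (q ^ n *\<^sub>R (T ^^ n) x) \<le> 1 / (4 * M) * norm x"
      using \<open>P q\<close> M(1) unfolding P_def by (metis divide_pos_pos mult_pos_pos zero_less_numeral zero_less_one)
    have "norm (q' ^ n *\<^sub>R (T ^^ n) x) \<le> norm x" if n: "n \<ge> N" "n > 0" for n x
    proof -
      define y where "y = x - q' ^ n *\<^sub>R (T ^^ n) x"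
      have qr: "q \<le> r" using qs by simp
      have "G n q y - q ^ n *\<^sub>R (T ^^ n) (G n q y) = y" by (rule G_right) (use n qs qr in auto)
      then have "G n q y - y = q ^ n *\<^sub>R (T ^^ n) (G n q y)" by (simp only: diff_eq_eq add.commute)
      then have "norm (G n q y - y) = norm (q ^ n *\<^sub>R (T ^^ n) (G n q y))" by (rule arg_cong)
      also have "\<dots> \<le> 1 / (4 * M) * (M * norm y)"
        using qs n M(1) qr by (intro order_trans[OF N] mult_left_mono G_bound) auto
      finally have 1: "norm (G n q y - y) \<le> norm y / 4" using M by simp
      have "\<bar>q' - q\<bar> * (M * (B * M)) * norm y \<le> \<delta> * (M * (B * M)) * norm y"
        using qs M B by (intro mult_right_mono) auto
      then have "norm (G n q' y - G n q y) \<le> norm y / 4"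
        using G_lip[of n q' q y] qs n M B by (simp add: \<delta>_def)
      with 1 have "norm (G n q' y - y) \<le> norm y / 2"
        using norm_triangle_ineq[of "G n q' y - G n q y" "G n q y - y"] by simp
      moreover have "G n q' y = x" unfolding y_def using G_left qs n by simp
      ultimately have "norm (q' ^ n *\<^sub>R (T ^^ n) x) \<le> norm (x - q' ^ n *\<^sub>R (T ^^ n) x) / 2"
        by (simp add: y_def)
      also have "\<dots> \<le> (norm x + norm (q' ^ n *\<^sub>R (T ^^ n) x)) / 2"
        using norm_triangle_ineq4[of x "q' ^ n *\<^sub>R (T ^^ n) x"] by simp
      finally show ?thesis by simp
    qed
    then show ?thesis by (intro exI[of _ "max N 1"]) auto
  qed
  have P0: "P 0" unfolding P_def by (auto intro!: exI[of _ 1] simp: power_0_left)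
  have "P q" if "0 \<le> q" "q < r" "q \<le> real k * (\<delta> / 2)" for q k
    using that
  proof (induction k arbitrary: q)
    case 0
    then show ?case using P0 by simp
  next
    case (Suc k)
    \<comment> \<open>The step starts half a \<delta> below q and ends beyond q. The surplus turns
      boundedness at q' into convergence to 0 at q, through the factor (q / q')^n.\<close>
    define q0 where "q0 = max 0 (q - \<delta> / 2)"
    define q' where "q' = min r (q + \<delta> / 2)"
    have "P q0" using Suc.prems \<open>\<delta> > 0\<close> r
      by (intro Suc.IH) (auto simp: q0_def field_simps max_def)
    moreover have "0 \<le> q0" "q0 \<le> q'" "q' \<le> r" "q' - q0 \<le> \<delta>" "q < q'"
      using Suc.prems \<open>\<delta> > 0\<close> by (auto simp: q0_def q'_def)
    ultimately obtain N where N: "\<And>n x. n \<ge> N \<Longrightarrow> norm (q' ^ n *\<^sub>R (T ^^ n) x) \<le> norm x"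
      using step by blast
    show "P q" unfolding P_def
    proof (intro allI impI)
      fix \<eta> :: real assume "\<eta> > 0"
      have qq: "0 \<le> q / q'" "q / q' < 1" using Suc.prems \<open>q < q'\<close> by auto
      then obtain m where m: "(q / q') ^ m < \<eta>" using real_arch_pow_inv[OF \<open>\<eta> > 0\<close>] by blast
      have "norm (q ^ n *\<^sub>R (T ^^ n) x) \<le> \<eta> * norm x" if "n \<ge> max N m" for n x
      proof -
        have "norm (q ^ n *\<^sub>R (T ^^ n) x) = (q / q') ^ n * norm (q' ^ n *\<^sub>R (T ^^ n) x)"
          using Suc.prems \<open>q < q'\<close> by (simp add: power_divide)
        also have "\<dots> \<le> (q / q') ^ m * norm x"
          using qq N that by (intro mult_mono power_decreasing) auto
        also have "\<dots> \<le> \<eta> * norm x" using m by (intro mult_right_mono) auto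
        finally show ?thesis .
      qed
      then show "\<exists>N. \<forall>n\<ge>N. \<forall>x. norm (q ^ n *\<^sub>R (T ^^ n) x) \<le> \<eta> * norm x" by blast
    qed
  qed
  moreover obtain k where "q1 / (\<delta> / 2) \<le> real k" using real_arch_simple by blast
  ultimately have "P q1" using r \<open>\<delta> > 0\<close> by (simp add: field_simps)
  then obtain N where N: "\<And>n x. n \<ge> N \<Longrightarrow> norm (q1 ^ n *\<^sub>R (T ^^ n) x) \<le> 1 * norm x"
    unfolding P_def by (meson zero_less_one)
  have "norm ((T ^^ n) x) \<le> \<rho> ^ n * norm x" if "n \<ge> N" for n x
    using N[OF that, of x] \<open>\<rho> > 1\<close> by (simp add: q1_def power_divide field_simps)
  then show ?thesis by blast
qed

end

subsection \<open>Polynomials in an operator\<close>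

text \<open>Horner evaluation with the scalar multiplication as a parameter, so that real and
  complex coefficients share one theory.\<close>

definition opoly :: "('a::zero \<Rightarrow> 'b \<Rightarrow> 'b) \<Rightarrow> ('b \<Rightarrow> 'b) \<Rightarrow> 'a poly \<Rightarrow> 'b::ab_group_add \<Rightarrow> 'b" where
  "opoly sc T p = fold_coeffs (\<lambda>c f x. sc c x + T (f x)) p (\<lambda>_. 0)"

lemma opoly_0 [simp]: "opoly sc T 0 x = 0"
  by (simp add: opoly_def)

context vector_space
begin

lemma opoly_pCons:
  assumes "Vector_Spaces.linear scale scale T"
  shows "opoly scale T (pCons c p) x = scale c x + T (opoly scale T p x)"
proof -
  interpret Vector_Spaces.linear scale scale T by (rule assms)
  show ?thesis by (cases "c = 0 \<and> p = 0") (auto simp: opoly_def zero)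
qed

context
  fixes T assumes T: "Vector_Spaces.linear scale scale T"
begin

interpretation T: Vector_Spaces.linear scale scale T by (rule T)

lemma opoly_commute: "opoly scale T p (T x) = T (opoly scale T p x)"
  by (induction p) (simp_all add: opoly_pCons[OF T] T.add T.scale T.zero)

lemma opoly_add: "opoly scale T (p + q) x = opoly scale T p x + opoly scale T q x"
proof (induction p arbitrary: q)
  case (pCons c p)
  then show ?case by (cases q) (simp add: opoly_pCons[OF T] T.add scale_left_distrib)
qed simp

lemma opoly_smult: "opoly scale T (smult c p) x = scale c (opoly scale T p x)"
  by (induction p) (simp_all add: opoly_pCons[OF T] T.scale scale_right_distrib)

lemma opoly_minus: "opoly scale T (- p) x = - opoly scale T p x"
  using opoly_smult[of "-1" p x] by simp

lemma opoly_diff: "opoly scale T (p - q) x = opoly scale T p x - opoly scale T q x"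
  using opoly_add[of p "- q" x] by (simp add: opoly_minus)

lemma opoly_mult: "opoly scale T (p * q) x = opoly scale T p (opoly scale T q x)"
  by (induction p) (simp_all add: mult_pCons_left opoly_add opoly_smult opoly_pCons[OF T])

lemma opoly_1: "opoly scale T 1 x = x"
  by (simp add: one_pCons opoly_pCons[OF T] T.zero)

lemma opoly_X_power: "opoly scale T ([:0, 1:] ^ n) x = (T ^^ n) x"
  by (induction n) (simp_all add: opoly_1 opoly_mult opoly_pCons[OF T] T.zero opoly_commute)

lemma opoly_sum: "opoly scale T (sum f I) x = (\<Sum>i\<in>I. opoly scale T (f i) x)"
  by (induction I rule: infinite_finite_induct) (auto simp: opoly_add)

end

end

lemma poly_map_of_real: "poly (map_poly complex_of_real p) (complex_of_real t) = complex_of_real (poly p t)"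
  by (induction p) (auto simp: map_poly_pCons)

context complex_banach
begin

lemma opoly_map_of_real: "opoly scaleC T (map_poly complex_of_real p) x = opoly scaleR T p x"
  if "Vector_Spaces.linear scaleC scaleC T" "linear T"
proof (induction p)
  case (pCons c p)
  then show ?case
    using that by (simp add: map_poly_pCons opoly_pCons real_vector.opoly_pCons linear_def scaleC_of_real)
qed (simp add: map_poly_0)

lemma bounded_clinear_opoly:
  assumes T: "bounded_clinear scaleC T"
  shows "bounded_clinear scaleC (opoly scaleC T p)"
proof (induction p)
  case 0
  then show ?case using bounded_clinear_zero by (simp add: opoly_def)
next
  case (pCons c p)
  have "bounded_clinear scaleC (\<lambda>x. c *\<^sub>C x + T (opoly scaleC T p x))"
    by (intro bounded_clinear_add bounded_clinear_scale bounded_clinear_compose[OF T] pCons)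
  then show ?case using opoly_pCons[OF bounded_clinearD(7)[OF T], of c p] by presburger
qed

end

section \<open>Polynomials in L(a, a) and the spectrum axiom\<close>

context jb_star_triple
begin

lemma bounded_clinear_triple: "bounded_clinear scaleC (triple a a)"
  using hermitian[of a] by (simp add: hermitian_op_def)

lemma clinear_triple: "Vector_Spaces.linear scaleC scaleC (triple a a)"
  by (rule bounded_clinearD(7)[OF bounded_clinear_triple])

lemma linear_triple: "linear (triple a a)"
  by (rule bounded_linear.linear[OF bounded_linear_triple_right])

text \<open>Over the complex numbers p splits into linear factors whose roots avoid the half-line t
  >= 0; by the spectrum axiom each factor is invertible at L(a, a).\<close>

lemma opoly_invertible:
  assumes "\<And>t. t \<ge> 0 \<Longrightarrow> poly p (complex_of_real t) \<noteq> 0"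
  shows "\<exists>S. bounded_clinear scaleC S \<and> (\<forall>x. S (opoly scaleC (triple a a) p x) = x)
    \<and> (\<forall>x. opoly scaleC (triple a a) p (S x) = x)"
  using assms
proof (induction "degree p" arbitrary: p)
  case 0
  then obtain c where c: "p = [:c:]" by (metis degree_eq_zeroE)
  then have "c \<noteq> 0" using 0(2)[of 0] by auto
  then show ?case using c bounded_clinear_scale[of "1 / c"]
    by (intro exI[of _ "\<lambda>x. (1 / c) *\<^sub>C x"]) (simp add: opoly_pCons[OF clinear_triple])
next
  case (Suc n)
  have "\<not> constant (poly p)" using Suc(2) by (simp add: constant_degree)
  then obtain z where "poly p z = 0" using fundamental_theorem_of_algebra by blast
  then obtain q where q: "p = [:- z, 1:] * q" by (metis poly_eq_0_iff_dvd dvdE)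
  have "p \<noteq> 0" using Suc(2) by auto
  then have "degree p = degree [:- z, 1:] + degree q" unfolding q by (intro degree_mult_eq) auto
  then have "n = degree q" using Suc(2) by simp
  moreover have "poly q (complex_of_real t) \<noteq> 0" if "t \<ge> 0" for t using Suc(3)[OF that] q by auto
  ultimately obtain S1 where S1: "bounded_clinear scaleC S1"
    "\<And>x. S1 (opoly scaleC (triple a a) q x) = x" "\<And>x. opoly scaleC (triple a a) q (S1 x) = x"
    using Suc(1) by metis
  have "z \<notin> complex_of_real ` {0..}" using Suc(3) \<open>poly p z = 0\<close> by auto
  then have "z \<notin> op_spectrum scaleC (triple a a)" using spectrum_nonneg by blast
  then obtain S2 where S2: "bounded_clinear scaleC S2"
    "S2 \<circ> (\<lambda>x. z *\<^sub>C x - triple a a x) = id" "(\<lambda>x. z *\<^sub>C x - triple a a x) \<circ> S2 = id"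
    by (auto simp: op_spectrum_def)
  have S2': "S2 (z *\<^sub>C x - triple a a x) = x" "z *\<^sub>C S2 x - triple a a (S2 x) = x" for x
    using S2(2,3) by (auto simp: fun_eq_iff)
  have p: "opoly scaleC (triple a a) p x = - (z *\<^sub>C opoly scaleC (triple a a) q x
      - triple a a (opoly scaleC (triple a a) q x))" for x
    unfolding q by (simp only: opoly_mult[OF clinear_triple] opoly_pCons[OF clinear_triple])
      (simp add: scale_minus_left)
  show ?case
  proof (intro exI[of _ "\<lambda>x. S1 (S2 ((-1) *\<^sub>C x))"] conjI allI)
    show "bounded_clinear scaleC (\<lambda>x. S1 (S2 (-1 *\<^sub>C x)))"
      by (intro bounded_clinear_compose[OF S1(1)] bounded_clinear_compose[OF S2(1)] bounded_clinear_scale)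
    show "S1 (S2 (-1 *\<^sub>C opoly scaleC (triple a a) p x)) = x" for x
      unfolding p by (simp add: scale_minus_left S2' S1 del: minus_diff_eq)
    show "opoly scaleC (triple a a) p (S1 (S2 (-1 *\<^sub>C x))) = x" for x
      unfolding p by (simp add: S2' S1 scale_minus_left del: minus_diff_eq)
  qed
qed

text \<open>Let L = L(a, a) and T = P(L) Q(L)^-1. Then 1 - zT = (Q - zP)(L) Q(L)^-1, and Q - zP has
  no root on the half-line when |z| < 1, so the spectral radius of T is at most 1.\<close>

lemma norm_opoly_power_le:
  fixes P Q :: "real poly"
  assumes PQ: "\<And>t. t \<ge> 0 \<Longrightarrow> \<bar>poly P t\<bar> \<le> poly Q t" "\<And>t. t \<ge> 0 \<Longrightarrow> poly Q t > 0" and "\<rho> > 1"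
  shows "\<exists>N. \<forall>n\<ge>N. \<forall>x. norm (opoly scaleR (triple a a) (P ^ n) x)
    \<le> \<rho> ^ n * norm (opoly scaleR (triple a a) (Q ^ n) x)"
proof -
  define L where "L = triple a a"
  note L = clinear_triple[of a, folded L_def] linear_triple[of a, folded L_def]
  note Lb = bounded_clinear_triple[of a, folded L_def]
  have conv: "opoly scaleC L (map_poly complex_of_real p) x = opoly scaleR L p x" for p x
    by (rule opoly_map_of_real[OF L])
  have conv': "opoly scaleC L (map_poly complex_of_real p) = opoly scaleR L p" for p
    by (rule ext) (rule conv)
  have bc: "bounded_clinear scaleC (opoly scaleR L p)" for p
    using bounded_clinear_opoly[OF Lb, of "map_poly complex_of_real p"] by (simp add: conv')
  have g_inv: "\<exists>S. bounded_clinear scaleC S \<and> (\<forall>x. S (opoly scaleR L Q x - z *\<^sub>C opoly scaleR L P x) = x)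
    \<and> (\<forall>x. opoly scaleR L Q (S x) - z *\<^sub>C opoly scaleR L P (S x) = x)" if "cmod z < 1" for z
  proof -
    define g where "g = map_poly complex_of_real Q - smult z (map_poly complex_of_real P)"
    have "poly g (complex_of_real t) \<noteq> 0" if t: "t \<ge> 0" for t
    proof
      assume "poly g (complex_of_real t) = 0"
      then have "complex_of_real (poly Q t) = z * complex_of_real (poly P t)"
        by (simp add: g_def poly_map_of_real)
      then have "cmod (complex_of_real (poly Q t)) = cmod z * \<bar>poly P t\<bar>"
        by (simp add: norm_mult)
      also have "\<dots> \<le> cmod z * poly Q t" using PQ(1)[OF t] by (intro mult_left_mono) auto
      also have "\<dots> < poly Q t" using PQ(2)[OF t] \<open>cmod z < 1\<close> by simp
      finally show False by simp
    qed
    then show ?thesis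
      using opoly_invertible[of g a, folded L_def]
      by (simp add: g_def opoly_diff[OF L(1)] opoly_smult[OF L(1)] conv)
  qed
  obtain S where S: "bounded_clinear scaleC S" "\<And>x. S (opoly scaleR L Q x) = x" "\<And>x. opoly scaleR L Q (S x) = x"
    using g_inv[of 0] by auto
  define T where "T = (\<lambda>x. opoly scaleR L P (S x))"
  have T: "bounded_clinear scaleC T" unfolding T_def by (rule bounded_clinear_compose[OF bc S(1)])
  have "\<exists>F. bounded_clinear scaleC F \<and> (\<forall>x. F (x - z *\<^sub>C T x) = x) \<and> (\<forall>x. F x - z *\<^sub>C T (F x) = x)"
    if z: "cmod z < 1" for z
  proof -
    obtain U where U: "bounded_clinear scaleC U" "\<And>x. U (opoly scaleR L Q x - z *\<^sub>C opoly scaleR L P x) = x"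
      "\<And>x. opoly scaleR L Q (U x) - z *\<^sub>C opoly scaleR L P (U x) = x"
      using g_inv[OF z] by blast
    have "opoly scaleR L Q (U (x - z *\<^sub>C T x)) = x" for x
      using U(2)[of "S x"] by (simp add: T_def S)
    moreover have "opoly scaleR L Q (U x) - z *\<^sub>C T (opoly scaleR L Q (U x)) = x" for x
      by (simp add: T_def S U)
    ultimately show ?thesis
      by (intro exI[of _ "\<lambda>x. opoly scaleR L Q (U x)"]) (auto intro: bounded_clinear_compose[OF bc U(1)])
  qed
  from spectral_radius_le_1[OF T this \<open>\<rho> > 1\<close>]
  obtain N where N: "\<And>n x. n \<ge> N \<Longrightarrow> norm ((T ^^ n) x) \<le> \<rho> ^ n * norm x" by blast
  have "(T ^^ n) (opoly scaleR L (Q ^ n) x) = opoly scaleR L (P ^ n) x" for n x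
  proof (induction n arbitrary: x)
    case (Suc n)
    have "(T ^^ Suc n) (opoly scaleR L (Q ^ Suc n) x) = (T ^^ n) (T (opoly scaleR L Q (opoly scaleR L (Q ^ n) x)))"
      by (simp add: real_vector.opoly_mult[OF L(2)] funpow_swap1)
    also have "T (opoly scaleR L Q (opoly scaleR L (Q ^ n) x)) = opoly scaleR L (Q ^ n) (opoly scaleR L P x)"
      by (simp add: T_def S) (simp add: mult.commute flip: real_vector.opoly_mult[OF L(2)])
    also have "(T ^^ n) \<dots> = opoly scaleR L (P ^ n) (opoly scaleR L P x)" by (rule Suc)
    finally show ?case by (simp add: mult.commute[of P] flip: real_vector.opoly_mult[OF L(2)])
  qed (simp add: real_vector.opoly_1[OF L(2)])
  then show ?thesis using N unfolding L_def by metis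
qed


subsection \<open>Odd functional calculus\<close>

text \<open>\<open>odd_poly a p\<close> is the value at \<open>a\<close> of the odd function \<open>t p(t\<^sup>2)\<close>.\<close>

definition odd_poly :: "'e \<Rightarrow> real poly \<Rightarrow> 'e" where
  "odd_poly a p = opoly scaleR (triple a a) p a"

lemma odd_poly_add: "odd_poly a (p + q) = odd_poly a p + odd_poly a q"
  and odd_poly_diff: "odd_poly a (p - q) = odd_poly a p - odd_poly a q"
  and odd_poly_smult: "odd_poly a (smult c p) = c *\<^sub>R odd_poly a p"
  and odd_poly_1: "odd_poly a 1 = a"
  and odd_poly_X: "odd_poly a ([:0, 1:] ^ n) = odd_power a n"
  and odd_poly_mult: "odd_poly a (p * q) = opoly scaleR (triple a a) p (odd_poly a q)"
  and odd_poly_sum: "odd_poly a (sum f I) = (\<Sum>i\<in>I. odd_poly a (f i))" for f :: "nat \<Rightarrow> real poly"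
  by (simp_all add: odd_poly_def odd_power_def real_vector.opoly_add[OF linear_triple]
      real_vector.opoly_diff[OF linear_triple] real_vector.opoly_smult[OF linear_triple]
      real_vector.opoly_1[OF linear_triple] real_vector.opoly_X_power[OF linear_triple]
      real_vector.opoly_mult[OF linear_triple] real_vector.opoly_sum[OF linear_triple])

text \<open>The exponents i, j, k stay free because splitting off a constant coefficient shifts the
  rest of the polynomial to the next odd power.\<close>

lemma triple_opoly_odd_power:
  fixes a :: 'e
  defines "R \<equiv> \<lambda>p i. opoly scaleR (triple a a) p (odd_power a i)"
  shows "triple (R p i) (R q j) (R r k) = R (p * q * r) (i + j + k + 1)"
proof -
  note lin = linear_triple[of a]
  have R_pCons: "R (pCons c p) i = c *\<^sub>R odd_power a i + R p (Suc i)" for c p i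
    by (simp add: R_def real_vector.opoly_pCons[OF lin] odd_power_Suc real_vector.opoly_commute[OF lin])
  have R_0: "R 0 i = 0" for i by (simp add: R_def)
  have R_mult: "R (pCons c p * q) i = c *\<^sub>R R q i + R (p * q) (Suc i)" for c p q i
    by (simp add: R_def mult_pCons_left real_vector.opoly_add[OF lin] real_vector.opoly_smult[OF lin]
        real_vector.opoly_pCons[OF lin] odd_power_Suc real_vector.opoly_commute[OF lin])
  have 1: "triple (odd_power a i) (odd_power a j) (R r k) = R r (i + j + k + 1)" for i j k
    by (induction r arbitrary: k) (simp_all add: R_0 R_pCons triple_simps triple_odd_power)
  have 2: "triple (odd_power a i) (R q j) (R r k) = R (q * r) (i + j + k + 1)" for i j k
    by (induction q arbitrary: j) (simp_all add: R_0 R_pCons R_mult triple_simps 1 del: mult_pCons_left)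
  show ?thesis
    by (induction p arbitrary: i) (simp_all add: R_0 R_pCons R_mult triple_simps 2 mult.assoc del: mult_pCons_left)
qed

lemma triple_odd_poly:
  "triple (odd_poly a p) (odd_poly a q) (odd_poly a r) = odd_poly a ([:0, 1:] * p * q * r)"
proof -
  have "odd_poly a ([:0, 1:] * p * q * r) = odd_poly a (p * q * r * [:0, 1:] ^ 1)"
    by (simp add: mult_ac)
  also have "\<dots> = opoly scaleR (triple a a) (p * q * r) (odd_power a 1)"
    by (simp only: odd_poly_mult odd_poly_X)
  finally show ?thesis
    using triple_opoly_odd_power[of a p 0 q 0 r 0] by (simp add: odd_poly_def)
qed

text \<open>The 3^k-th power of t p(t^2) is t (t^2)^m p(t^2)^(3^k) with 3^k = 2m + 1, again an odd
  function.\<close>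

lemma cube_odd_poly:
  "\<exists>m. 3 ^ k = 2 * m + 1 \<and> (\<forall>p. (cube ^^ k) (odd_poly a p) = odd_poly a ([:0, 1:] ^ m * p ^ (3 ^ k)))"
proof (induction k)
  case 0
  show ?case by (intro exI[of _ 0]) simp
next
  case (Suc k)
  then obtain m where m: "3 ^ k = 2 * m + 1"
    "\<And>p. (cube ^^ k) (odd_poly a p) = odd_poly a ([:0, 1:] ^ m * p ^ (3 ^ k))" by blast
  have "(cube ^^ Suc k) (odd_poly a p) = odd_poly a ([:0, 1:] ^ (3 * m + 1) * p ^ (3 ^ Suc k))" for p
  proof -
    have "(3::nat) ^ Suc k = 3 ^ k + 3 ^ k + 3 ^ k" by simp
    then show ?thesis
      by (simp only: funpow.simps comp_apply m(2) triple_odd_poly power_add)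
        (simp add: mult_ac power_add power_mult power3_eq_cube)
  qed
  then show ?case using m(1) by (intro exI[of _ "3 * m + 1"]) simp
qed

text \<open>After k cubings the left side is one triple product of iterated cubes, so the bound K of
  the product enters only once and disappears under the 3^k-th root.\<close>

lemma norm_odd_poly_X_mult: "norm (odd_poly a ([:0, 1:] * p)) \<le> (norm a)\<^sup>2 * norm (odd_poly a p)"
proof -
  obtain K where K: "\<And>x y z. norm (triple x y z) \<le> K * norm x * norm y * norm z"
    using triple_bounded by blast
  show ?thesis
  proof (rule power3_cube_le[where C = K and N = 0])
    fix k :: nat
    obtain m where m: "3 ^ k = 2 * m + 1"
      "\<And>p. (cube ^^ k) (odd_poly a p) = odd_poly a ([:0, 1:] ^ m * p ^ (3 ^ k))"
      using cube_odd_poly by blast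
    have pow: "norm (odd_poly a ([:0, 1:] ^ m * p ^ 3 ^ k)) = norm (odd_poly a p) ^ 3 ^ k" for p
      using m(2)[of p] by (simp flip: norm_cube_iter)
    have X: "norm (odd_poly a ([:0, 1:] ^ m)) = norm a ^ 3 ^ k"
      using pow[of 1] by (simp add: odd_poly_1)
    have "[:0, 1:] ^ m * ([:0, 1:] * p) ^ 3 ^ k
        = [:0, 1:] * [:0, 1:] ^ m * [:0, 1:] ^ m * ([:0, 1:] ^ m * p ^ 3 ^ k)"
      unfolding power_mult_distrib by (simp only: m(1) mult_2 power_one_right power_add power_mult) (simp only: mult_ac)
    then have "norm (odd_poly a ([:0, 1:] * p)) ^ 3 ^ k
      = norm (triple (odd_poly a ([:0, 1:] ^ m)) (odd_poly a ([:0, 1:] ^ m)) (odd_poly a ([:0, 1:] ^ m * p ^ 3 ^ k)))"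
      by (simp only: flip: pow triple_odd_poly)
    also have "\<dots> \<le> K * norm a ^ 3 ^ k * norm a ^ 3 ^ k * norm (odd_poly a p) ^ 3 ^ k"
      using K[of "odd_poly a ([:0, 1:] ^ m)" "odd_poly a ([:0, 1:] ^ m)" "odd_poly a ([:0, 1:] ^ m * p ^ 3 ^ k)"]
      unfolding X pow .
    finally show "norm (odd_poly a ([:0, 1:] * p)) ^ 3 ^ k \<le> K * ((norm a)\<^sup>2 * norm (odd_poly a p)) ^ 3 ^ k"
      by (simp add: power_mult_distrib power2_eq_square mult_ac)
  qed auto
qed

lemma norm_odd_power_le: "norm a \<le> 1 \<Longrightarrow> norm (odd_power a n) \<le> 1"
proof (induction n)
  case (Suc n)
  have "norm (odd_power a (Suc n)) \<le> (norm a)\<^sup>2 * norm (odd_power a n)"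
    using norm_odd_poly_X_mult[of a "[:0, 1:] ^ n"] odd_poly_X[of a "Suc n"] by (simp add: odd_poly_X)
  also have "\<dots> \<le> 1 * 1" using Suc by (intro mult_mono) (auto simp: power_le_one)
  finally show ?case by simp
qed simp

text \<open>Iterated cubing turns P * w into the 3^k-th power of P at L(a, a), applied to a vector
  that does not depend on P. So \<open>norm_opoly_power_le\<close> applies with n = 3^k, up to a
  factor \<rho> arbitrarily close to 1.\<close>

lemma norm_odd_poly_mono:
  assumes PQ: "\<And>t. t \<ge> 0 \<Longrightarrow> \<bar>poly P t\<bar> \<le> poly Q t" "\<And>t. t \<ge> 0 \<Longrightarrow> poly Q t > 0"
  shows "norm (odd_poly a (P * w)) \<le> norm (odd_poly a (Q * w))"
proof -
  have le: "norm (odd_poly a (P * w)) \<le> \<rho> * norm (odd_poly a (Q * w))" if \<rho>: "\<rho> > 1" for \<rho>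
  proof -
    obtain N where N: "\<And>n x. n \<ge> N \<Longrightarrow> norm (opoly scaleR (triple a a) (P ^ n) x)
      \<le> \<rho> ^ n * norm (opoly scaleR (triple a a) (Q ^ n) x)"
      using norm_opoly_power_le[OF PQ \<rho>] by blast
    show ?thesis
    proof (rule power3_cube_le[where C = 1 and N = N])
      fix k assume "k \<ge> N"
      have "m < 3 ^ m" for m :: nat by (induction m) auto
      from this[of k] have n: "3 ^ k \<ge> N" using \<open>k \<ge> N\<close> by linarith
      obtain m where m: "\<And>p. (cube ^^ k) (odd_poly a p) = odd_poly a ([:0, 1:] ^ m * p ^ (3 ^ k))"
        using cube_odd_poly by blast
      have pow: "norm (odd_poly a (p * w)) ^ 3 ^ k
        = norm (opoly scaleR (triple a a) (p ^ 3 ^ k) (odd_poly a ([:0, 1:] ^ m * w ^ 3 ^ k)))" for p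
      proof -
        have "norm (odd_poly a (p * w)) ^ 3 ^ k = norm (odd_poly a ([:0, 1:] ^ m * (p * w) ^ 3 ^ k))"
          by (simp only: flip: norm_cube_iter m)
        also have "[:0, 1:] ^ m * (p * w) ^ 3 ^ k = p ^ 3 ^ k * ([:0, 1:] ^ m * w ^ 3 ^ k)"
          by (simp only: power_mult_distrib mult_ac)
        finally show ?thesis by (simp only: odd_poly_mult)
      qed
      show "norm (odd_poly a (P * w)) ^ 3 ^ k \<le> 1 * (\<rho> * norm (odd_poly a (Q * w))) ^ 3 ^ k"
        unfolding power_mult_distrib pow using N[OF n] by simp
    qed (use \<rho> in auto)
  qed
  show ?thesis
  proof (rule ccontr)
    assume "\<not> ?thesis"
    moreover define x where "x = norm (odd_poly a (P * w))"
    moreover define y where "y = norm (odd_poly a (Q * w))"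
    ultimately have xy: "y < x" "0 \<le> y" by auto
    show False
    proof (cases "y = 0")
      case True
      then show False using le[of 2] xy by (simp add: x_def y_def)
    next
      case False
      \<comment> \<open>The mean of 1 and x / y exceeds 1 but stays below x / y.\<close>
      then have "x \<le> (1 + x / y) / 2 * y" unfolding x_def y_def using xy
        by (intro le) (simp add: x_def y_def field_simps)
      then show False using xy False by (simp add: field_simps)
    qed
  qed
qed

text \<open>The 3^k-th power of the maximum is at most the positive polynomial 1 + t^(D 3^k). What
  it leaves are two odd powers of a, of total norm at most 2, and the root removes the 2.\<close>

lemma norm_odd_poly_le_1:
  assumes a: "norm a \<le> 1" and f: "\<And>t. t \<ge> 0 \<Longrightarrow> \<bar>poly f t\<bar> \<le> max 1 (t ^ D)"
  shows "norm (odd_poly a f) \<le> 1"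
proof (rule power3_cube_le[where C = 2 and N = 0])
  fix k :: nat
  obtain m where m: "\<And>p. (cube ^^ k) (odd_poly a p) = odd_poly a ([:0, 1:] ^ m * p ^ (3 ^ k))"
    using cube_odd_poly by blast
  have "norm (odd_poly a f) ^ 3 ^ k = norm (odd_poly a (f ^ 3 ^ k * [:0, 1:] ^ m))"
    by (simp only: mult.commute[of "f ^ 3 ^ k"] flip: norm_cube_iter m)
  also have "\<dots> \<le> norm (odd_poly a ((1 + [:0, 1:] ^ (D * 3 ^ k)) * [:0, 1:] ^ m))"
  proof (rule norm_odd_poly_mono)
    fix t :: real assume t: "t \<ge> 0"
    show "0 < poly (1 + [:0, 1:] ^ (D * 3 ^ k)) t" using t by (simp add: add_pos_nonneg)
    have "\<bar>poly f t\<bar> ^ 3 ^ k \<le> (max 1 (t ^ D)) ^ 3 ^ k" by (intro power_mono f t) auto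
    also have "\<dots> \<le> 1 + t ^ (D * 3 ^ k)" using t by (auto simp: max_def power_mult)
    finally show "\<bar>poly (f ^ 3 ^ k) t\<bar> \<le> poly (1 + [:0, 1:] ^ (D * 3 ^ k)) t"
      by (simp add: power_abs)
  qed
  also have "(1 + [:0, 1:] ^ (D * 3 ^ k)) * [:0, 1:] ^ m = [:0, 1:] ^ m + [:0, 1:] ^ (D * 3 ^ k + m)"
    by (simp only: distrib_right power_add mult_1)
  also have "norm (odd_poly a \<dots>) \<le> norm (odd_power a m) + norm (odd_power a (D * 3 ^ k + m))"
    by (simp only: odd_poly_add odd_poly_X norm_triangle_ineq)
  also have "\<dots> \<le> 2" using norm_odd_power_le[OF a, of m] norm_odd_power_le[OF a, of "D * 3 ^ k + m"] by simp
  finally show "norm (odd_poly a f) ^ 3 ^ k \<le> 2 * 1 ^ 3 ^ k" by simp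
qed auto

end

subsection \<open>Consequences of the Kadec-Klee property\<close>

lemma kadec_klee_subset:
  assumes "kadec_klee A" "B \<subseteq> A"
  shows "kadec_klee B"
proof -
  have "dual_on A \<subseteq> dual_on B" using assms(2) unfolding dual_on_def by blast
  then have "weakly_tendsto_on A x l" if "weakly_tendsto_on B x l" for x l
    using that by (auto simp: weakly_tendsto_on_def)
  then show ?thesis using assms unfolding kadec_klee_def by blast
qed

lemma dual_on_sum:
  assumes f: "f \<in> dual_on A" and A: "subspace A" "\<And>i. i \<in> I \<Longrightarrow> h i \<in> A"
  shows "f (\<Sum>i\<in>I. c i *\<^sub>R h i) = (\<Sum>i\<in>I. c i * f (h i))"
proof -
  have f_add: "f (x + y) = f x + f y" and f_scale: "f (r *\<^sub>R x) = r * f x" if "x \<in> A" "y \<in> A" for x y r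
    using f that by (auto simp: dual_on_def)
  have f0: "f 0 = 0" using f_scale[of 0 0 0] subspace_0[OF A(1)] by simp
  show ?thesis using A(2)
  proof (induction I rule: infinite_finite_induct)
    case (insert i I)
    have "(\<Sum>i\<in>I. c i *\<^sub>R h i) \<in> A"
      using insert A(1) by (intro subspace_sum) (auto intro: subspace_scale)
    moreover have "h i \<in> A" using insert by simp
    ultimately show ?case using insert A(1) by (simp add: f_add f_scale subspace_scale)
  qed (simp_all add: f0)
qed

text \<open>Taking for each j the sign of \<open>f (h j)\<close> bounds the sum of the absolute
  values, so the series of the \<open>f (h j)\<close> converges absolutely.\<close>

lemma weakly_null_of_bounded_signed_sums:
  assumes A: "subspace A" "\<And>j. h j \<in> A" and f: "f \<in> dual_on A"
    and C: "\<And>J \<epsilon>. (\<And>j. \<epsilon> j = 1 \<or> \<epsilon> j = -1) \<Longrightarrow> norm (\<Sum>j<J. \<epsilon> j *\<^sub>R h j) \<le> C"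
  shows "(\<lambda>j. f (h j)) \<longlonglongrightarrow> 0"
proof -
  obtain K where K: "\<And>x. x \<in> A \<Longrightarrow> \<bar>f x\<bar> \<le> K * norm x" using f unfolding dual_on_def by blast
  define \<epsilon> :: "nat \<Rightarrow> real" where "\<epsilon> j = (if f (h j) \<ge> 0 then 1 else -1)" for j
  have "(\<Sum>j<J. norm (f (h j))) \<le> max K 0 * C" for J
  proof -
    have "(\<Sum>j<J. norm (f (h j))) = f (\<Sum>j<J. \<epsilon> j *\<^sub>R h j)"
      unfolding dual_on_sum[OF f A(1) A(2)] by (intro sum.cong) (auto simp: \<epsilon>_def)
    also have "\<dots> \<le> K * norm (\<Sum>j<J. \<epsilon> j *\<^sub>R h j)"
      by (intro abs_le_D1[OF K] subspace_sum subspace_scale A)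
    also have "\<dots> \<le> max K 0 * norm (\<Sum>j<J. \<epsilon> j *\<^sub>R h j)" by (intro mult_right_mono) auto
    also have "\<dots> \<le> max K 0 * C" by (intro mult_left_mono C) (auto simp: \<epsilon>_def)
    finally show ?thesis .
  qed
  then have "summable (\<lambda>j. norm (f (h j)))"
    by (intro summableI_nonneg_bounded[where x = "max K 0 * C"]) auto
  then show ?thesis by (rule summable_LIMSEQ_zero[OF summable_norm_cancel])
qed

text \<open>The form in which the Kadec-Klee property is applied every time: perturb a unit vector
  without leaving the sphere.\<close>

lemma kadec_klee_perturbation:
  assumes A: "kadec_klee A" "subspace A" and l: "l \<in> A" "norm l = 1"
    and h: "\<And>n. h n \<in> A" "\<And>n. norm (l + h n) = 1" "\<And>f. f \<in> dual_on A \<Longrightarrow> (\<lambda>n. f (h n)) \<longlonglongrightarrow> 0"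
  shows "h \<longlonglongrightarrow> 0"
proof -
  have "weakly_tendsto_on A (\<lambda>n. l + h n) l"
    unfolding weakly_tendsto_on_def
  proof
    fix f assume f: "f \<in> dual_on A"
    have "f (l + h n) = f l + f (h n)" for n using f l(1) h(1) by (simp add: dual_on_def)
    then show "(\<lambda>n. f (l + h n)) \<longlonglongrightarrow> f l" using tendsto_add[OF tendsto_const h(3)[OF f], of "f l"] by simp
  qed
  moreover have "\<forall>n. l + h n \<in> A \<and> norm (l + h n) = 1" using A(2) l h by (simp add: subspace_add)
  ultimately have "(\<lambda>n. l + h n) \<longlonglongrightarrow> l"
    using A(1)[unfolded kadec_klee_def, rule_format, of "\<lambda>n. l + h n" l] l by simp
  then show ?thesis using tendsto_diff[of "\<lambda>n. l + h n" l sequentially "\<lambda>_. l" l] by simp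
qed

context jb_star_triple
begin

text \<open>The locale conditions on A as a predicate, because the arguments pass to smaller sets:
  Peirce spaces and their symmetric parts.\<close>

definition subtriple :: "'e set \<Rightarrow> bool" where
  "subtriple B \<longleftrightarrow> Real_Vector_Spaces.subspace B \<and> closed B \<and> (\<forall>x\<in>B. \<forall>y\<in>B. \<forall>z\<in>B. triple x y z \<in> B)"

lemma subtripleD:
  assumes "subtriple B"
  shows "Real_Vector_Spaces.subspace B" "closed B"
    "x \<in> B \<Longrightarrow> y \<in> B \<Longrightarrow> z \<in> B \<Longrightarrow> triple x y z \<in> B"
    "0 \<in> B" "x \<in> B \<Longrightarrow> y \<in> B \<Longrightarrow> x + y \<in> B" "x \<in> B \<Longrightarrow> y \<in> B \<Longrightarrow> x - y \<in> B" "x \<in> B \<Longrightarrow> r *\<^sub>R x \<in> B"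
    "x \<in> B \<Longrightarrow> - x \<in> B"
  using assms
  by (auto simp: subtriple_def intro: Real_Vector_Spaces.subspace_0 Real_Vector_Spaces.subspace_add
      Real_Vector_Spaces.subspace_diff Real_Vector_Spaces.subspace_scale Real_Vector_Spaces.subspace_neg)

lemma subtriple_Int_peirce:
  assumes B: "subtriple B" and c: "c = 0 \<or> c = 1/2 \<or> c = 1"
  shows "subtriple (B \<inter> peirce e c)"
  unfolding subtriple_def
proof (intro conjI ballI)
  show "Real_Vector_Spaces.subspace (B \<inter> peirce e c)"
    using subtripleD[OF B]
    by (auto simp: Real_Vector_Spaces.subspace_def peirce_zero peirce_add peirce_scaleR)
  show "closed (B \<inter> peirce e c)" using subtripleD(2)[OF B] closed_peirce by blast
  fix x y z assume "x \<in> B \<inter> peirce e c" "y \<in> B \<inter> peirce e c" "z \<in> B \<inter> peirce e c"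
  then show "triple x y z \<in> B \<inter> peirce e c"
    using subtripleD(3)[OF B, of x y z] peirce_triple[of x e c y c z c] c by auto
qed

lemma odd_power_in_subtriple: "subtriple B \<Longrightarrow> a \<in> B \<Longrightarrow> odd_power a n \<in> B"
  by (induction n) (auto simp: odd_power_Suc subtripleD)

text \<open>The norms decrease with n and equal 1 at the arbitrarily large indices that belong to
  iterated cubes.\<close>

lemma norm_odd_power:
  assumes "norm a = 1"
  shows "norm (odd_power a n) = 1"
proof -
  have anti: "norm (odd_power a (n + k)) \<le> norm (odd_power a n)" for n k
  proof (induction k)
    case (Suc k)
    have "norm (odd_power a (Suc (n + k))) \<le> norm (odd_power a (n + k))"
      using norm_odd_poly_X_mult[of a "[:0, 1:] ^ (n + k)"] odd_poly_X[of a "Suc (n + k)"] assms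
      by (simp add: odd_poly_X)
    then show ?case using Suc by simp
  qed simp
  obtain m where m: "3 ^ Suc n = 2 * m + 1"
    "(cube ^^ Suc n) (odd_poly a 1) = odd_poly a ([:0, 1:] ^ m * 1 ^ (3 ^ Suc n))"
    using cube_odd_poly[of "Suc n" a] by blast
  have "n < 3 ^ n" by (induction n) auto
  then have "n \<le> m" using m(1) by simp
  have "norm (odd_power a m) = norm ((cube ^^ Suc n) a)"
    using m(2) by (simp only: odd_poly_1 power_one mult_1_right odd_poly_X)
  then have "norm (odd_power a m) = 1" using norm_cube_iter[of "Suc n" a] assms by simp
  then have "1 \<le> norm (odd_power a n)" using anti[of n "m - n"] \<open>n \<le> m\<close> by simp
  then show ?thesis using norm_odd_power_le[of a n] assms by simp
qed

text \<open>Powers of s are monotone in the exponent and the blocks do not overlap, so whatever the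
  signs, the sum is bounded by a telescoping total variation.\<close>

lemma sum_signed_power_differences:
  fixes s :: real and \<epsilon> :: "nat \<Rightarrow> real"
  assumes s: "s \<ge> 0" and \<epsilon>: "\<And>j. \<epsilon> j = 1 \<or> \<epsilon> j = -1"
    and nm: "\<And>j. t j \<le> n j" "\<And>j. n j \<le> t (Suc j)"
  shows "\<bar>\<Sum>j<J. \<epsilon> j * (s ^ t (Suc j) - s ^ n j)\<bar> \<le> max 1 (s ^ t J)"
proof -
  have "\<bar>\<Sum>j<J. \<epsilon> j * (s ^ t (Suc j) - s ^ n j)\<bar> \<le> (\<Sum>j<J. \<bar>s ^ t (Suc j) - s ^ n j\<bar>)"
    by (rule order_trans[OF sum_abs]) (use \<epsilon> in \<open>auto simp: abs_mult intro!: sum_mono\<close>, metis abs_1 abs_minus_cancel mult_1 order_refl)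
  also have "\<dots> \<le> max 1 (s ^ t J)"
  proof (cases "s \<le> 1")
    case True
    have "(\<Sum>j<J. \<bar>s ^ t (Suc j) - s ^ n j\<bar>) \<le> (\<Sum>j<J. s ^ t j - s ^ t (Suc j))"
    proof (intro sum_mono)
      fix j
      show "\<bar>s ^ t (Suc j) - s ^ n j\<bar> \<le> s ^ t j - s ^ t (Suc j)"
        using power_decreasing[OF nm(1)[of j] s True] power_decreasing[OF nm(2)[of j] s True] by linarith
    qed
    also have "\<dots> = s ^ t 0 - s ^ t J" by (rule sum_lessThan_telescope')
    also have "\<dots> \<le> 1" using s True by (simp add: power_le_one add_increasing2 diff_le_eq)
    finally show ?thesis by simp
  next
    case False
    have "(\<Sum>j<J. \<bar>s ^ t (Suc j) - s ^ n j\<bar>) \<le> (\<Sum>j<J. s ^ t (Suc j) - s ^ t j)"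
    proof (intro sum_mono)
      fix j
      have "s \<ge> 1" using False by simp
      then show "\<bar>s ^ t (Suc j) - s ^ n j\<bar> \<le> s ^ t (Suc j) - s ^ t j"
        using power_increasing[OF nm(1)[of j], of s] power_increasing[OF nm(2)[of j], of s] by linarith
    qed
    also have "\<dots> = s ^ t J - s ^ t 0" by (rule sum_lessThan_telescope)
    also have "\<dots> \<le> s ^ t J" using s by simp
    finally show ?thesis by simp
  qed
  finally show ?thesis .
qed

text \<open>If the odd powers of \<open>a\<close> were not Cauchy, blocks \<open>h j\<close> of differences of powers would be a
  weakly null sequence with \<open>\<parallel>a + h j\<parallel> = 1\<close> that does not tend to \<open>0\<close> in norm.\<close>

lemma Cauchy_odd_power:
  assumes B: "subtriple B" "kadec_klee B" and a: "a \<in> B" "norm a = 1"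
  shows "Cauchy (odd_power a)"
proof (rule ccontr)
  assume "\<not> Cauchy (odd_power a)"
  then obtain e where e: "e > 0" "\<And>N. \<exists>m n. m \<ge> N \<and> n > m \<and> \<not> norm (odd_power a n - odd_power a m) < e"
    unfolding Cauchy_altdef dist_norm by (metis norm_minus_commute)
  then obtain nn mm where nm: "\<And>N. nn N \<ge> N" "\<And>N. mm N > nn N"
    "\<And>N. norm (odd_power a (mm N) - odd_power a (nn N)) \<ge> e"
    unfolding not_less by metis
  \<comment> \<open>Starting at 1 keeps the exponents i = n j positive; otherwise 1 - s^i + s^(i +
    k) would vanish at s = 0, where positivity is required below.\<close>
  define t where "t = rec_nat 1 (\<lambda>_. mm)"
  have t: "t 0 = 1" "t (Suc j) = mm (t j)" for j by (simp_all add: t_def)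
  define n where "n j = nn (t j)" for j
  have n: "t j \<le> n j" "n j < t (Suc j)" for j using nm by (simp_all add: n_def t)
  have t1: "t j \<ge> 1" for j
  proof (induction j)
    case (Suc j)
    then show ?case using n[of j] by linarith
  qed (simp add: t)
  define h where "h j = odd_power a (t (Suc j)) - odd_power a (n j)" for j
  have hB: "h j \<in> B" for j
    unfolding h_def by (intro subtripleD(6)[OF B(1)] odd_power_in_subtriple[OF B(1) a(1)])
  have far: "norm (h j) \<ge> e" for j using nm(3) by (simp add: h_def n_def t)
  have "h \<longlonglongrightarrow> 0"
  proof (rule kadec_klee_perturbation[OF B(2) subtripleD(1)[OF B(1)] a hB])
    fix j
    define i k where "i = n j" and "k = t (Suc j) - n j"
    have ik: "t (Suc j) = i + k" "i \<ge> 1" using n[of j] t1[of j] by (auto simp: i_def k_def)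
    define p where "p = 1 - [:0, 1:] ^ i + ([:0, 1:] ^ (i + k) :: real poly)"
    have p: "odd_poly a p = a + h j"
      unfolding p_def odd_poly_add odd_poly_diff odd_poly_1 odd_poly_X h_def ik by (simp add: i_def)
    have poly_p: "poly p s = 1 - s ^ i + s ^ (i + k)" for s by (simp add: p_def)
    \<comment> \<open>The factors s^i - 1 and s^k - 1 have the same sign. So a + h j lies between
      the k-th odd power, of norm one, and a function of norm at most one.\<close>
    have key: "s ^ k \<le> poly p s" "poly p s \<le> max 1 (s ^ (i + k))" if s: "s \<ge> 0" for s
    proof -
      have "0 \<le> (s ^ i - 1) * (s ^ k - 1)"
        using s by (cases "s \<le> 1") (auto simp: zero_le_mult_iff power_le_one one_le_power)
      then show "s ^ k \<le> poly p s" by (simp add: poly_p power_add algebra_simps)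
      show "poly p s \<le> max 1 (s ^ (i + k))"
        using s power_decreasing[of i "i + k" s] one_le_power[of s i] by (cases "s \<le> 1") (auto simp: poly_p)
    qed
    have "norm (odd_poly a p) \<le> 1"
    proof (rule norm_odd_poly_le_1)
      fix s :: real assume s: "s \<ge> 0"
      show "\<bar>poly p s\<bar> \<le> max 1 (s ^ (i + k))"
        using key[OF s] zero_le_power[OF s, of k] by linarith
    qed (simp add: a)
    moreover have "norm (odd_poly a ([:0, 1:] ^ k * 1)) \<le> norm (odd_poly a (p * 1))"
    proof (rule norm_odd_poly_mono)
      fix s :: real assume s: "s \<ge> 0"
      show "\<bar>poly ([:0, 1:] ^ k) s\<bar> \<le> poly p s" using key(1)[OF s] s by simp
      show "0 < poly p s"
      proof (cases "s = 0")
        case True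
        then show ?thesis using ik by (simp add: poly_p power_0_left)
      next
        case False
        then show ?thesis using key(1)[OF s] s zero_less_power[of s k] by linarith
      qed
    qed
    ultimately show "norm (a + h j) = 1"
      using norm_odd_power[OF a(2), of k] by (simp add: p odd_poly_X)
  next
    fix f assume f: "f \<in> dual_on B"
    show "(\<lambda>j. f (h j)) \<longlonglongrightarrow> 0"
    proof (rule weakly_null_of_bounded_signed_sums[OF subtripleD(1)[OF B(1)] hB f, where C = 1])
      fix J and \<epsilon> :: "nat \<Rightarrow> real" assume \<epsilon>: "\<And>j. \<epsilon> j = 1 \<or> \<epsilon> j = -1"
      define p where "p = (\<Sum>j<J. smult (\<epsilon> j) ([:0, 1:] ^ t (Suc j) - [:0, 1:] ^ n j))"
      have "odd_poly a p = (\<Sum>j<J. \<epsilon> j *\<^sub>R h j)"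
        by (simp only: p_def odd_poly_sum odd_poly_smult odd_poly_diff odd_poly_X h_def)
      moreover have "norm (odd_poly a p) \<le> 1"
      proof (rule norm_odd_poly_le_1[where D = "t J"])
        fix s :: real assume "s \<ge> 0"
        then show "\<bar>poly p s\<bar> \<le> max 1 (s ^ t J)"
          using sum_signed_power_differences[of s \<epsilon> t n J] \<epsilon> n by (simp add: p_def poly_sum less_imp_le)
      qed (simp add: a)
      ultimately show "norm (\<Sum>j<J. \<epsilon> j *\<^sub>R h j) \<le> 1" by simp
    qed
  qed
  then have "(\<lambda>j. norm (h j)) \<longlonglongrightarrow> 0" by (rule tendsto_norm_zero)
  then have "e \<le> 0" by (rule LIMSEQ_le_const) (use far in auto)
  then show False using e by simp
qed

text \<open>Let e be the limit of the odd powers of b = a / norm a. Limits along the indices 3n + 1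
  and 2n + 1 give {e, e, e} = e and {e, e, b} = e, and e is nonzero since all powers have norm
  one.\<close>

lemma top_tripotent:
  assumes B: "subtriple B" "kadec_klee B" and a: "a \<in> B" "a \<noteq> 0"
  shows "\<exists>e\<in>B. tripotent e \<and> e \<noteq> 0 \<and> a - norm a *\<^sub>R e \<in> peirce e 0"
proof -
  define b where "b = (1 / norm a) *\<^sub>R a"
  have b: "b \<in> B" "norm b = 1" using a subtripleD[OF B(1)] by (auto simp: b_def)
  obtain e where e: "odd_power b \<longlonglongrightarrow> e"
    using Cauchy_odd_power[OF B b] Cauchy_convergent convergent_def by blast
  have "e \<in> B" using subtripleD(2)[OF B(1)] _ e
    by (rule closed_sequentially) (use odd_power_in_subtriple[OF B(1) b(1)] in blast)
  have sub: "(\<lambda>n. odd_power b (r n)) \<longlonglongrightarrow> e" if "strict_mono r" for r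
    using LIMSEQ_subseq_LIMSEQ[OF e that] by (simp add: o_def)
  have "(\<lambda>n. triple (odd_power b n) (odd_power b n) (odd_power b n)) \<longlonglongrightarrow> triple e e e"
    by (intro tendsto_triple e)
  moreover have "(\<lambda>n. odd_power b (n + n + n + 1)) \<longlonglongrightarrow> e" by (rule sub) (simp add: strict_mono_def)
  ultimately have "triple e e e = e" unfolding triple_odd_power by (rule LIMSEQ_unique)
  moreover have "(\<lambda>n. triple (odd_power b n) (odd_power b n) (odd_power b 0)) \<longlonglongrightarrow> triple e e b"
    by (simp, intro tendsto_triple e tendsto_const)
  moreover have "(\<lambda>n. odd_power b (n + n + 0 + 1)) \<longlonglongrightarrow> e" by (rule sub) (simp add: strict_mono_def)
  ultimately have "triple e e b = e" unfolding triple_odd_power using LIMSEQ_unique by blast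
  have "(\<lambda>n. norm (odd_power b n)) \<longlonglongrightarrow> norm e" by (rule tendsto_norm[OF e])
  then have "norm e = 1" using norm_odd_power[OF b(2)] by (simp add: LIMSEQ_const_iff)
  have "a = norm a *\<^sub>R b" using a by (simp add: b_def)
  then have "triple e e a = norm a *\<^sub>R e" using \<open>triple e e b = e\<close> by (metis triple_scaleR_right)
  then have "a - norm a *\<^sub>R e \<in> peirce e 0"
    using \<open>triple e e e = e\<close> by (simp add: peirce_def triple_simps)
  then show ?thesis using \<open>e \<in> B\<close> \<open>triple e e e = e\<close> \<open>norm e = 1\<close> by (auto simp: tripotent_def)
qed

section \<open>Orthogonal tripotents, finite decompositions and minimality\<close>

lemma tripotent_zero: "tripotent 0"
  by (simp add: tripotent_def)

lemma tripotent_scaleR_sign: "\<epsilon> = 1 \<or> \<epsilon> = -1 \<Longrightarrow> tripotent u \<Longrightarrow> tripotent (\<epsilon> *\<^sub>R u)"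
  by (auto simp: tripotent_minus)

text \<open>Signed sums of orthogonal tripotents are tripotents, hence bounded, so the sequence is
  weakly null; and u 0 + u n stays on the sphere. Norm convergence to 0 contradicts norm
  one.\<close>

lemma no_infinite_orthogonal_sequence:
  assumes B: "subtriple B" "kadec_klee B"
    and u: "\<And>i. u i \<in> B" "\<And>i. tripotent (u i)" "\<And>i j. i < j \<Longrightarrow> orth (u i) (u j)"
  shows "\<exists>i::nat. u i = 0"
proof (rule ccontr)
  assume "\<not> ?thesis"
  then have n0: "u i \<noteq> 0" for i by blast
  have n1: "norm (u i) = 1" for i using norm_tripotent[OF u(2) n0] .
  have "(\<lambda>n. u (Suc n)) \<longlonglongrightarrow> 0"
  proof (rule kadec_klee_perturbation[OF B(2) subtripleD(1)[OF B(1)] u(1)[of 0] n1 u(1)])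
    fix n
    show "norm (u 0 + u (Suc n)) = 1"
      using u(2,3) n0 n1 by (intro norm_add_orth) (auto simp flip: orth_iff_peirce0)
  next
    fix f assume f: "f \<in> dual_on B"
    show "(\<lambda>n. f (u (Suc n))) \<longlonglongrightarrow> 0"
    proof (rule weakly_null_of_bounded_signed_sums[OF subtripleD(1)[OF B(1)] u(1) f, where C = 1])
      fix J and \<epsilon> :: "nat \<Rightarrow> real" assume \<epsilon>: "\<And>j. \<epsilon> j = 1 \<or> \<epsilon> j = -1"
      have "tripotent (\<Sum>j<J. \<epsilon> j *\<^sub>R u (Suc j))" for J
      proof (induction J)
        case (Suc J)
        have "orth (u (Suc J)) (\<Sum>j<J. \<epsilon> j *\<^sub>R u (Suc j))"
          using u(3) by (intro orth_sum orth_scaleR) (auto intro: orth_sym)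
        then have "orth (\<Sum>j<J. \<epsilon> j *\<^sub>R u (Suc j)) (\<epsilon> J *\<^sub>R u (Suc J))"
          by (intro orth_scaleR orth_sym[of "u (Suc J)"])
        then show ?case using Suc u(2) \<epsilon> by (auto intro!: tripotent_add_orth tripotent_scaleR_sign)
      qed (simp add: tripotent_zero)
      then show "norm (\<Sum>j<J. \<epsilon> j *\<^sub>R u (Suc j)) \<le> 1" by (rule norm_tripotent_le)
    qed
  qed
  then have "(\<lambda>n. norm (u (Suc n))) \<longlonglongrightarrow> 0" by (rule tendsto_norm_zero)
  then show False using n1 by (simp add: LIMSEQ_const_iff)
qed

text \<open>Peeling off top tripotents terminates, since these are mutually orthogonal.\<close>

lemma spectral_decomposition:
  assumes B: "subtriple B" "kadec_klee B" and z: "z \<in> B"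
  obtains n :: nat and u \<mu> where
    "\<And>i. i < n \<Longrightarrow> u i \<in> B \<and> tripotent (u i) \<and> u i \<noteq> 0 \<and> 0 \<le> \<mu> i \<and> \<mu> i \<le> norm z"
    "\<And>i j. i < n \<Longrightarrow> j < n \<Longrightarrow> i \<noteq> j \<Longrightarrow> orth (u i) (u j)"
    "z = (\<Sum>i<n. \<mu> i *\<^sub>R u i)" "z \<noteq> 0 \<Longrightarrow> n > 0 \<and> \<mu> 0 = norm z"
proof -
  define top where "top C a = (if a = 0 then 0 else
    SOME e. e \<in> C \<and> tripotent e \<and> e \<noteq> 0 \<and> a - norm a *\<^sub>R e \<in> peirce e 0)" for C and a :: 'e
  \<comment> \<open>The state consists of the part of B orthogonal to the tripotents found so far
    and of the remainder of z. At remainder 0 the chosen tripotent is 0, so the recursion is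
    total.\<close>
  define S where "S = rec_nat (B, z) (\<lambda>_ (C, a). (C \<inter> peirce (top C a) 0, a - norm a *\<^sub>R top C a))"
  define C a e where "C n = fst (S n)" and "a n = snd (S n)" and "e n = top (fst (S n)) (snd (S n))" for n
  have rec: "C 0 = B" "a 0 = z" "C (Suc n) = C n \<inter> peirce (e n) 0" "a (Suc n) = a n - norm (a n) *\<^sub>R e n" for n
    by (simp_all add: C_def a_def e_def S_def split: prod.split)
  have top: "e n \<in> C n \<and> tripotent (e n) \<and> (e n = 0 \<longleftrightarrow> a n = 0) \<and> a n - norm (a n) *\<^sub>R e n \<in> peirce (e n) 0"
    if "subtriple (C n)" "kadec_klee (C n)" "a n \<in> C n" for n
  proof (cases "a n = 0")
    case True
    then show ?thesis using subtripleD(4)[OF that(1)]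
      by (auto simp: e_def top_def tripotent_zero peirce_zero simp flip: a_def)
  next
    case False
    then show ?thesis
      using someI_ex[OF bexE[OF top_tripotent[OF that False]], of "\<lambda>e. e \<in> C n \<and> tripotent e \<and> e \<noteq> 0 \<and> a n - norm (a n) *\<^sub>R e \<in> peirce e 0"]
      unfolding e_def top_def a_def[symmetric] C_def[symmetric] by auto
  qed
  have inv: "subtriple (C n) \<and> kadec_klee (C n) \<and> a n \<in> C n" for n
  proof (induction n)
    case (Suc n)
    then show ?case
      using top[of n] unfolding rec
      by (auto intro: subtriple_Int_peirce kadec_klee_subset subtripleD(6,7))
  qed (simp add: rec B z)
  have e: "e n \<in> C n" "tripotent (e n)" "e n = 0 \<longleftrightarrow> a n = 0" "a (Suc n) \<in> peirce (e n) 0" for n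
    using top[of n] inv[of n] rec by auto
  have C_mono: "C (n + k) \<subseteq> C n" for n k by (induction k) (auto simp: rec)
  have "e n \<in> B" for n using e(1)[of n] C_mono[of 0 n] by (auto simp: rec)
  have orth: "orth (e i) (e j)" if "i < j" for i j
  proof -
    have "e j \<in> C (Suc i)" using e(1)[of j] C_mono[of "Suc i" "j - Suc i"] that by auto
    then show ?thesis using orth_peirce0[OF e(2)] by (auto simp: rec)
  qed
  have norm_step: "norm (a (Suc n)) \<le> norm (a n)" for n
  proof -
    have "norm (a (Suc n)) \<le> norm (a (Suc n) + 0 + norm (a n) *\<^sub>R e n)"
      using e(4) by (intro norm_peirce_bounds(1)[of _ "e n"])
        (auto simp: peirce_zero peirce_scaleR tripotent_in_peirce[OF e(2)])
    then show ?thesis by (simp add: rec)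
  qed
  have norm_a: "norm (a n) \<le> norm z" for n
    by (induction n) (auto simp: rec(2) intro: order_trans[OF norm_step])
  have "\<exists>i. e i = 0" by (rule no_infinite_orthogonal_sequence[OF B \<open>\<And>n. e n \<in> B\<close> e(2) orth])
  then have ex: "\<exists>n. a n = 0" using e(3) by blast
  define n where "n = (LEAST n. a n = 0)"
  have "a n = 0" unfolding n_def by (rule LeastI_ex[OF ex])
  have nz: "a i \<noteq> 0" if "i < n" for i using not_less_Least that unfolding n_def by blast
  have "z = (\<Sum>i<k. norm (a i) *\<^sub>R e i) + a k" for k
    by (induction k) (simp_all add: rec)
  then have dec: "z = (\<Sum>i<n. norm (a i) *\<^sub>R e i)" using \<open>a n = 0\<close> by (metis add.right_neutral)
  show thesis
  proof (rule that[of n e "\<lambda>i. norm (a i)"])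
    show "e i \<in> B \<and> tripotent (e i) \<and> e i \<noteq> 0 \<and> 0 \<le> norm (a i) \<and> norm (a i) \<le> norm z" if "i < n" for i
      using \<open>e i \<in> B\<close> e nz[OF that] norm_a by auto
    show "orth (e i) (e j)" if "i \<noteq> j" for i j
      using orth that orth_sym by (cases "i < j") auto
    show "z = (\<Sum>i<n. norm (a i) *\<^sub>R e i)" by (rule dec)
    show "0 < n \<and> norm (a 0) = norm z" if "z \<noteq> 0"
      using that \<open>a n = 0\<close> rec(2) by (cases "n = 0") auto
  qed
qed

text \<open>Indecomposability inside B is what a splitting argument delivers;
  \<open>symmetric_part_minimal\<close> turns it into one-dimensionality.\<close>

definition minimal_tripotent :: "'e set \<Rightarrow> 'e \<Rightarrow> bool" where
  "minimal_tripotent B e \<longleftrightarrow> e \<in> B \<and> tripotent e \<and> e \<noteq> 0 \<and>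
     (\<forall>f\<in>B. \<forall>g\<in>B. tripotent f \<longrightarrow> tripotent g \<longrightarrow> orth f g \<longrightarrow> e = f + g \<longrightarrow> f = 0 \<or> g = 0)"

text \<open>Otherwise e splits forever: F is a half that again dominates no minimal tripotent, G the
  half cut off. Later pieces lie in the Peirce 1-space of an earlier F, to which the earlier G is
  orthogonal, so the pieces form a forbidden orthogonal sequence.\<close>

lemma exists_minimal_tripotent:
  assumes B: "subtriple B" "kadec_klee B" and e: "e \<in> B" "tripotent e" "e \<noteq> 0"
  shows "\<exists>f\<in>B. \<exists>g\<in>B. minimal_tripotent B f \<and> tripotent g \<and> orth f g \<and> e = f + g"
proof (rule ccontr)
  assume neg: "\<not> ?thesis"
  define bad where "bad e \<longleftrightarrow> e \<in> B \<and> tripotent e \<and> e \<noteq> 0 \<and>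
    \<not> (\<exists>f\<in>B. \<exists>g\<in>B. minimal_tripotent B f \<and> tripotent g \<and> orth f g \<and> e = f + g)" for e
  have below: "x \<in> peirce (f + g) 1" if fg: "orth f g" "tripotent f" "x \<in> peirce f 1" for x f g
  proof -
    have "g \<in> peirce f 0" using fg orth_iff_peirce0 by blast
    then have "orth x g" using orth_peirce1_peirce0[OF fg(2,3)] by blast
    then show ?thesis
      using fg by (simp add: peirce_def triple_add_orth(1) triple_commute[of g g x] orthD)
  qed
  have split: "\<exists>f g. bad f \<and> g \<in> B \<and> tripotent g \<and> g \<noteq> 0 \<and> orth f g \<and> e = f + g" if "bad e" for e
  proof -
    have eB: "e \<in> B" "tripotent e" "e \<noteq> 0" using that by (auto simp: bad_def)
    have "\<not> minimal_tripotent B e"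
    proof
      assume "minimal_tripotent B e"
      moreover have "orth e 0" by (simp add: orth_def)
      ultimately show False
        using that subtripleD(4)[OF B(1)] tripotent_zero unfolding bad_def by (metis add.right_neutral)
    qed
    then obtain f g where fg: "f \<in> B" "g \<in> B" "tripotent f" "tripotent g" "orth f g" "e = f + g" "f \<noteq> 0" "g \<noteq> 0"
      using eB unfolding minimal_tripotent_def by blast
    have "bad f"
    proof (rule ccontr)
      assume "\<not> bad f"
      then obtain f1 f2 where f: "f1 \<in> B" "f2 \<in> B" "minimal_tripotent B f1" "tripotent f2" "orth f1 f2" "f = f1 + f2"
        using fg unfolding bad_def by blast
      have tf1: "tripotent f1" using f(3) by (simp add: minimal_tripotent_def)
      have "f1 \<in> peirce f 1" "f2 \<in> peirce f 1"
        unfolding f(6) using below[OF f(5) tf1 tripotent_in_peirce[OF tf1]]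
          below[OF orth_sym[OF f(5)] f(4) tripotent_in_peirce[OF f(4)]] by (auto simp: add.commute)
      moreover have "g \<in> peirce f 0" using fg orth_iff_peirce0 by blast
      ultimately have "orth f1 g" "orth f2 g" using orth_peirce1_peirce0[OF fg(3)] by auto
      then have "orth f1 (f2 + g)" "tripotent (f2 + g)" "e = f1 + (f2 + g)" "f2 + g \<in> B"
        using f fg by (auto simp: orth_add tripotent_add_orth add.assoc subtripleD(5)[OF B(1)])
      then show False using that f unfolding bad_def by blast
    qed
    then show ?thesis using fg by blast
  qed
  obtain F G where FG: "\<And>e. bad e \<Longrightarrow> bad (F e) \<and> G e \<in> B \<and> tripotent (G e) \<and> G e \<noteq> 0 \<and> orth (F e) (G e) \<and> e = F e + G e"
    using split by metis
  define s where "s n = (F ^^ n) e" for n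
  have bad: "bad (s n)" for n
  proof (induction n)
    case 0
    show ?case using e neg by (simp add: s_def bad_def)
  qed (use FG in \<open>simp add: s_def\<close>)
  note s = FG[OF bad]
  have s_Suc: "s (Suc n) = F (s n)" for n by (simp add: s_def)
  have ts: "tripotent (s n)" for n using bad by (simp add: bad_def)
  have mono: "peirce (s (Suc n)) 1 \<subseteq> peirce (s n) 1" for n
  proof
    fix x assume "x \<in> peirce (s (Suc n)) 1"
    then have "x \<in> peirce (F (s n) + G (s n)) 1"
      using s[of n] ts[of "Suc n"] by (intro below) (auto simp: s_Suc)
    then show "x \<in> peirce (s n) 1" using s[of n] by metis
  qed
  have mono': "peirce (s (n + k)) 1 \<subseteq> peirce (s n) 1" for n k
  proof (induction k)
    case (Suc k)
    then show ?case using mono[of "n + k"] by auto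
  qed simp
  have "orth (G (s i)) (G (s j))" if "i < j" for i j
  proof -
    have "G (s j) \<in> peirce (G (s j) + F (s j)) 1"
      using s[of j] by (intro below tripotent_in_peirce) (auto intro: orth_sym)
    then have "G (s j) \<in> peirce (s j) 1" using s[of j] by (metis add.commute)
    then have "G (s j) \<in> peirce (s (Suc i)) 1" using mono'[of "Suc i" "j - Suc i"] that by auto
    moreover have "G (s i) \<in> peirce (s (Suc i)) 0"
      using s[of i] ts[of "Suc i"] orth_iff_peirce0 by (simp add: s_Suc)
    ultimately show ?thesis using orth_peirce1_peirce0[OF ts] orth_sym by blast
  qed
  then have "\<exists>i. G (s i) = 0"
    using s by (intro no_infinite_orthogonal_sequence[OF B]) auto
  then show False using s by blast
qed

end

context jb_star_triple
begin

subsection \<open>The Peirce 1-space as a Jordan algebra\<close>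

lemma jordan_product_identity:
  "triple (triple e b e) y u + triple (triple e y e) b u = 2 *\<^sub>R triple e (triple b e y) u"
  using jordan_antisym[of e b e y u] triple_commute[of y e b] by (simp add: scaleR_2 algebra_simps)

text \<open>On the Peirce 1-space x o y = {x, e, y} is a Jordan product with involution Q.
  \<open>\<alpha>\<close> says L(e, b) = L(Qb, e), \<open>\<gamma>\<close> that Q is multiplicative,
  and \<open>\<beta>\<close> expresses Q{x, y, z} by terms in which {Qx, Qy, Qz} has to be
  recognised.\<close>

lemma Q_triple:
  assumes e: "tripotent e" and x: "x \<in> peirce e 1" and y: "y \<in> peirce e 1" and z: "z \<in> peirce e 1"
  shows "triple e (triple x y z) e = triple (triple e x e) (triple e y e) (triple e z e)"
proof -
  define Q where "Q x = triple e x e" for x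
  have ee: "triple e e e = e" using e by (simp add: tripotent_def)
  have QQ: "Q (Q x) = x" if "x \<in> peirce e 1" for x using Q_Q_peirce1[OF e that] by (simp add: Q_def)
  have Qp: "Q x \<in> peirce e 1" for x using Q_in_peirce1[OF e] by (simp add: Q_def)
  have \<alpha>: "triple e b u = triple (Q b) e u" if "b \<in> peirce e 1" for b u
  proof -
    have "triple b e e = b" using that by (simp add: peirce_def triple_commute[of b e e])
    then show ?thesis using jordan_product_identity[of e b e u] by (simp add: ee Q_def scaleR_2)
  qed
  have \<beta>: "Q (triple x y z) = 2 *\<^sub>R triple (Q z) e (triple (Q x) e y) - triple y x (Q z)"
    if "x \<in> peirce e 1" "z \<in> peirce e 1" for x y z
  proof -
    have "triple y x e = triple (Q x) e y" using \<alpha>[OF that(1)] triple_commute by metis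
    moreover have "triple (triple y x e) z e = triple e z (triple y x e)" by (rule triple_commute)
    ultimately show ?thesis
      using jordan_identity[of y x e z e] \<alpha>[OF that(2), of "triple y x e"]
      by (simp add: Q_def scaleR_2 algebra_simps)
  qed
  have \<gamma>: "Q (triple x e z) = triple (Q x) e (Q z)" if "x \<in> peirce e 1" "z \<in> peirce e 1" for x z
  proof -
    have "triple (Q x) e e = Q x" using Qp[of x] by (simp add: peirce_def triple_commute[of _ e e])
    then show ?thesis
      using \<beta>[OF that, of e] \<alpha>[OF that(1)] triple_commute[of "Q z" e "Q x"] by (simp add: scaleR_2)
  qed
  \<comment> \<open>Here w = x o Qy and Qw = Qx o y; \<open>jordan_product_identity\<close> for x
    and Qy then produces exactly the terms of \<open>\<beta>\<close>.\<close>
  define w where "w = triple x e (Q y)"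
  have w: "w \<in> peirce e 1"
    unfolding w_def using peirce_triple[OF x tripotent_in_peirce[OF e] Qp] by simp
  have "triple (Q x) (Q y) (Q z) + triple (Q (Q y)) x (Q z) = 2 *\<^sub>R triple e w (Q z)"
    using jordan_product_identity[of e x "Q y" "Q z"] by (simp add: Q_def w_def)
  also have "triple e w (Q z) = triple (triple (Q x) e y) e (Q z)"
    using \<alpha>[OF w] \<gamma>[OF x Qp[of y]] QQ[OF y] by (simp add: w_def)
  also have "\<dots> = triple (Q z) e (triple (Q x) e y)" by (rule triple_commute)
  finally have "2 *\<^sub>R triple (Q z) e (triple (Q x) e y) - triple y x (Q z) = triple (Q x) (Q y) (Q z)"
    using QQ[OF y] by (simp add: diff_eq_eq)
  then have "Q (triple x y z) = triple (Q x) (Q y) (Q z)" using \<beta>[OF x z, of y] by simp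
  then show ?thesis by (simp add: Q_def)
qed

lemma subtriple_symmetric_part:
  assumes B: "subtriple B" and e: "tripotent e"
  shows "subtriple (B \<inter> peirce e 1 \<inter> {x. triple e x e = x})"
  unfolding subtriple_def
proof (intro conjI ballI)
  note S = subtriple_Int_peirce[OF B, of 1 e, simplified]
  show "Real_Vector_Spaces.subspace (B \<inter> peirce e 1 \<inter> {x. triple e x e = x})"
    using subtripleD[OF S] by (auto simp: Real_Vector_Spaces.subspace_def triple_simps)
  have "closed {x. triple e x e = x}"
    by (intro closed_Collect_eq continuous_intros linear_continuous_on bounded_linear_triple_middle)
  then show "closed (B \<inter> peirce e 1 \<inter> {x. triple e x e = x})" using subtripleD(2)[OF S] by blast
  fix x y z assume xyz: "x \<in> B \<inter> peirce e 1 \<inter> {x. triple e x e = x}"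
    "y \<in> B \<inter> peirce e 1 \<inter> {x. triple e x e = x}" "z \<in> B \<inter> peirce e 1 \<inter> {x. triple e x e = x}"
  then show "triple x y z \<in> B \<inter> peirce e 1 \<inter> {x. triple e x e = x}"
    using subtripleD(3)[OF S, of x y z] Q_triple[OF e, of x y z] by auto
qed


subsection \<open>Minimal tripotents\<close>

lemma minimal_tripotentD:
  assumes "minimal_tripotent B e"
  shows "e \<in> B" "tripotent e" "e \<noteq> 0" "triple e e e = e" "norm e = 1"
    "\<And>f g. f \<in> B \<Longrightarrow> g \<in> B \<Longrightarrow> tripotent f \<Longrightarrow> tripotent g \<Longrightarrow> orth f g \<Longrightarrow> e = f + g \<Longrightarrow> f = 0 \<or> g = 0"
  using assms norm_tripotent[of e] unfolding minimal_tripotent_def tripotent_def by blast+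

text \<open>With respect to u, e has only the Peirce components q = {u, u, e} and e - q. They are
  orthogonal tripotents, so minimality leaves q = 0, which kills u, or q = e, where u is a symmetry
  of e.\<close>

lemma symmetric_tripotent_minimal:
  assumes B: "subtriple B" and m: "minimal_tripotent B e"
    and u: "u \<in> B" "tripotent u" "u \<in> peirce e 1" "triple e u e = u"
  shows "u = 0 \<or> u = e \<or> u = - e"
proof (cases "u = 0")
  case False
  note e = minimal_tripotentD[OF m]
  note BD = subtripleD[OF B]
  have uu: "triple u u u = u" using u by (simp add: tripotent_def)
  have eu: "triple e e u = u" "triple u e e = u"
    using u by (simp_all add: peirce_def triple_commute[of u e e])
  define q where "q = triple u e u"
  have "triple e q e = q"
    using Q_triple[OF e(2) u(3) tripotent_in_peirce[OF e(2)] u(3)] u e by (simp add: q_def)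
  moreover have "2 *\<^sub>R triple u u e = 2 *\<^sub>R triple e q e"
    using jordan_product_identity[of e u u e] u(4) by (simp add: q_def scaleR_2)
  ultimately have uue: "triple u u e = q" by simp
  have q1: "q \<in> peirce u 1" unfolding q_def by (rule Q_in_peirce1[OF u(2)])
  then have uuq: "triple u u q = q" by (simp add: peirce_def)
  have pr: "pr0 u e = e - q" "pr2 u e = q"
    by (simp_all add: pr0_def[OF u(2)] pr2_def[OF u(2)] uue uuq scaleR_2 scaleR_3)
  have q0: "e - q \<in> peirce u 0" using pr_in_peirce(1)[OF u(2), of e] pr by simp
  have o: "orth q (e - q)" by (rule orth_peirce1_peirce0[OF u(2) q1 q0])
  have sum: "e = triple q q q + triple (e - q) (e - q) (e - q)"
    using triple_add_orth(2)[OF o] e(4) by simp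
  \<comment> \<open>By orthogonality e is the sum of the cubes of its two components; comparing
    Peirce 1-components shows that q is its own cube.\<close>
  have "pr2 u e = triple q q q"
    using pr_linear(3)[OF u(2)] pr_peirce(7,9)[OF u(2)]
      peirce_triple[OF q1 q1 q1] peirce_triple[OF q0 q0 q0]
    by (subst sum) simp
  then have tq: "tripotent q" using pr by (simp add: tripotent_def)
  then have tq': "tripotent (e - q)" using sum by (simp add: tripotent_def algebra_simps)
  have qB: "q \<in> B" unfolding q_def using BD u e by blast
  then have "q = 0 \<or> e - q = 0" using e(1) tq tq' o BD by (intro e(6)) auto
  then show ?thesis
  proof
    assume "q = 0"
    then have "e \<in> peirce u 0" using q0 by simp
    then have "triple e e u = 0" using orth_peirce0[OF u(2)] orthD by blast
    then show ?thesis using eu by simp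
  next
    assume "e - q = 0"
    then have ue: "triple u u e = e" "triple u e u = e" "triple e u u = e"
      using uue triple_commute[of e u u] by (auto simp: q_def)
    \<comment> \<open>The two spectral projections of the symmetry u; minimality makes one of them
      zero.\<close>
    define f where "f = (1/2) *\<^sub>R (e + u)"
    define g where "g = (1/2) *\<^sub>R (e - u)"
    have half: "(1/2) *\<^sub>R (1/2) *\<^sub>R (1/2) *\<^sub>R (x + x + x + x) = (1/2) *\<^sub>R x" for x :: 'e
      by (simp flip: scaleR_4)
    have "triple (e + u) (e + u) (e + u) = (e + u) + (e + u) + (e + u) + (e + u)"
      by (simp add: triple_simps e u(4) uu ue eu)
    then have "tripotent f" unfolding tripotent_def f_def by (simp only: triple_simps(10-12) half)
    have "triple (e - u) (e - u) (e - u) = (e - u) + (e - u) + (e - u) + (e - u)"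
      by (simp add: triple_simps e u(4) uu ue eu)
    then have "tripotent g" unfolding tripotent_def g_def by (simp only: triple_simps(10-12) half)
    have "triple (e + u) (e + u) (e - u) = 0"
      by (simp add: triple_simps e u(4) uu ue eu)
    then have "g \<in> peirce f 0" unfolding peirce_def f_def g_def by (simp add: triple_scaleR_left triple_scaleR_middle triple_scaleR_right)
    then have "orth f g" by (rule orth_peirce0[OF \<open>tripotent f\<close>])
    moreover have "e = f + g" by (simp add: f_def g_def algebra_simps flip: scaleR_left_distrib)
    moreover have "f \<in> B" "g \<in> B" unfolding f_def g_def by (intro BD(5-7) e(1) u(1))+
    ultimately have "f = 0 \<or> g = 0" using e(6) \<open>tripotent f\<close> \<open>tripotent g\<close> by blast
    then show ?thesis by (auto simp: f_def g_def eq_neg_iff_add_eq_0 add.commute)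
  qed
qed simp

text \<open>The symmetric part is itself a subtriple with the Kadec-Klee property, so a is a finite
  combination of tripotents inside it, each of them 0, e or - e.\<close>

lemma symmetric_part_minimal:
  assumes B: "subtriple B" "kadec_klee B" and m: "minimal_tripotent B e"
    and a: "a \<in> B" "a \<in> peirce e 1" "triple e a e = a"
  shows "\<exists>r. a = r *\<^sub>R e"
proof -
  note e = minimal_tripotentD[OF m]
  let ?S = "B \<inter> peirce e 1 \<inter> {x. triple e x e = x}"
  have S: "subtriple ?S" "kadec_klee ?S"
    using subtriple_symmetric_part[OF B(1) e(2)] kadec_klee_subset[OF B(2), of ?S] by auto
  have "a \<in> ?S" using a by simp
  then obtain n :: nat and u \<mu> where u: "\<And>i. i < n \<Longrightarrow> u i \<in> ?S \<and> tripotent (u i)" "a = (\<Sum>i<n. \<mu> i *\<^sub>R u i)"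
    by (rule spectral_decomposition[OF S]) blast
  have "\<exists>r. u i = r *\<^sub>R e" if "i < n" for i
  proof -
    have "u i = 0 *\<^sub>R e \<or> u i = 1 *\<^sub>R e \<or> u i = (-1) *\<^sub>R e"
      using symmetric_tripotent_minimal[OF B(1) m, of "u i"] u(1)[OF that] by simp
    then show ?thesis by blast
  qed
  then obtain r where r: "\<And>i. i < n \<Longrightarrow> u i = r i *\<^sub>R e" by metis
  have "a = (\<Sum>i<n. \<mu> i * r i) *\<^sub>R e"
    unfolding u(2) scaleR_sum_left using r by (intro sum.cong) auto
  then show ?thesis by blast
qed

lemma triple_eigenvalue_nonneg:
  assumes "triple v v w = c *\<^sub>R w" "w \<noteq> 0"
  shows "c \<ge> 0"
proof -
  have "complex_of_real c \<in> op_spectrum scaleC (triple v v)"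
  proof (rule ccontr)
    assume "\<not> ?thesis"
    then obtain S where S: "bounded_clinear scaleC S"
      "S \<circ> (\<lambda>x. complex_of_real c *\<^sub>C x - triple v v x) = id" unfolding op_spectrum_def by blast
    have "S (complex_of_real c *\<^sub>C w - triple v v w) = w" using S(2) by (metis comp_apply id_apply)
    then show False using assms bounded_clinearD(4)[OF S(1)] by (simp add: scaleC_of_real)
  qed
  then show ?thesis using spectrum_nonneg by fastforce
qed

text \<open>Applying L(v, v) to e = {e, e, e} gives w = 2w - {e, w, e} for w = {v, v, e}.\<close>

lemma triple_self_symmetric:
  assumes e: "tripotent e" and w: "triple v v e \<in> peirce e 1"
  shows "triple e (triple v v e) e = triple v v e"
proof -
  have "triple (triple v v e) e e = triple v v e" "triple e e (triple v v e) = triple v v e"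
    using w triple_commute[of "triple v v e" e e] by (simp_all add: peirce_def)
  then show ?thesis using jordan_identity[of v v e e e] e by (simp add: tripotent_def)
qed

text \<open>With {s, s, e} = c e, the cube of z = \<alpha> e + s is (\<alpha>^2 + c) z, so the cube
  axiom gives the squared norm; \<alpha> = 0 identifies c. The norm on this part is thus
  Hilbertian.\<close>

lemma skew_minimal:
  assumes B: "subtriple B" "kadec_klee B" and m: "minimal_tripotent B e"
    and s: "s \<in> B" "s \<in> peirce e 1" "triple e s e = - s"
  shows "triple s s e = (norm s)\<^sup>2 *\<^sub>R e" "(norm (\<alpha> *\<^sub>R e + s))\<^sup>2 = \<alpha>\<^sup>2 + (norm s)\<^sup>2"
proof -
  note e = minimal_tripotentD[OF m]
  have ep: "e \<in> peirce e 1" by (rule tripotent_in_peirce[OF e(2)])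
  have "triple s s e \<in> peirce e 1" using peirce_triple[OF s(2) s(2) ep] by simp
  then obtain c where c: "triple s s e = c *\<^sub>R e"
    using symmetric_part_minimal[OF B m _ _ triple_self_symmetric[OF e(2)]] subtripleD(3)[OF B(1) s(1) s(1) e(1)] by blast
  have "triple e (triple s e s) e = triple s e s"
    using Q_triple[OF e(2) s(2) ep s(2)] s(3) e(4) by (simp add: triple_simps)
  moreover have ss: "triple s s w = - triple e (triple s e s) w" for w
  proof -
    have "2 *\<^sub>R triple e (triple s e s) w = 2 *\<^sub>R (- triple s s w)"
      using jordan_product_identity[of e s s w] s(3) by (simp add: triple_simps scaleR_2)
    then have "triple e (triple s e s) w = - triple s s w"
      by (metis scaleR_cancel_left zero_neq_numeral)
    then show ?thesis by simp
  qed
  ultimately have ses: "triple s e s = - c *\<^sub>R e"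
    using ss[of e] c by (metis minus_minus scaleR_minus_left)
  have es: "triple e e s = s" "triple s e e = s" "triple e s s = c *\<^sub>R e"
    using s(2) c by (simp_all add: peirce_def triple_commute[of s e e] triple_commute[of e s s])
  have sss: "triple s s s = c *\<^sub>R s" using ss[of s] by (simp add: ses triple_simps es)
  have "c \<ge> 0"
    using triple_eigenvalue_nonneg[OF sss] c e(3) by (cases "s = 0") auto
  have norm: "(norm (\<alpha> *\<^sub>R e + s))\<^sup>2 = \<alpha>\<^sup>2 + c" for \<alpha>
  proof -
    define z where "z = \<alpha> *\<^sub>R e + s"
    have "triple z z z = (\<alpha>\<^sup>2 + c) *\<^sub>R z"
      unfolding z_def
      by (simp add: triple_simps e s(3) c ses es sss) (simp add: algebra_simps power2_eq_square)
    then have "norm z ^ 3 = (\<alpha>\<^sup>2 + c) * norm z" using norm_cube[of z] \<open>c \<ge> 0\<close> by simp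
    then have "norm z * ((norm z)\<^sup>2 - (\<alpha>\<^sup>2 + c)) = 0" by (simp add: power3_eq_cube power2_eq_square algebra_simps)
    moreover have "\<alpha>\<^sup>2 + c = 0" if "z = 0"
    proof -
      have "triple e z e = \<alpha> *\<^sub>R e - s" by (simp add: z_def triple_simps e s(3))
      then have "s = \<alpha> *\<^sub>R e" using that by simp
      then have "2 *\<^sub>R (\<alpha> *\<^sub>R e) = 0" using that unfolding z_def by (simp only: scaleR_2)
      then have "\<alpha> = 0" using e(3) by simp
      then show ?thesis using \<open>s = \<alpha> *\<^sub>R e\<close> c e(3) by simp
    qed
    ultimately show ?thesis by (cases "z = 0") (auto simp: z_def)
  qed
  have "(norm s)\<^sup>2 = c" using norm[of 0] by simp
  then show "triple s s e = (norm s)\<^sup>2 *\<^sub>R e" "(norm (\<alpha> *\<^sub>R e + s))\<^sup>2 = \<alpha>\<^sup>2 + (norm s)\<^sup>2"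
    using c norm by simp_all
qed

lemma triple_orthogonal_sum:
  assumes o: "\<And>i j. i < n \<Longrightarrow> j < n \<Longrightarrow> i \<noteq> j \<Longrightarrow> orth (u i) (u j)"
  shows "triple (\<Sum>i<n. \<mu> i *\<^sub>R u i) (\<Sum>i<n. \<mu> i *\<^sub>R u i) x = (\<Sum>i<n::nat. (\<mu> i)\<^sup>2 *\<^sub>R triple (u i) (u i) x)"
proof -
  have "triple (\<Sum>i<n. \<mu> i *\<^sub>R u i) (\<Sum>i<n. \<mu> i *\<^sub>R u i) x
      = (\<Sum>i<n. \<Sum>j<n. (\<mu> j * \<mu> i) *\<^sub>R triple (u i) (u j) x)"
    by (simp only: triple_sum_left)
      (simp only: triple_sum_middle triple_scaleR_left triple_scaleR_middle scaleR_sum_right scaleR_scaleR)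
  also have "\<dots> = (\<Sum>i<n. \<Sum>j<n. if j = i then (\<mu> i)\<^sup>2 *\<^sub>R triple (u i) (u i) x else 0)"
    using o by (intro sum.cong refl) (auto simp: power2_eq_square orthD)
  finally show ?thesis by simp
qed

text \<open>For each tripotent u i in the decomposition of v, e is an eigenvector of L(u i, u i).
  Its eigenvalue is not 0, as e and u i are not orthogonal, so it is at least 1/2; the leading
  coefficient \<open>norm v\<close> does the rest.\<close>

lemma half_minimal:
  assumes B: "subtriple B" "kadec_klee B" and m: "minimal_tripotent B e"
    and v: "v \<in> B" "v \<in> peirce e (1/2)"
  shows "\<exists>c \<ge> (norm v)\<^sup>2 / 2. triple v v e = c *\<^sub>R e"
proof (cases "v = 0")
  case False
  note e = minimal_tripotentD[OF m]
  let ?S = "B \<inter> peirce e (1/2)"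
  have S: "subtriple ?S" "kadec_klee ?S"
    using subtriple_Int_peirce[OF B(1)] kadec_klee_subset[OF B(2), of ?S] by auto
  have "v \<in> ?S" using v by simp
  then obtain n :: nat and u \<mu> where u: "\<And>i. i < n \<Longrightarrow> u i \<in> ?S \<and> tripotent (u i) \<and> u i \<noteq> 0"
    "\<And>i j. i < n \<Longrightarrow> j < n \<Longrightarrow> i \<noteq> j \<Longrightarrow> orth (u i) (u j)"
    "v = (\<Sum>i<n. \<mu> i *\<^sub>R u i)" "n > 0" "\<mu> 0 = norm v"
    by (rule spectral_decomposition[OF S]) (use False in blast)
  have "\<exists>c \<ge> 1/2. triple (u i) (u i) e = c *\<^sub>R e" if i: "i < n" for i
  proof -
    have ui: "u i \<in> B" "u i \<in> peirce e (1/2)" "tripotent (u i)" "u i \<noteq> 0" using u(1)[OF i] by auto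
    have "triple (u i) (u i) e \<in> peirce e 1"
      using peirce_triple[OF ui(2) ui(2) tripotent_in_peirce[OF e(2)]] by simp
    then obtain c where c: "triple (u i) (u i) e = c *\<^sub>R e"
      using symmetric_part_minimal[OF B m _ _ triple_self_symmetric[OF e(2)]] subtripleD(3)[OF B(1) ui(1) ui(1) e(1)] by blast
    then have "e \<in> peirce (u i) c" by (simp add: peirce_def)
    then have "c = 0 \<or> c = 1/2 \<or> c = 1" using peirce_eigenvalue[OF ui(3)] e(3) by blast
    moreover have "c \<noteq> 0"
    proof
      assume "c = 0"
      then have "orth (u i) e" using orth_peirce0[OF ui(3)] \<open>e \<in> peirce (u i) c\<close> by simp
      then show False using orthD(4)[of "u i" e e] ui by (simp add: peirce_def)
    qed
    ultimately show ?thesis using c by (intro exI[of _ c]) auto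
  qed
  then obtain c where c: "\<And>i. i < n \<Longrightarrow> c i \<ge> 1/2" "\<And>i. i < n \<Longrightarrow> triple (u i) (u i) e = c i *\<^sub>R e" by metis
  have "triple v v e = (\<Sum>i<n. (\<mu> i)\<^sup>2 *\<^sub>R triple (u i) (u i) e)"
    unfolding u(3) by (rule triple_orthogonal_sum[OF u(2)])
  then have "triple v v e = (\<Sum>i<n. (\<mu> i)\<^sup>2 * c i) *\<^sub>R e"
    using c by (simp add: scaleR_sum_left)
  moreover have "(norm v)\<^sup>2 / 2 \<le> (\<Sum>i<n. (\<mu> i)\<^sup>2 * c i)"
  proof -
    have "(norm v)\<^sup>2 * (1/2) \<le> (\<mu> 0)\<^sup>2 * c 0" unfolding u(5) using c(1)[OF u(4)] by (intro mult_left_mono) auto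
    also have "\<dots> \<le> (\<Sum>i<n. (\<mu> i)\<^sup>2 * c i)"
    proof (rule member_le_sum)
      show "0 \<le> (\<mu> i)\<^sup>2 * c i" if "i \<in> {..<n} - {0}" for i
        using c(1)[of i] that by (intro mult_nonneg_nonneg) auto
    qed (use u(4) in auto)
    finally show ?thesis by simp
  qed
  ultimately show ?thesis by blast
qed (auto intro!: exI[of _ 0])


subsection \<open>The norm and the Peirce components\<close>

text \<open>For a minimal tripotent \<open>e\<close> the part of \<open>z\<close> in the Peirce 1-space is \<open>coord e z *\<^sub>R e + skew e z\<close>.\<close>

definition skew :: "'e \<Rightarrow> 'e \<Rightarrow> 'e" where
  "skew e z = (1/2) *\<^sub>R (pr2 e z - triple e z e)"

definition coord :: "'e \<Rightarrow> 'e \<Rightarrow> real" where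
  "coord e z = (SOME r. (1/2) *\<^sub>R (pr2 e z + triple e z e) = r *\<^sub>R e)"

context
  fixes B e
  assumes B: "subtriple B" "kadec_klee B" and m: "minimal_tripotent B e"
begin

lemmas minimal_e = minimal_tripotentD[OF m]

lemma pr_in_subtriple:
  assumes "z \<in> B"
  shows "pr0 e z \<in> B" "pr1 e z \<in> B" "pr2 e z \<in> B" "triple e z e \<in> B" "skew e z \<in> B"
  using assms subtripleD[OF B(1)] minimal_e(1)
  by (auto simp: pr0_def[OF minimal_e(2)] pr1_def[OF minimal_e(2)] pr2_def[OF minimal_e(2)] skew_def)

lemma Q_pr2: "triple e (pr2 e z) e = triple e z e" "triple e (triple e z e) e = pr2 e z"
  by (simp_all add: pr2_def[OF minimal_e(2)] triple_simps Q_D[OF minimal_e(2)] Q_Q[OF minimal_e(2)] scaleR_2)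

lemma skew: "skew e z \<in> peirce e 1" "triple e (skew e z) e = - skew e z"
proof -
  show "skew e z \<in> peirce e 1"
    unfolding skew_def by (intro peirce_scaleR peirce_diff pr_in_peirce[OF minimal_e(2)] Q_in_peirce1[OF minimal_e(2)])
  show "triple e (skew e z) e = - skew e z"
    by (simp add: skew_def triple_simps Q_pr2 flip: scaleR_minus_right)
qed

lemma coord:
  assumes "z \<in> B"
  shows "(1/2) *\<^sub>R (pr2 e z + triple e z e) = coord e z *\<^sub>R e"
proof -
  define h where "h = (1/2) *\<^sub>R (pr2 e z + triple e z e)"
  have "h \<in> peirce e 1"
    unfolding h_def by (intro peirce_scaleR peirce_add pr_in_peirce[OF minimal_e(2)] Q_in_peirce1[OF minimal_e(2)])
  moreover have "triple e h e = h" by (simp add: h_def triple_simps Q_pr2 add.commute)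
  moreover have "h \<in> B" unfolding h_def by (intro subtripleD(5,7)[OF B(1)] pr_in_subtriple(3,4)[OF assms])
  ultimately have "\<exists>r. h = r *\<^sub>R e" using symmetric_part_minimal[OF B m] by blast
  then show ?thesis unfolding coord_def h_def by (rule someI_ex)
qed

lemma coord_eqI: "z \<in> B \<Longrightarrow> (1/2) *\<^sub>R (pr2 e z + triple e z e) = r *\<^sub>R e \<Longrightarrow> coord e z = r"
  using coord minimal_e(3) by simp

lemma pr2_eq:
  assumes "z \<in> B"
  shows "pr2 e z = coord e z *\<^sub>R e + skew e z"
  by (simp add: skew_def algebra_simps flip: coord[OF assms] scaleR_left_distrib)

lemma coord_add:
  assumes "x \<in> B" "y \<in> B"
  shows "coord e (x + y) = coord e x + coord e y"
proof (rule coord_eqI)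
  show "x + y \<in> B" using assms subtripleD(5)[OF B(1)] by blast
  have "(1/2) *\<^sub>R (pr2 e (x + y) + triple e (x + y) e)
      = (1/2) *\<^sub>R (pr2 e x + triple e x e) + (1/2) *\<^sub>R (pr2 e y + triple e y e)"
    by (simp add: pr_linear[OF minimal_e(2)] triple_simps algebra_simps)
  also have "\<dots> = (coord e x + coord e y) *\<^sub>R e"
    unfolding coord[OF assms(1)] coord[OF assms(2)] by (simp add: scaleR_left_distrib)
  finally show "(1/2) *\<^sub>R (pr2 e (x + y) + triple e (x + y) e) = (coord e x + coord e y) *\<^sub>R e" .
qed

lemma coord_scaleR: "x \<in> B \<Longrightarrow> coord e (r *\<^sub>R x) = r * coord e x"
  using subtripleD(7)[OF B(1), of x r] coord[of x]
  by (intro coord_eqI) (simp_all add: pr_linear[OF minimal_e(2)] triple_simps flip: scaleR_scaleR scaleR_right_distrib add: scaleR_left_commute)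

lemma coord_e: "coord e (r *\<^sub>R e) = r"
proof (rule coord_eqI)
  show "r *\<^sub>R e \<in> B" using minimal_e(1) subtripleD(7)[OF B(1)] by blast
  have "pr2 e e = e" using pr_peirce(9)[OF minimal_e(2) tripotent_in_peirce[OF minimal_e(2)]] .
  then show "(1/2) *\<^sub>R (pr2 e (r *\<^sub>R e) + triple e (r *\<^sub>R e) e) = r *\<^sub>R e"
    by (simp add: pr_linear[OF minimal_e(2)] triple_simps minimal_e(4) flip: scaleR_2)
qed

lemma coord_peirce:
  assumes "x \<in> B" "x \<in> peirce e c" "c \<noteq> 1"
  shows "coord e x = 0"
proof (rule coord_eqI)
  consider "c = 0" | "c = 1/2" | "x = 0" using peirce_trivial[OF minimal_e(2) assms(2)] assms(3) by blast
  then have "pr2 e x = 0"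
  proof cases
    case 1
    then show ?thesis using pr_peirce(7)[OF minimal_e(2)] assms(2) by simp
  next
    case 2
    with assms(2) have "x \<in> peirce e (1/2)" by (simp only:)
    then show ?thesis by (rule pr_peirce(8)[OF minimal_e(2)])
  next
    case 3
    then show ?thesis using pr_linear(6)[OF minimal_e(2), of 0 x] by simp
  qed
  then show "(1/2) *\<^sub>R (pr2 e x + triple e x e) = 0 *\<^sub>R e"
    using Q_peirce[OF minimal_e(2) assms(2,3)] by simp
qed (rule assms)

lemma abs_coord_le:
  assumes "x \<in> B"
  shows "\<bar>coord e x\<bar> \<le> norm x"
proof -
  have "(coord e x)\<^sup>2 \<le> (norm (pr2 e x))\<^sup>2"
    unfolding pr2_eq[OF assms] skew_minimal(2)[OF B m pr_in_subtriple(5)[OF assms] skew] by simp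
  also have "\<dots> \<le> (norm x)\<^sup>2" using norm_pr_le(2)[OF minimal_e(2)] by (intro power_mono) auto
  finally show ?thesis using abs_le_square_iff[of "coord e x" "norm x"] by simp
qed

lemma coord_dual: "coord e \<in> dual_on B"
  unfolding dual_on_def using coord_add coord_scaleR abs_coord_le by (auto intro!: exI[of _ 1])

text \<open>In the expansion of {z, z, e} a mixed product of components for i and j lies in
  \<open>peirce e (i - j + 1)\<close>, which \<open>coord e\<close> kills; only the three diagonal
  terms remain.\<close>

lemma coord_triple_self:
  assumes z: "z \<in> B"
  shows "coord e (triple z z e) \<ge> (coord e z)\<^sup>2 + (norm (skew e z))\<^sup>2 + (norm (pr1 e z))\<^sup>2 / 2"
proof -
  define p v w where "p = pr2 e z" and "v = pr1 e z" and "w = pr0 e z"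
  have zsum: "z = p + v + w" using pr_sum[OF minimal_e(2), of z] by (simp add: p_def v_def w_def algebra_simps)
  have pB: "p \<in> B" "v \<in> B" "w \<in> B" using pr_in_subtriple[OF z] by (simp_all add: p_def v_def w_def)
  have pp: "p \<in> peirce e 1" "v \<in> peirce e (1/2)" "w \<in> peirce e 0" "e \<in> peirce e 1"
    using pr_in_peirce[OF minimal_e(2)] tripotent_in_peirce[OF minimal_e(2)] by (simp_all add: p_def v_def w_def)
  have tB: "triple x y e \<in> B" if "x \<in> B" "y \<in> B" for x y using subtripleD(3)[OF B(1)] that minimal_e(1) by blast
  have off: "coord e (triple x y e) = 0"
    if "x \<in> B" "y \<in> B" "x \<in> peirce e i" "y \<in> peirce e j" "i \<noteq> j" for x y i j
    using peirce_triple[OF that(3,4) pp(4)] that by (intro coord_peirce[OF tB]) auto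
  define \<alpha> s where "\<alpha> = coord e z" and "s = skew e z"
  have ps: "p = \<alpha> *\<^sub>R e + s" unfolding p_def \<alpha>_def s_def by (rule pr2_eq[OF z])
  have s: "s \<in> B" "s \<in> peirce e 1" "triple e s e = - s"
    using pr_in_subtriple(5)[OF z] skew by (simp_all add: s_def)
  have se: "triple s e e = s" using s(2) by (simp add: peirce_def triple_commute[of s e e])
  have "triple p p e = (\<alpha>\<^sup>2 + (norm s)\<^sup>2) *\<^sub>R e"
    by (simp add: ps triple_simps minimal_e(4) s(3) se skew_minimal(1)[OF B m s] power2_eq_square algebra_simps)
  then have 1: "coord e (triple p p e) = \<alpha>\<^sup>2 + (norm s)\<^sup>2" by (simp add: coord_e)
  obtain c where c: "c \<ge> (norm v)\<^sup>2 / 2" "triple v v e = c *\<^sub>R e"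
    using half_minimal[OF B m pB(2) pp(2)] by blast
  then have 2: "coord e (triple v v e) \<ge> (norm v)\<^sup>2 / 2" by (simp add: coord_e)
  have "triple w w e = 0" using orthD[OF orth_peirce0[OF minimal_e(2) pp(3)]] by simp
  then have 3: "coord e (triple w w e) = 0" using coord_e[of 0] by simp
  have "triple z z e = triple p p e + triple v v e + triple w w e + triple p v e + triple v p e
      + triple p w e + triple w p e + triple v w e + triple w v e"
    by (simp add: zsum triple_simps)
  then have "coord e (triple z z e) = coord e (triple p p e) + coord e (triple v v e) + coord e (triple w w e)"
    using pB off[OF _ _ pp(1) pp(2)] off[OF _ _ pp(2) pp(1)] off[OF _ _ pp(1) pp(3)] off[OF _ _ pp(3) pp(1)]
      off[OF _ _ pp(2) pp(3)] off[OF _ _ pp(3) pp(2)]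
    by (simp add: coord_add tB subtripleD(5)[OF B(1)])
  then show ?thesis using 1 2 3 by (simp add: \<alpha>_def s_def v_def)
qed

text \<open>It remains to bound \<open>coord e (triple z z e)\<close> by the squared norm of z. The
  spectral decomposition replaces all coefficients by \<open>norm z\<close>, leaving the tripotent
  U, for which L(U, U) is known to be contractive.\<close>

lemma peirce_norm_inequality:
  assumes z: "z \<in> B"
  shows "(coord e z)\<^sup>2 + (norm (skew e z))\<^sup>2 + (norm (pr1 e z))\<^sup>2 / 2 \<le> (norm z)\<^sup>2"
proof -
  obtain n :: nat and u \<mu> where u: "\<And>i. i < n \<Longrightarrow> u i \<in> B \<and> tripotent (u i) \<and> 0 \<le> \<mu> i \<and> \<mu> i \<le> norm z"
    "\<And>i j. i < n \<Longrightarrow> j < n \<Longrightarrow> i \<noteq> j \<Longrightarrow> orth (u i) (u j)"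
    "z = (\<Sum>i<n. \<mu> i *\<^sub>R u i)"
    using z by (rule spectral_decomposition[OF B]) blast
  define c where "c i = coord e (triple (u i) (u i) e)" for i
  have tB: "triple (u i) (u i) e \<in> B" if "i \<in> {..<n}" for i
    using u(1) that minimal_e(1) subtripleD(3)[OF B(1)] by auto
  have "0 \<le> c i" if "i < n" for i
    using coord_triple_self[of "u i"] u(1)[OF that] by (auto simp: c_def intro: order_trans[rotated])
  define U where "U = (\<Sum>i<n. u i)"
  have "tripotent (\<Sum>i<k. u i)" if "k \<le> n" for k using that
  proof (induction k)
    case (Suc k)
    have "orth (u k) (\<Sum>i<k. u i)" using Suc.prems u(2) by (intro orth_sum) auto
    then show ?case using Suc u(1)[of k] by (auto intro!: tripotent_add_orth orth_sym)
  qed (simp add: tripotent_zero)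
  then have U: "tripotent U" by (simp add: U_def)
  have "U \<in> B" unfolding U_def using u(1) by (intro Real_Vector_Spaces.subspace_sum[OF subtripleD(1)[OF B(1)]]) auto
  then have UB: "triple U U e \<in> B" using minimal_e(1) subtripleD(3)[OF B(1)] by blast
  have "triple z z e = (\<Sum>i<n. (\<mu> i)\<^sup>2 *\<^sub>R triple (u i) (u i) e)"
    unfolding u(3) by (rule triple_orthogonal_sum[OF u(2)])
  then have "coord e (triple z z e) = (\<Sum>i<n. (\<mu> i)\<^sup>2 * c i)"
    using dual_on_sum[OF coord_dual subtripleD(1)[OF B(1)] tB, of "{..<n}" "\<lambda>i. i" "\<lambda>i. (\<mu> i)\<^sup>2"] by (simp add: c_def)
  also have "\<dots> \<le> (\<Sum>i<n. (norm z)\<^sup>2 * c i)"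
    using u(1) \<open>\<And>i. i < n \<Longrightarrow> 0 \<le> c i\<close> by (intro sum_mono mult_right_mono power_mono) auto
  also have "\<dots> = (norm z)\<^sup>2 * coord e (triple U U e)"
    using dual_on_sum[OF coord_dual subtripleD(1)[OF B(1)] tB, of "{..<n}" "\<lambda>i. i" "\<lambda>i. 1"]
      triple_orthogonal_sum[OF u(2), where \<mu> = "\<lambda>i. 1" and x = e]
    by (simp add: c_def U_def sum_distrib_left)
  also have "\<dots> \<le> (norm z)\<^sup>2 * 1"
  proof (intro mult_left_mono)
    have "coord e (triple U U e) \<le> norm (triple U U e)" using abs_coord_le[OF UB] by simp
    also have "\<dots> \<le> 1" using norm_pr_le(3)[OF U, of e] minimal_e(5) by simp
    finally show "coord e (triple U U e) \<le> 1" .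
  qed simp
  finally show ?thesis using coord_triple_self[OF z] by simp
qed

text \<open>Scaled into the unit ball by R, the Peirce 0-components can be added to e without
  changing its norm, so the Kadec-Klee property at e applies to them.\<close>

lemma pr0_weakly_null_imp_null:
  assumes x: "\<And>n. x n \<in> B" "\<And>n. norm (x n) \<le> 1" and l: "l \<in> B" and w: "weakly_tendsto_on B x l"
  shows "(\<lambda>n. pr0 e (x n - l)) \<longlonglongrightarrow> 0"
proof -
  define R where "R = 1 + norm l"
  have "R > 0" by (simp add: R_def add_pos_nonneg)
  define h where "h n = (1 / R) *\<^sub>R pr0 e (x n - l)" for n
  have hB: "h n \<in> B" for n
    unfolding h_def using pr_in_subtriple(1)[OF subtripleD(6)[OF B(1) x(1) l]] subtripleD(7)[OF B(1)] by blast
  have "norm (pr0 e (x n - l)) \<le> R" for n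
    using norm_pr_le(1)[OF minimal_e(2), of "x n - l"] norm_triangle_ineq4[of "x n" l] x(2)[of n] by (simp add: R_def)
  then have h1: "norm (h n) \<le> 1" for n using \<open>R > 0\<close> by (simp add: h_def)
  have h0: "h n \<in> peirce e 0" for n
    unfolding h_def by (intro peirce_scaleR pr_in_peirce[OF minimal_e(2)])
  have "h \<longlonglongrightarrow> 0"
  proof (rule kadec_klee_perturbation[OF B(2) subtripleD(1)[OF B(1)] minimal_e(1,5) hB])
    show "norm (e + h n) = 1" for n by (rule norm_add_orth[OF minimal_e(2,3) h0 h1])
    fix f assume f: "f \<in> dual_on B"
    then obtain K where K: "\<And>x. x \<in> B \<Longrightarrow> \<bar>f x\<bar> \<le> K * norm x" unfolding dual_on_def by blast
    have f_lin: "f (x + y) = f x + f y" "f (r *\<^sub>R x) = r * f x" if "x \<in> B" "y \<in> B" for x y r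
      using f that by (auto simp: dual_on_def)
    have "\<bar>f (pr0 e x)\<bar> \<le> \<bar>K\<bar> * norm x" if "x \<in> B" for x
    proof -
      have "\<bar>f (pr0 e x)\<bar> \<le> K * norm (pr0 e x)" using K pr_in_subtriple(1)[OF that] by blast
      also have "\<dots> \<le> \<bar>K\<bar> * norm x" using norm_pr_le(1)[OF minimal_e(2)] by (intro mult_mono) auto
      finally show ?thesis .
    qed
    then have "(\<lambda>x. f (pr0 e x)) \<in> dual_on B"
      using f_lin pr_in_subtriple(1) by (auto simp: dual_on_def pr_linear[OF minimal_e(2)])
    then have "(\<lambda>n. f (pr0 e (x n))) \<longlonglongrightarrow> f (pr0 e l)" using w unfolding weakly_tendsto_on_def by (auto dest: bspec)
    then have lim: "(\<lambda>n. (1 / R) * (f (pr0 e (x n)) - f (pr0 e l))) \<longlonglongrightarrow> (1 / R) * (f (pr0 e l) - f (pr0 e l))"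
      by (intro tendsto_intros)
    have "f (h n) = (1 / R) * (f (pr0 e (x n)) - f (pr0 e l))" for n
    proof -
      have "h n = (1 / R) *\<^sub>R (pr0 e (x n) + (-1) *\<^sub>R pr0 e l)"
        using pr_linear(1)[OF minimal_e(2), of "x n" "(-1) *\<^sub>R l"] pr_linear(4)[OF minimal_e(2), of "-1" l] by (simp add: h_def)
      moreover have "pr0 e (x n) \<in> B" "pr0 e l \<in> B" using pr_in_subtriple(1) x l by auto
      ultimately show ?thesis
        using f_lin subtripleD[OF B(1)] by (metis (no_types, lifting) mult_minus1 uminus_add_conv_diff add.commute)
    qed
    then show "(\<lambda>n. f (h n)) \<longlonglongrightarrow> 0" using lim by simp
  qed
  then have "(\<lambda>n. R *\<^sub>R h n) \<longlonglongrightarrow> R *\<^sub>R 0" by (intro tendsto_intros)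
  then show ?thesis using \<open>R > 0\<close> by (simp add: h_def)
qed

end

section \<open>The uniform estimate\<close>

lemma minimal_tripotent_decomposition:
  assumes B: "subtriple B" "kadec_klee B" and l: "l \<in> B" "l \<noteq> 0"
  obtains e l' where "minimal_tripotent B e" "l' \<in> B" "l' \<in> peirce e 0" "l = norm l *\<^sub>R e + l'"
proof -
  obtain t where t: "t \<in> B" "tripotent t" "t \<noteq> 0" "l - norm l *\<^sub>R t \<in> peirce t 0"
    using top_tripotent[OF B l] by blast
  obtain e g where e: "minimal_tripotent B e" "g \<in> B" "tripotent g" "orth e g" "t = e + g"
    using exists_minimal_tripotent[OF B t(1-3)] by blast
  note eD = minimal_tripotentD[OF e(1)]
  \<comment> \<open>Being below t, e is orthogonal to everything orthogonal to t; the complementary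
    piece g of t joins the remainder.\<close>
  have "e \<in> peirce t 1" unfolding e(5) peirce_def
    using e(4) eD(4) by (simp add: triple_add_orth(1) orthD)
  then have "orth e (l - norm l *\<^sub>R t)" by (rule orth_peirce1_peirce0[OF t(2) _ t(4)])
  then have "orth e (norm l *\<^sub>R g + (l - norm l *\<^sub>R t))" by (intro orth_add orth_scaleR e(4))
  then have "norm l *\<^sub>R g + (l - norm l *\<^sub>R t) \<in> peirce e 0" using orth_iff_peirce0[OF eD(2)] by blast
  moreover have "norm l *\<^sub>R g + (l - norm l *\<^sub>R t) \<in> B"
    by (intro subtripleD(5-7)[OF B(1)] l e(2) t(1))
  moreover have "l = norm l *\<^sub>R e + (norm l *\<^sub>R g + (l - norm l *\<^sub>R t))"
    by (simp add: e(5) algebra_simps)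
  ultimately show thesis using that e(1) by blast
qed

lemma kadec_klee_imp_uniform:
  assumes B: "subtriple B" "kadec_klee B"
  shows "uniform_kadec_klee B"
  unfolding uniform_kadec_klee_def
proof (intro allI impI)
  fix \<epsilon> :: real assume "\<epsilon> > 0"
  \<comment> \<open>The skew and Peirce 1/2 parts contribute in the limit at most 2 sqrt(4 \<delta>)
    <= 4 \<epsilon> / 10 < \<epsilon> / 2, so late terms lie within \<epsilon> / 2 of l. The bound
    1/2 ensures that l is nonzero.\<close>
  define \<delta> where "\<delta> = min (1/2) ((\<epsilon> / 10)\<^sup>2)"
  have \<delta>: "0 < \<delta>" "\<delta> \<le> 1/2" "\<delta> \<le> (\<epsilon> / 10)\<^sup>2" using \<open>\<epsilon> > 0\<close> by (simp_all add: \<delta>_def)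
  have sqrt_\<delta>: "sqrt \<delta> \<le> \<epsilon> / 10" by (rule real_le_lsqrt) (use \<delta> \<open>\<epsilon> > 0\<close> in auto)
  show "\<exists>\<delta>>0. \<forall>x l. (\<forall>n. x n \<in> B \<and> norm (x n) \<le> 1) \<and> \<epsilon> \<le> sep x \<and> l \<in> B \<and> weakly_tendsto_on B x l
      \<longrightarrow> norm l < 1 - \<delta>"
  proof (intro exI[of _ \<delta>] conjI allI impI \<delta>(1))
    fix x :: "nat \<Rightarrow> 'e" and l
    assume "(\<forall>n. x n \<in> B \<and> norm (x n) \<le> 1) \<and> \<epsilon> \<le> sep x \<and> l \<in> B \<and> weakly_tendsto_on B x l"
    then have x: "\<And>n. x n \<in> B" "\<And>n. norm (x n) \<le> 1" and sep: "\<epsilon> \<le> sep x" and l: "l \<in> B"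
      and w: "weakly_tendsto_on B x l" by auto
    show "norm l < 1 - \<delta>"
    proof (rule ccontr)
      assume "\<not> ?thesis"
      then have nl: "norm l \<ge> 1 - \<delta>" by simp
      then have "l \<noteq> 0" using \<delta> by auto
      obtain e l' where m: "minimal_tripotent B e" and l': "l' \<in> B" "l' \<in> peirce e 0" "l = norm l *\<^sub>R e + l'"
        using minimal_tripotent_decomposition[OF B l \<open>l \<noteq> 0\<close>] by blast
      note e = minimal_tripotentD[OF m]
      have ep: "norm l *\<^sub>R e \<in> peirce e 1" by (intro peirce_scaleR tripotent_in_peirce[OF e(2)])
      have "coord e l = coord e (norm l *\<^sub>R e) + coord e l'"
        using coord_add[OF B m _ l'(1)] subtripleD(7)[OF B(1) e(1)] l'(3) by metis
      then have cl: "coord e l = norm l"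
        using coord_e[OF B m] coord_peirce[OF B m l'(1,2)] by simp
      have "pr1 e l = pr1 e (norm l *\<^sub>R e) + pr1 e l'" using pr_linear(2)[OF e(2)] l'(3) by metis
      then have pl: "pr1 e l = 0" using pr_peirce(4,6)[OF e(2)] ep l'(2) by simp
      have pr2l: "pr2 e l = norm l *\<^sub>R e"
        using pr_linear(3)[OF e(2), of "norm l *\<^sub>R e" l'] pr_peirce(7,9)[OF e(2)] ep l' by simp
      then have sl: "skew e l = 0" using pr2_eq[OF B m l] cl by simp
      define a where "a n = coord e (x n)" for n
      have a_lim: "a \<longlonglongrightarrow> norm l"
        using w coord_dual[OF B m] unfolding weakly_tendsto_on_def a_def cl[symmetric] by blast
      have pr0_lim: "(\<lambda>n. pr0 e (x n - l)) \<longlonglongrightarrow> 0" by (rule pr0_weakly_null_imp_null[OF B m x l w])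
      define b where "b n = \<bar>a n - norm l\<bar> + 2 * sqrt (2 * (1 - (a n)\<^sup>2)) + norm (pr0 e (x n - l))" for n
      have bound: "norm (x n - l) \<le> b n" for n
      proof -
        have ineq: "(a n)\<^sup>2 + (norm (skew e (x n)))\<^sup>2 + (norm (pr1 e (x n)))\<^sup>2 / 2 \<le> 1"
          using peirce_norm_inequality[OF B m x(1)[of n]] power_le_one[of "norm (x n)" 2] x(2)[of n]
          by (simp add: a_def)
        \<comment> \<open>The factor 2 is forced by the coefficient 1/2 of the Peirce 1/2 part;
          using it for the skew part too gives one common bound.\<close>
        have aux: "S \<le> 2 * (1 - A) \<and> P \<le> 2 * (1 - A)"
          if "A + S + P / 2 \<le> 1" "0 \<le> S" "0 \<le> P" for A S P :: real using that by auto
        have s: "norm (skew e (x n)) \<le> sqrt (2 * (1 - (a n)\<^sup>2))"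
          using aux[OF ineq] by (intro real_le_rsqrt) simp
        have p: "norm (pr1 e (x n)) \<le> sqrt (2 * (1 - (a n)\<^sup>2))"
          using aux[OF ineq] by (intro real_le_rsqrt) simp
        have x_eq: "x n = pr0 e (x n) + pr1 e (x n) + (a n *\<^sub>R e + skew e (x n))"
          using pr_sum[OF e(2), of "x n"] pr2_eq[OF B m x(1)[of n]] by (simp add: a_def)
        have l_eq: "l = pr0 e l + norm l *\<^sub>R e"
          using pr_sum[OF e(2), of l] by (simp add: pl pr2l)
        have "x n - l = (pr0 e (x n) + pr1 e (x n) + (a n *\<^sub>R e + skew e (x n))) - (pr0 e l + norm l *\<^sub>R e)"
          using x_eq l_eq by (rule arg_cong2)
        also have "\<dots> = (a n - norm l) *\<^sub>R e + skew e (x n) + pr1 e (x n) + (pr0 e (x n) - pr0 e l)"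
          by (simp add: algebra_simps)
        also have "pr0 e (x n) - pr0 e l = pr0 e (x n - l)"
          using pr_linear(1)[OF e(2), of "x n - l" l] by simp
        finally have "x n - l = (a n - norm l) *\<^sub>R e + skew e (x n) + pr1 e (x n) + pr0 e (x n - l)" .
        from arg_cong[where f = norm, OF this]
        have "norm (x n - l) \<le> norm ((a n - norm l) *\<^sub>R e) + norm (skew e (x n)) + norm (pr1 e (x n))
            + norm (pr0 e (x n - l))"
          by (rule ord_eq_le_trans) (intro norm_triangle_mono order_refl)
        also have "\<dots> \<le> b n" using s p e(5) by (simp add: b_def)
        finally show ?thesis .
      qed
      have "b \<longlonglongrightarrow> \<bar>norm l - norm l\<bar> + 2 * sqrt (2 * (1 - (norm l)\<^sup>2)) + norm (0 :: 'e)"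
        unfolding b_def by (intro tendsto_intros a_lim pr0_lim)
      moreover have "2 * sqrt (2 * (1 - (norm l)\<^sup>2)) < \<epsilon> / 2"
      proof -
        have "(1 - \<delta>)\<^sup>2 \<le> (norm l)\<^sup>2" using nl \<delta> by (intro power_mono) auto
        moreover have "1 - 2 * \<delta> \<le> (1 - \<delta>)\<^sup>2" by (simp add: power2_diff)
        ultimately have "1 - 2 * \<delta> \<le> (norm l)\<^sup>2" by simp
        then have "2 * (1 - (norm l)\<^sup>2) \<le> 4 * \<delta>" by (simp add: algebra_simps)
        then have "sqrt (2 * (1 - (norm l)\<^sup>2)) \<le> 2 * sqrt \<delta>"
          using real_sqrt_le_mono[of "2 * (1 - (norm l)\<^sup>2)" "4 * \<delta>"] by (simp add: real_sqrt_mult)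
        then show ?thesis using sqrt_\<delta> \<open>\<epsilon> > 0\<close> by simp
      qed
      ultimately have "eventually (\<lambda>n. b n < \<epsilon> / 2) sequentially"
        by (intro order_tendstoD(2)) auto
      then obtain N where N: "\<And>n. n \<ge> N \<Longrightarrow> b n < \<epsilon> / 2" by (auto simp: eventually_sequentially)
      have "norm (x N - x (Suc N)) \<le> norm (x N - l) + norm (x (Suc N) - l)"
        using norm_triangle_ineq4[of "x N - l" "x (Suc N) - l"] by simp
      also have "\<dots> < \<epsilon>" using bound[of N] bound[of "Suc N"] N[of N] N[of "Suc N"] by simp
      finally show False using sep sep_le[of N "Suc N" x] by simp
    qed
  qed
qed

end

theorem proposition4p4:
  fixes scaleC :: "complex \<Rightarrow> 'e::banach \<Rightarrow> 'e"
    and triple :: "'e \<Rightarrow> 'e \<Rightarrow> 'e \<Rightarrow> 'e"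
    and A :: "'e set"
  assumes "real_jb_star_triple scaleC triple A"
  shows "kadec_klee A \<longleftrightarrow> uniform_kadec_klee A"
proof -
  interpret real_jb_star_triple scaleC triple A by (rule assms)
  have "subtriple A" unfolding subtriple_def using subspace_A closed_A triple_closed by blast
  then show ?thesis
    using kadec_klee_imp_uniform uniform_kadec_klee_imp_kadec_klee[OF subspace_A closed_A] by blast
qed

end
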